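(* (i) For any $0<\theta_1<\theta_2<\theta_3<\theta_4<\pi$ there exists a positive constant $C$, depending only on $\theta_1,\theta_2,\theta_3,\theta_4$, such that for every $0<\nu<1$ and every $(-1)$-homogeneous axisymmetric no-swirl solution $(u_\nu,p_\nu)$ of the stationary Navier-Stokes equations with viscosity $\nu$ which is smooth on $\mathbb{S}^2\setminus\{S,N\}$, $$\int_{\mathbb{S}^2\cap\{\theta_1<\theta<\theta_4\}}|u_{\nu,\theta}|^2\le C\left(\int_{\mathbb{S}^2\cap\{\theta_2<\theta<\theta_3\}}|u_{\nu,\theta}|^2+\nu^2\right).$$ (ii) Let $\nu_k\to 0^+$ and let $(u_{\nu_k},p_{\nu_k})$ be $(-1)$-homogeneous axisymmetric no-swirl solutions of the stationary Navier-Stokes equations with viscosity $\nu_k$ which are smooth on $\mathbb{S}^2\setminus\{S,N\}$. If $$\sup_k \nu_k^{-2}\int_{\mathbb{S}^2\cap\{a<\theta<b\}}|u_{\nu_k,\theta}|^2<\infty$$ for some $0<a<b<\pi$, then there exists a solution $(\tilde u,\tilde p)$ of the stationary Navier-Stokes equations with viscosity $\nu=1$ which is smooth on $\mathbb{S}^2\setminus\{S,N\}$ such that, after passing to a subsequence, for any $\epsilon>0$ and any integer $m$, $$\lim_{k\to\infty}\left\|\left(\frac{u_{\nu_k}}{\nu_k},\frac{p_{\nu_k}}{\nu_k^2}\right)-(\tilde u,\tilde p)\right\|_{C^m(\mathbb{S}^2\cap\{\epsilon<\theta<\pi-\epsilon\})}=0.$$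
   Context: The stationary Navier-Stokes equations in $\mathbb{R}^3$ with viscosity $\nu>0$ are $-\nu\Delta u+u\cdot\nabla u+\nabla p=0$, $\operatorname{div}u=0$. A solution $(u,p)$ is called $(-1)$-homogeneous if $u$ is homogeneous of degree $-1$ and $p$ is homogeneous of degree $-2$; such a solution is determined by its restriction to the unit sphere $\mathbb{S}^2$, and "smooth on $\mathbb{S}^2\setminus\{S,N\}$" means it is smooth (and solves the equations) in the cone over $\mathbb{S}^2\setminus\{S,N\}$, where $N,S$ are the north and south poles. Spherical coordinates $(r,\theta,\phi)$: $r$ is the distance to the origin, $\theta$ the angle with the positive $x_3$-axis, $\phi$ the meridian angle about the $x_3$-axis; $u=u_r\vec e_r+u_\theta\vec e_\theta+u_\phi\vec e_\phi$ in the corresponding orthonormal frame. $u$ is axisymmetric if $u_r,u_\theta,u_\phi$ depend only on $r,\theta$, and no-swirl if $u_\phi=0$. The notation $u_{\nu,\theta}$ denotes the $\theta$-component of $u_\nu$. *)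

theory Defs
  imports "HOL-Analysis.Analysis"
begin

section \<open>Differential operators and smoothness\<close>

definition pd :: "'a::euclidean_space \<Rightarrow> ('a \<Rightarrow> 'b::real_normed_vector) \<Rightarrow> 'a \<Rightarrow> 'b" where
  "pd b f x = frechet_derivative f (at x) b"

abbreviation iter_pd :: "'a::euclidean_space list \<Rightarrow> ('a \<Rightarrow> 'b::real_normed_vector) \<Rightarrow> 'a \<Rightarrow> 'b" where
  "iter_pd bs f \<equiv> foldr pd bs f"

text \<open>Meant for open \<open>S\<close>, where differentiability of all iterated partial derivatives is
  \<open>C\<^sup>\<infinity>\<close>-smoothness; the values of \<open>f\<close> outside \<open>S\<close> are then irrelevant.\<close>
definition smooth_on :: "'a::euclidean_space set \<Rightarrow> ('a \<Rightarrow> 'b::real_normed_vector) \<Rightarrow> bool" where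
  "smooth_on S f \<longleftrightarrow>
     (\<forall>bs. set bs \<subseteq> Basis \<longrightarrow> (\<forall>x\<in>S. iter_pd bs f differentiable (at x)))"

definition laplacian :: "('a::euclidean_space \<Rightarrow> 'b::real_normed_vector) \<Rightarrow> 'a \<Rightarrow> 'b" where
  "laplacian f x = (\<Sum>b\<in>Basis. pd b (pd b f) x)"

definition gradient :: "('a::euclidean_space \<Rightarrow> real) \<Rightarrow> 'a \<Rightarrow> 'a" where
  "gradient f x = (\<Sum>b\<in>Basis. pd b f x *\<^sub>R b)"

definition divergence :: "('a::euclidean_space \<Rightarrow> 'a) \<Rightarrow> 'a \<Rightarrow> real" where
  "divergence u x = (\<Sum>b\<in>Basis. pd b u x \<bullet> b)"

definition convection :: "('a::euclidean_space \<Rightarrow> 'a) \<Rightarrow> 'a \<Rightarrow> 'a" where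
  "convection u x = (\<Sum>b\<in>Basis. (u x \<bullet> b) *\<^sub>R pd b u x)"

definition homogeneous_on ::
    "'a::real_normed_vector set \<Rightarrow> int \<Rightarrow> ('a \<Rightarrow> 'b::real_normed_vector) \<Rightarrow> bool" where
  "homogeneous_on S d f \<longleftrightarrow> (\<forall>x\<in>S. \<forall>t>0. f (t *\<^sub>R x) = (t powi d) *\<^sub>R f x)"

section \<open>Spherical coordinates\<close>

definition sph :: "real \<Rightarrow> real \<Rightarrow> real \<Rightarrow> real^3" where
  "sph r \<theta> \<phi> = vector [r * sin \<theta> * cos \<phi>, r * sin \<theta> * sin \<phi>, r * cos \<theta>]"

definition e_r :: "real \<Rightarrow> real \<Rightarrow> real^3" where
  "e_r \<theta> \<phi> = vector [sin \<theta> * cos \<phi>, sin \<theta> * sin \<phi>, cos \<theta>]"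

definition e_theta :: "real \<Rightarrow> real \<Rightarrow> real^3" where
  "e_theta \<theta> \<phi> = vector [cos \<theta> * cos \<phi>, cos \<theta> * sin \<phi>, - sin \<theta>]"

definition e_phi :: "real \<Rightarrow> real \<Rightarrow> real^3" where
  "e_phi \<theta> \<phi> = vector [- sin \<phi>, cos \<phi>, 0]"

definition comp_r :: "(real^3 \<Rightarrow> real^3) \<Rightarrow> real \<Rightarrow> real \<Rightarrow> real \<Rightarrow> real" where
  "comp_r u r \<theta> \<phi> = u (sph r \<theta> \<phi>) \<bullet> e_r \<theta> \<phi>"

definition comp_theta :: "(real^3 \<Rightarrow> real^3) \<Rightarrow> real \<Rightarrow> real \<Rightarrow> real \<Rightarrow> real" where
  "comp_theta u r \<theta> \<phi> = u (sph r \<theta> \<phi>) \<bullet> e_theta \<theta> \<phi>"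

definition comp_phi :: "(real^3 \<Rightarrow> real^3) \<Rightarrow> real \<Rightarrow> real \<Rightarrow> real \<Rightarrow> real" where
  "comp_phi u r \<theta> \<phi> = u (sph r \<theta> \<phi>) \<bullet> e_phi \<theta> \<phi>"

definition axisymmetric :: "(real^3 \<Rightarrow> real^3) \<Rightarrow> bool" where
  "axisymmetric u \<longleftrightarrow>
     (\<forall>r>0. \<forall>\<theta>\<in>{0<..<pi}. \<forall>\<phi> \<phi>'.
        comp_r u r \<theta> \<phi> = comp_r u r \<theta> \<phi>' \<and>
        comp_theta u r \<theta> \<phi> = comp_theta u r \<theta> \<phi>' \<and>
        comp_phi u r \<theta> \<phi> = comp_phi u r \<theta> \<phi>')"

definition no_swirl :: "(real^3 \<Rightarrow> real^3) \<Rightarrow> bool" where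
  "no_swirl u \<longleftrightarrow> (\<forall>r>0. \<forall>\<theta>\<in>{0<..<pi}. \<forall>\<phi>. comp_phi u r \<theta> \<phi> = 0)"

section \<open>Homogeneous solutions of the stationary Navier-Stokes equations\<close>

definition north :: "real^3" where "north = vector [0, 0, 1]"

definition south :: "real^3" where "south = vector [0, 0, -1]"

definition cone_over :: "'a::real_normed_vector set \<Rightarrow> 'a set" where
  "cone_over A = {t *\<^sub>R x | t x. 0 < t \<and> x \<in> A}"

abbreviation punctured_cone :: "(real^3) set" where
  "punctured_cone \<equiv> cone_over (sphere 0 1 - {south, north})"

definition NS_solution ::
    "real \<Rightarrow> (real^3) set \<Rightarrow> (real^3 \<Rightarrow> real^3) \<Rightarrow> (real^3 \<Rightarrow> real) \<Rightarrow> bool" where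
  "NS_solution \<nu> S u p \<longleftrightarrow>
     smooth_on S u \<and> smooth_on S p \<and>
     (\<forall>x\<in>S. - \<nu> *\<^sub>R laplacian u x + convection u x + gradient p x = 0 \<and> divergence u x = 0)"

definition hom_NS_solution ::
    "real \<Rightarrow> (real^3 \<Rightarrow> real^3) \<Rightarrow> (real^3 \<Rightarrow> real) \<Rightarrow> bool" where
  "hom_NS_solution \<nu> u p \<longleftrightarrow>
     NS_solution \<nu> punctured_cone u p \<and>
     homogeneous_on punctured_cone (-1) u \<and> homogeneous_on punctured_cone (-2) p"

section \<open>Integrals and norms on zones of the unit sphere\<close>

text \<open>The surface integral over the part \<open>a < \<theta> < b\<close> of the unit sphere, for
  \<open>0 \<le> a\<close> and \<open>b \<le> \<pi>\<close>; the surface element is \<open>sin \<theta> d\<theta> d\<phi>\<close>.\<close>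
definition zone_integral :: "real \<Rightarrow> real \<Rightarrow> (real \<Rightarrow> real \<Rightarrow> real) \<Rightarrow> real" where
  "zone_integral a b f =
     set_lebesgue_integral lborel ({a<..<b} \<times> {0..2 * pi}) (\<lambda>(\<theta>, \<phi>). f \<theta> \<phi> * sin \<theta>)"

text \<open>The supremum of all partial derivatives of order at most \<open>m\<close>; it is taken in \<^typ>\<open>ennreal\<close>,
  so that an unbounded derivative gives the value \<open>\<infinity>\<close>.\<close>
definition Cm_norm ::
    "nat \<Rightarrow> 'a::euclidean_space set \<Rightarrow> ('a \<Rightarrow> 'b::real_normed_vector) \<Rightarrow> ennreal" where
  "Cm_norm m S f =
     (SUP bs \<in> {bs. set bs \<subseteq> Basis \<and> length bs \<le> m}. SUP x\<in>S. ennreal (norm (iter_pd bs f x)))"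

text \<open>The \<open>C\<^sup>m\<close> norm on the part \<open>a < \<theta> < b\<close> of the unit sphere, for \<open>0 < a\<close> and \<open>b < \<pi>\<close>. There
  \<open>(\<theta>, \<phi>)\<close> is a regular (\<open>2\<pi>\<close>-periodic in \<open>\<phi>\<close>) parametrisation, and derivatives along the sphere
  are taken in these coordinates. Only the values of \<open>f\<close> on the sphere enter.\<close>
definition zone_Cm_norm ::
    "nat \<Rightarrow> real \<Rightarrow> real \<Rightarrow> (real^3 \<Rightarrow> 'b::real_normed_vector) \<Rightarrow> ennreal" where
  "zone_Cm_norm m a b f = Cm_norm m ({a<..<b} \<times> UNIV) (\<lambda>(\<theta>, \<phi>). f (sph 1 \<theta> \<phi>))"

end

theory Submission
  imports Defs
begin

text \<open>
  The idea is that the equations integrate three times. On the cone, a \<open>(-1)\<close>-homogeneous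
  axisymmetric field without swirl is determined by two functions of \<open>z = cos \<theta>\<close>, and
  incompressibility leaves one: \<open>V(z) = sin \<theta> u\<^sub>\<theta>\<close> at distance 1. Dividing \<open>u\<close> by \<open>\<nu>\<close> and \<open>p\<close> by
  \<open>\<nu>\<^sup>2\<close> makes the viscosity 1. Euler's identity for the homogeneous pressure expresses \<open>p\<close> through
  \<open>u\<close>, and the remaining momentum equation says that
  \<open>(1 - z\<^sup>2) V' + 2 z V + V\<^sup>2 / 2\<close> has vanishing third derivative. So \<open>V\<close> solves a Riccati equation
  whose right-hand side is a quadratic polynomial \<open>a + b z + c z\<^sup>2\<close> (\<open>solution_is_riccati\<close>), and
  conversely each such \<open>V\<close> gives a solution with viscosity 1 (\<open>riccati_gives_solution\<close>).

  Two estimates, both uniform in the polynomial, carry the theorem. First, testing the Riccati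
  equation with a function that vanishes at the ends of an interval bounds a weighted mean of the
  polynomial by a multiple of \<open>1 + \<integral> V\<^sup>2\<close>; doing this on three separated intervals bounds the polynomial at three
  separated points and therefore its coefficients (\<open>riccati_coefficient_bound\<close>). Secondly, \<open>V\<close>
  exists on all of \<open>(-1, 1)\<close>, and a large value of \<open>V\<close> would blow up before the end of the
  interval; at a maximum of a cut-off times \<open>V\<close> this becomes the inequality
  \<open>V\<^sup>2 \<le> C (1 + \<bar>a\<bar> + \<bar>b\<bar> + \<bar>c\<bar>)\<close> away from the poles (\<open>riccati_pointwise_bound\<close>).
  Together they bound \<open>V\<close> on the large zone by its square integral on the small zone, which after
  multiplication by \<open>\<nu>\<^sup>2\<close> is the first claim.

  For the second claim, the hypothesis bounds the coefficients along the sequence. After passing to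
  a subsequence the coefficients and the values \<open>V\<^sub>k(0)\<close> converge; Gronwall's inequality turns this
  into locally uniform convergence of \<open>V\<^sub>k\<close> to a solution of the limit equation
  (\<open>riccati_compactness\<close>), and the equation itself passes convergence on to all derivatives
  (\<open>riccati_smooth_conv\<close>). Velocity and pressure are built from \<open>z\<close>, \<open>V\<close> and \<open>1 / (1 - z\<^sup>2)\<close> by
  sums and products, so they converge with all derivatives too (\<open>riccati_fields_converge\<close>).
\<close>

section \<open>Convergence with derivatives\<close>

lemma pd_eq: "(f has_derivative D) (at x) \<Longrightarrow> pd b f x = D b"
  unfolding pd_def by (drule frechet_derivative_at) simp

lemma pd_cong:
  assumes "open S" "x \<in> S" "\<And>y. y \<in> S \<Longrightarrow> f y = g y"
  shows "pd b f x = pd b g x"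
proof -
  have "(f has_derivative D) (at x) \<longleftrightarrow> (g has_derivative D) (at x)" for D
    using has_derivative_transform_within_open[of f D x UNIV S g]
      has_derivative_transform_within_open[of g D x UNIV S f] assms by auto
  then show ?thesis by (simp add: pd_def frechet_derivative_def)
qed

lemma differentiable_cong_open:
  assumes "open S" "x \<in> S" "\<And>y. y \<in> S \<Longrightarrow> f y = g y" "f differentiable (at x)"
  shows "g differentiable (at x)"
  using assms has_derivative_transform_within_open[of f _ x UNIV S g]
  unfolding differentiable_def by blast

text \<open>Uniform convergence on \<open>K\<close> of the derivatives up to order \<open>n\<close>, defined by recursion so that closure
  under products and composition follows by induction on \<open>n\<close>. Boundedness of the limit is built in
  because products need it; hence \<open>K\<close> may be unbounded, such as a strip. With \<open>K\<close> empty and a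
  constant sequence the notion is plain smoothness of order \<open>n\<close>, so the same closure lemmas serve for regularity and for convergence.\<close>
primrec smooth_conv :: "nat \<Rightarrow> 'a::euclidean_space set \<Rightarrow> 'a set \<Rightarrow>
    (nat \<Rightarrow> 'a \<Rightarrow> 'b::real_normed_vector) \<Rightarrow> ('a \<Rightarrow> 'b) \<Rightarrow> bool" where
  "smooth_conv 0 S K f l \<longleftrightarrow> uniform_limit K f l sequentially \<and> bounded (l ` K)"
| "smooth_conv (Suc n) S K f l \<longleftrightarrow>
     (uniform_limit K f l sequentially \<and> bounded (l ` K)) \<and>
     (\<forall>x\<in>S. (\<forall>k. f k differentiable (at x)) \<and> l differentiable (at x)) \<and>
     (\<forall>b\<in>Basis. smooth_conv n S K (\<lambda>k. pd b (f k)) (pd b l))"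

lemma smooth_conv_0D: "smooth_conv n S K f l \<Longrightarrow> uniform_limit K f l sequentially \<and> bounded (l ` K)"
  by (cases n) auto

lemma smooth_conv_SucD: "smooth_conv (Suc n) S K f l \<Longrightarrow> smooth_conv n S K f l"
proof (induction n arbitrary: f l)
  case (Suc n) then show ?case by (metis smooth_conv.simps(2))
qed simp

lemma smooth_conv_cong:
  assumes "open S" "K \<subseteq> S" "\<And>k x. x \<in> S \<Longrightarrow> f k x = g k x" "\<And>x. x \<in> S \<Longrightarrow> l x = m x"
    and "smooth_conv n S K f l"
  shows "smooth_conv n S K g m"
  using assms(3-5)
proof (induction n arbitrary: f l g m)
  case 0
  have "l ` K = m ` K" using 0 assms(2) by (auto simp: image_iff subset_iff)
  moreover have "uniform_limit K f l sequentially = uniform_limit K g m sequentially"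
    by (rule uniform_limit_cong) (use 0 assms(2) in \<open>auto intro!: always_eventually\<close>)
  ultimately show ?case using 0 by auto
next
  case (Suc n)
  have "l ` K = m ` K" using Suc assms(2) by (auto simp: image_iff subset_iff)
  moreover have "uniform_limit K f l sequentially = uniform_limit K g m sequentially"
    by (rule uniform_limit_cong) (use Suc assms(2) in \<open>auto intro!: always_eventually\<close>)
  moreover have "smooth_conv n S K (\<lambda>k. pd b (g k)) (pd b m)" if "b \<in> Basis" for b
  proof (rule Suc.IH)
    show "smooth_conv n S K (\<lambda>k. pd b (f k)) (pd b l)" using Suc.prems that by simp
    show "pd b (f k) x = pd b (g k) x" if "x \<in> S" for k x
      by (rule pd_cong[OF assms(1) that Suc.prems(1)])
    show "pd b l x = pd b m x" if "x \<in> S" for x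
      by (rule pd_cong[OF assms(1) that Suc.prems(2)])
  qed
  moreover have "g k differentiable (at x)" "m differentiable (at x)" if "x \<in> S" for k x
    using differentiable_cong_open[OF assms(1) that] Suc.prems that by (metis smooth_conv.simps(2))+
  ultimately show ?case using Suc.prems by auto
qed

text \<open>The recursion refers to \<^const>\<open>pd\<close>, whereas concrete functions come with a derivative: this form
  accepts any derivatives, and is the step of every bootstrapping argument below.\<close>
lemma smooth_conv_SucI:
  assumes "open S" "K \<subseteq> S"
    and "\<And>k x. x \<in> S \<Longrightarrow> (f k has_derivative D k x) (at x)"
    and "\<And>x. x \<in> S \<Longrightarrow> (l has_derivative E x) (at x)"
    and "uniform_limit K f l sequentially" "bounded (l ` K)"
    and "\<And>b. b \<in> Basis \<Longrightarrow> smooth_conv n S K (\<lambda>k x. D k x b) (\<lambda>x. E x b)"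
  shows "smooth_conv (Suc n) S K f l"
proof -
  have "smooth_conv n S K (\<lambda>k. pd b (f k)) (pd b l)" if "b \<in> Basis" for b
    by (rule smooth_conv_cong[OF assms(1,2) _ _ assms(7)[OF that]])
      (use assms(3,4) pd_eq in \<open>metis+\<close>)
  then show ?thesis using assms(3-6) unfolding smooth_conv.simps differentiable_def by blast
qed

lemma smooth_conv_const: "smooth_conv n S K (\<lambda>_ _. c) (\<lambda>_. c)"
proof (induction n arbitrary: c)
  case 0
  show ?case by (auto intro!: uniform_limit_const finite_imp_bounded finite_subset[of _ "{c}"])
next
  case (Suc n)
  have "pd b (\<lambda>_. c) = (\<lambda>_. 0)" for b :: 'a
    by (rule ext, rule pd_eq[where D="\<lambda>_. 0"]) auto
  with Suc show ?case
    by (auto intro!: uniform_limit_const finite_imp_bounded finite_subset[of _ "{c}"])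
qed

lemma smooth_conv_has_derivative:
  assumes "smooth_conv (Suc n) S K f l" "x \<in> S"
  shows "(f k has_derivative (\<lambda>b. pd b (f k) x)) (at x)" "(l has_derivative (\<lambda>b. pd b l x)) (at x)"
  using assms unfolding smooth_conv.simps pd_def
  by (simp_all add: frechet_derivative_works[symmetric])

lemma smooth_conv_add:
  assumes "open S" "K \<subseteq> S" "smooth_conv n S K f l" "smooth_conv n S K g m"
  shows "smooth_conv n S K (\<lambda>k x. f k x + g k x) (\<lambda>x. l x + m x)"
  using assms(3,4)
proof (induction n arbitrary: f l g m)
  case 0 then show ?case by (auto intro!: uniform_limit_intros bounded_plus_comp)
next
  case (Suc n)
  show ?case
    by (rule smooth_conv_SucI[OF assms(1,2)
        has_derivative_add[OF smooth_conv_has_derivative(1)[OF Suc.prems(1)] smooth_conv_has_derivative(1)[OF Suc.prems(2)]]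
        has_derivative_add[OF smooth_conv_has_derivative(2)[OF Suc.prems(1)] smooth_conv_has_derivative(2)[OF Suc.prems(2)]]])
     (use smooth_conv_0D[OF Suc.prems(1)] smooth_conv_0D[OF Suc.prems(2)] Suc in
       \<open>auto intro!: uniform_limit_intros bounded_plus_comp\<close>)
qed

lemma smooth_conv_linear:
  assumes "open S" "K \<subseteq> S" "bounded_linear L" "smooth_conv n S K f l"
  shows "smooth_conv n S K (\<lambda>k x. L (f k x)) (\<lambda>x. L (l x))"
  using assms(4)
proof (induction n arbitrary: f l)
  case 0
  then have "bounded (L ` l ` K)" by (intro bounded_linear_image[OF _ assms(3)]) simp
  then show ?case using 0
    by (simp add: bounded_linear.uniform_limit[OF assms(3)] image_image)
next
  case (Suc n)
  then have "bounded (L ` l ` K)" by (intro bounded_linear_image[OF _ assms(3)]) simp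
  then have "bounded ((\<lambda>x. L (l x)) ` K)" by (simp add: image_image)
  moreover have "uniform_limit K (\<lambda>k x. L (f k x)) (\<lambda>x. L (l x)) sequentially"
    using Suc.prems by (simp add: bounded_linear.uniform_limit[OF assms(3)])
  moreover have "smooth_conv n S K (\<lambda>k x. L (pd b (f k) x)) (\<lambda>x. L (pd b l x))" if "b \<in> Basis" for b
    using Suc.prems that by (intro Suc.IH) simp
  ultimately show ?case
    by (intro smooth_conv_SucI[OF assms(1,2)
        bounded_linear.has_derivative[OF assms(3) smooth_conv_has_derivative(1)[OF Suc.prems]]
        bounded_linear.has_derivative[OF assms(3) smooth_conv_has_derivative(2)[OF Suc.prems]]])
qed

lemma bounded_scaleR_image:
  assumes "bounded (l ` K)" "bounded (m ` K)"
  shows "bounded ((\<lambda>x. (l x :: real) *\<^sub>R (m x :: 'b::real_normed_vector)) ` K)"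
proof -
  obtain a b where "\<And>x. x \<in> K \<Longrightarrow> norm (l x) \<le> a" "\<And>x. x \<in> K \<Longrightarrow> norm (m x) \<le> b"
    using assms unfolding bounded_iff by fastforce
  then have "norm (l x *\<^sub>R m x) \<le> a * b" if "x \<in> K" for x
    using mult_mono[of "norm (l x)" a "norm (m x)" b] that order_trans[OF norm_ge_zero, of "l x" a]
    by simp
  then show ?thesis unfolding bounded_iff by blast
qed

lemma smooth_conv_scaleR:
  fixes g :: "nat \<Rightarrow> 'a::euclidean_space \<Rightarrow> 'b::real_normed_vector"
  assumes "open S" "K \<subseteq> S" "smooth_conv n S K f l" "smooth_conv n S K g m"
  shows "smooth_conv n S K (\<lambda>k x. f k x *\<^sub>R g k x) (\<lambda>x. l x *\<^sub>R m x)"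
  using assms(3,4)
proof (induction n arbitrary: f l g m)
  case 0 then show ?case
    by (auto intro!: bounded_scaleR_image bounded_bilinear.bounded_uniform_limit[OF bounded_bilinear_scaleR])
next
  case (Suc n)
  note S1 = smooth_conv_SucD[OF Suc.prems(1)] and S2 = smooth_conv_SucD[OF Suc.prems(2)]
  have "uniform_limit K (\<lambda>k x. f k x *\<^sub>R g k x) (\<lambda>x. l x *\<^sub>R m x) sequentially"
    using Suc.prems by (intro bounded_bilinear.bounded_uniform_limit[OF bounded_bilinear_scaleR]) auto
  moreover have "bounded ((\<lambda>x. l x *\<^sub>R m x) ` K)"
    using Suc.prems by (intro bounded_scaleR_image) auto
  moreover have "smooth_conv n S K
        (\<lambda>k x. f k x *\<^sub>R pd b (g k) x + pd b (f k) x *\<^sub>R g k x)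
        (\<lambda>x. l x *\<^sub>R pd b m x + pd b l x *\<^sub>R m x)" if "b \<in> Basis" for b
    using Suc.prems that S1 S2 by (intro smooth_conv_add[OF assms(1,2)] Suc.IH) auto
  ultimately show ?case
    by (intro smooth_conv_SucI[OF assms(1,2)
        has_derivative_scaleR[OF smooth_conv_has_derivative(1)[OF Suc.prems(1)] smooth_conv_has_derivative(1)[OF Suc.prems(2)]]
        has_derivative_scaleR[OF smooth_conv_has_derivative(2)[OF Suc.prems(1)] smooth_conv_has_derivative(2)[OF Suc.prems(2)]]])
qed

lemma smooth_conv_mult:
  fixes f g :: "nat \<Rightarrow> 'a::euclidean_space \<Rightarrow> real"
  assumes "open S" "K \<subseteq> S" "smooth_conv n S K f l" "smooth_conv n S K g m"
  shows "smooth_conv n S K (\<lambda>k x. f k x * g k x) (\<lambda>x. l x * m x)"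
  using smooth_conv_scaleR[OF assms] by simp

lemma smooth_conv_sum:
  assumes "open S" "K \<subseteq> S" "finite I" "\<And>i. i \<in> I \<Longrightarrow> smooth_conv n S K (f i) (l i)"
  shows "smooth_conv n S K (\<lambda>k x. \<Sum>i\<in>I. f i k x) (\<lambda>x. \<Sum>i\<in>I. l i x)"
  using assms(3,4)
  by (induction rule: finite_induct) (auto intro: smooth_conv_const smooth_conv_add[OF assms(1,2)])

lemma smooth_conv_diff:
  assumes "open S" "K \<subseteq> S" "smooth_conv n S K f l" "smooth_conv n S K g m"
  shows "smooth_conv n S K (\<lambda>k x. f k x - g k x) (\<lambda>x. l x - m x)"
  using smooth_conv_add[OF assms(1-3) smooth_conv_linear[OF assms(1,2) bounded_linear_minus[OF bounded_linear_ident] assms(4)]]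
  by simp

text \<open>By the chain rule only derivatives of the inner map enter as factors. The inner map
  itself may be unbounded on \<open>K\<close>, which is the case for the angle \<open>\<phi>\<close>.\<close>
lemma smooth_conv_compose:
  fixes g :: "'a::euclidean_space \<Rightarrow> 'c::euclidean_space" and f :: "nat \<Rightarrow> 'c \<Rightarrow> 'b::real_normed_vector"
  assumes "open S" "K \<subseteq> S" "g ` S \<subseteq> S'" "g ` K \<subseteq> K'"
    and dg: "\<And>x. x \<in> S \<Longrightarrow> g differentiable (at x)"
    and sg: "\<And>n b. b \<in> Basis \<Longrightarrow> smooth_conv n S K (\<lambda>_. pd b g) (pd b g)"
    and "smooth_conv n S' K' f l"
  shows "smooth_conv n S K (\<lambda>k x. f k (g x)) (\<lambda>x. l (g x))"
  using assms(7)
proof (induction n arbitrary: f l)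
  have base: "uniform_limit K (\<lambda>k x. f k (g x)) (\<lambda>x. l (g x)) sequentially \<and> bounded ((\<lambda>x. l (g x)) ` K)"
    if "smooth_conv n S' K' f l" for n f l
  proof -
    have "uniform_limit K' f l sequentially" and b: "bounded (l ` K')" using smooth_conv_0D[OF that] by auto
    then have "uniform_limit K (\<lambda>k x. f k (g x)) (\<lambda>x. l (g x)) sequentially"
      using assms(4) unfolding uniform_limit_iff by (force elim!: eventually_mono)
    moreover have "bounded ((\<lambda>x. l (g x)) ` K)"
      by (rule bounded_subset[OF b]) (use assms(4) in auto)
    ultimately show ?thesis by auto
  qed
  {
    case 0 then show ?case using base[of 0] by simp
  next
    case (Suc n)
    have gd: "(g has_derivative (\<lambda>b. pd b g x)) (at x)" if "x \<in> S" for x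
      using dg[OF that] unfolding pd_def by (simp add: frechet_derivative_works[symmetric])
    have ch: "((\<lambda>x. h (g x)) has_derivative (\<lambda>b. \<Sum>c\<in>Basis. (pd b g x \<bullet> c) *\<^sub>R pd c h (g x))) (at x)"
      if x: "x \<in> S" and h: "(h has_derivative (\<lambda>b. pd b h (g x))) (at (g x))" for x and h :: "'c \<Rightarrow> 'b"
    proof -
      have lin: "pd v h (g x) = (\<Sum>c\<in>Basis. (v \<bullet> c) *\<^sub>R pd c h (g x))" for v
      proof -
        have "linear (\<lambda>b. pd b h (g x))" using h has_derivative_linear by blast
        then have "pd (\<Sum>c\<in>Basis. (v \<bullet> c) *\<^sub>R c) h (g x) = (\<Sum>c\<in>Basis. (v \<bullet> c) *\<^sub>R pd c h (g x))"
          by (simp only: linear_sum[of "\<lambda>b. pd b h (g x)"] linear_scale[of "\<lambda>b. pd b h (g x)"])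
        then show ?thesis by (simp only: euclidean_representation)
      qed
      have "((\<lambda>x. h (g x)) has_derivative (\<lambda>b. pd (pd b g x) h (g x))) (at x)"
        using diff_chain_at[OF gd[OF x] h] by (simp only: o_def)
      moreover have "(\<lambda>b. pd (pd b g x) h (g x)) = (\<lambda>b. \<Sum>c\<in>Basis. (pd b g x \<bullet> c) *\<^sub>R pd c h (g x))"
        by (rule ext, rule lin)
      ultimately show ?thesis by metis
    qed
    have gS: "g x \<in> S'" if "x \<in> S" for x using that assms(3) by auto
    show ?case
    proof (rule smooth_conv_SucI[OF assms(1,2)])
      show "smooth_conv n S K (\<lambda>k x. \<Sum>c\<in>Basis. (pd b g x \<bullet> c) *\<^sub>R pd c (f k) (g x))
         (\<lambda>x. \<Sum>c\<in>Basis. (pd b g x \<bullet> c) *\<^sub>R pd c l (g x))" if "b \<in> Basis" for b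
        using Suc.prems that
        by (intro smooth_conv_sum smooth_conv_scaleR assms(1,2) finite_Basis Suc.IH
            smooth_conv_linear[OF _ _ bounded_linear_inner_left] sg) auto
    qed (use base[OF Suc.prems] ch smooth_conv_has_derivative[OF Suc.prems gS] in auto)
  }
qed

lemma smooth_conv_const_seq:
  fixes S :: "'a::euclidean_space set" and c :: "nat \<Rightarrow> 'b::real_normed_vector"
  assumes "c \<longlonglongrightarrow> d"
  shows "smooth_conv n S K (\<lambda>k _. c k) (\<lambda>_. d)"
proof -
  have "uniform_limit K (\<lambda>k _. c k) (\<lambda>_. d) sequentially"
    using assms unfolding uniform_limit_iff tendsto_iff by (auto elim: eventually_mono)
  moreover have "bounded ((\<lambda>_. d) ` K)"
    by (auto intro!: finite_imp_bounded finite_subset[of _ "{d}"])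
  moreover have "pd b (\<lambda>_. c) = (\<lambda>_. 0)" for b :: 'a and c :: 'b
    by (rule ext, rule pd_eq[where D="\<lambda>_. 0"]) auto
  ultimately show ?thesis
    by (cases n) (simp_all add: smooth_conv_const)
qed

lemma smooth_conv_bounded_linear:
  assumes "open S" "K \<subseteq> S" "bounded_linear h" "bounded (h ` K)"
  shows "smooth_conv n S K (\<lambda>_. h) h"
proof (cases n)
  case 0 then show ?thesis using assms by (auto intro: uniform_limit_const)
next
  case (Suc m)
  show ?thesis unfolding Suc
    by (rule smooth_conv_SucI[OF assms(1,2), where D="\<lambda>_ _. h" and E="\<lambda>_. h"])
      (use assms in \<open>auto intro: uniform_limit_const smooth_conv_const bounded_linear_imp_has_derivative\<close>)
qed

section \<open>Smooth functions\<close>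

text \<open>The two notions peel off partial derivatives from opposite ends of the list, hence the reversed
  case distinction.\<close>
lemma smooth_on_iff_smooth_conv:
  fixes S :: "'a::euclidean_space set"
  shows "smooth_on S f \<longleftrightarrow> (\<forall>n. smooth_conv n S {} (\<lambda>_. f) f)"
proof -
  have "smooth_conv n S {} (\<lambda>_. f) f \<longleftrightarrow>
     (\<forall>bs. set bs \<subseteq> Basis \<longrightarrow> length bs < n \<longrightarrow> (\<forall>x\<in>S. iter_pd bs f differentiable (at x)))" for n
  proof (induction n arbitrary: f)
    case 0 show ?case by simp
  next
    case (Suc n)
    have "smooth_conv (Suc n) S {} (\<lambda>_. f) f \<longleftrightarrow> (\<forall>x\<in>S. f differentiable (at x)) \<and>
      (\<forall>b\<in>Basis. \<forall>bs. set bs \<subseteq> Basis \<longrightarrow> length bs < n \<longrightarrow> (\<forall>x\<in>S. iter_pd (bs @ [b]) f differentiable (at x)))"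
      using Suc by (simp del: foldr_append add: foldr_append[symmetric]) simp
    also have "\<dots> \<longleftrightarrow> (\<forall>bs. set bs \<subseteq> Basis \<longrightarrow> length bs < Suc n \<longrightarrow> (\<forall>x\<in>S. iter_pd bs f differentiable (at x)))"
      (is "?L \<longleftrightarrow> ?R")
    proof
      assume L: ?L
      show ?R
      proof (intro allI impI)
        fix bs :: "'a list" assume bs: "set bs \<subseteq> Basis" "length bs < Suc n"
        show "\<forall>x\<in>S. iter_pd bs f differentiable (at x)"
        proof (cases bs rule: rev_cases)
          case Nil then show ?thesis using L by simp
        next
          case (snoc cs c) then show ?thesis using L bs by simp
        qed
      qed
    next
      assume R: ?R
      show ?L
      proof (intro conjI ballI allI impI)
        fix x assume "x \<in> S" then show "f differentiable (at x)" using R[rule_format, of "[]" x] by simp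
      next
        fix b x :: 'a and bs :: "'a list" assume "b \<in> Basis" "set bs \<subseteq> Basis" "length bs < n" "x \<in> S"
        then show "iter_pd (bs @ [b]) f differentiable (at x)"
          using R[rule_format, of "bs @ [b]" x] by simp
      qed
    qed
    finally show ?case .
  qed
  then show ?thesis unfolding smooth_on_def by (metis lessI)
qed

lemma smooth_on_conv: "smooth_on S f \<Longrightarrow> smooth_conv n S {} (\<lambda>_. f) f"
  by (simp add: smooth_on_iff_smooth_conv)

lemma smooth_on_cong:
  assumes "open S" "\<And>x. x \<in> S \<Longrightarrow> f x = g x" "smooth_on S f" shows "smooth_on S g"
  using smooth_conv_cong[OF assms(1), of "{}" "\<lambda>_. f" "\<lambda>_. g" f g] assms(2,3)
  by (auto simp: smooth_on_iff_smooth_conv)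

lemma smooth_on_const: "smooth_on S (\<lambda>_. c)"
  by (simp add: smooth_on_iff_smooth_conv smooth_conv_const)

lemma smooth_on_add: "open S \<Longrightarrow> smooth_on S f \<Longrightarrow> smooth_on S g \<Longrightarrow> smooth_on S (\<lambda>x. f x + g x)"
  unfolding smooth_on_iff_smooth_conv by (intro allI smooth_conv_add) auto

lemma smooth_on_diff: "open S \<Longrightarrow> smooth_on S f \<Longrightarrow> smooth_on S g \<Longrightarrow> smooth_on S (\<lambda>x. f x - g x)"
  unfolding smooth_on_iff_smooth_conv by (intro allI smooth_conv_diff) auto

lemma smooth_on_scaleR:
  "open S \<Longrightarrow> smooth_on S f \<Longrightarrow> smooth_on S g \<Longrightarrow> smooth_on S (\<lambda>x. f x *\<^sub>R g x)"
  unfolding smooth_on_iff_smooth_conv by (intro allI smooth_conv_scaleR) auto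

lemma smooth_on_mult:
  fixes f :: "'a::euclidean_space \<Rightarrow> real"
  shows "open S \<Longrightarrow> smooth_on S f \<Longrightarrow> smooth_on S g \<Longrightarrow> smooth_on S (\<lambda>x. f x * g x)"
  unfolding smooth_on_iff_smooth_conv by (intro allI smooth_conv_mult) auto

lemma smooth_on_bounded_linear: "open S \<Longrightarrow> bounded_linear h \<Longrightarrow> smooth_on S h"
  unfolding smooth_on_iff_smooth_conv by (simp add: smooth_conv_bounded_linear)

lemma smooth_on_linear_comp:
  "open S \<Longrightarrow> bounded_linear L \<Longrightarrow> smooth_on S f \<Longrightarrow> smooth_on S (\<lambda>x. L (f x))"
  using smooth_conv_linear[of S "{}" L _ "\<lambda>_. f" f] by (auto simp: smooth_on_iff_smooth_conv)

lemma smooth_on_differentiable: "smooth_on S f \<Longrightarrow> x \<in> S \<Longrightarrow> f differentiable (at x)"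
  unfolding smooth_on_def by (metis empty_subsetI foldr.simps(1) id_apply list.set(1))

lemma smooth_on_pd: "smooth_on S f \<Longrightarrow> b \<in> Basis \<Longrightarrow> smooth_on S (pd b f)"
  unfolding smooth_on_iff_smooth_conv
proof
  fix n assume "\<forall>n. smooth_conv n S {} (\<lambda>_. f) f" "b \<in> Basis"
  then have "smooth_conv (Suc n) S {} (\<lambda>_. f) f" by blast
  then show "smooth_conv n S {} (\<lambda>_. pd b f) (pd b f)" using \<open>b \<in> Basis\<close> by simp
qed

lemma smooth_on_compose:
  fixes g :: "'a::euclidean_space \<Rightarrow> 'c::euclidean_space"
  assumes "open S" "smooth_on S' f" "smooth_on S g" "g ` S \<subseteq> S'"
  shows "smooth_on S (\<lambda>x. f (g x))"
  unfolding smooth_on_iff_smooth_conv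
proof
  fix n
  show "smooth_conv n S {} (\<lambda>_ x. f (g x)) (\<lambda>x. f (g x))"
  proof (rule smooth_conv_compose[OF assms(1) _ assms(4), where K'="{}" and f="\<lambda>_. f" and l=f])
    show "smooth_conv m S {} (\<lambda>_. pd b g) (pd b g)" if "b \<in> Basis" for m b
      by (rule smooth_on_conv[OF smooth_on_pd[OF assms(3) that]])
  qed (use assms in \<open>auto intro: smooth_on_differentiable smooth_on_conv\<close>)
qed

lemma smooth_on_real_derivative:
  fixes f :: "real \<Rightarrow> real"
  assumes "smooth_on S f" "x \<in> S"
  shows "(f has_real_derivative pd 1 f x) (at x)"
proof -
  have d: "(f has_derivative frechet_derivative f (at x)) (at x)"
    using smooth_on_differentiable[OF assms] frechet_derivative_works by blast
  then have lin: "linear (frechet_derivative f (at x))" using has_derivative_linear by blast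
  have "frechet_derivative f (at x) h = pd 1 f x * h" for h
    unfolding pd_def mult.commute[of _ h] by (fact linear_scale[OF lin, of h 1, simplified])
  then have "frechet_derivative f (at x) = (*) (pd 1 f x)" by (rule ext)
  then show ?thesis using d unfolding has_field_derivative_def by metis
qed

lemma smooth_conv_real_SucI:
  fixes f :: "nat \<Rightarrow> real \<Rightarrow> real"
  assumes "open S" "K \<subseteq> S"
    and "\<And>k x. x \<in> S \<Longrightarrow> (f k has_real_derivative f' k x) (at x)"
    and "\<And>x. x \<in> S \<Longrightarrow> (l has_real_derivative l' x) (at x)"
    and "smooth_conv n S K f l" "smooth_conv n S K f' l'"
  shows "smooth_conv (Suc n) S K f l"
  by (rule smooth_conv_SucI[OF assms(1,2) assms(3,4)[unfolded has_field_derivative_def]])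
    (use smooth_conv_0D[OF assms(5)] assms(6) in auto)

text \<open>The function \<open>1 / sin \<theta>\<close> in the variable \<open>z = cos \<theta>\<close>. It satisfies \<open>s' = z s\<^sup>3\<close>, from which its
  smoothness and that of \<open>1 / (1 - z\<^sup>2) = s\<^sup>2\<close> are bootstrapped.\<close>
definition recip_sin :: "real \<Rightarrow> real" where "recip_sin z = 1 / sqrt (1 - z\<^sup>2)"

lemma one_minus_sq_pos: "\<bar>z\<bar> < 1 \<Longrightarrow> 0 < 1 - (z::real)\<^sup>2"
  by (simp add: abs_square_less_1)

lemma smooth_conv_recip_sin:
  assumes "K \<subseteq> {-1<..<1}" "bounded (recip_sin ` K)"
  shows "smooth_conv n {-1<..<1} K (\<lambda>_. recip_sin) recip_sin"
proof (induction n)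
  case 0 then show ?case using assms by (simp add: uniform_limit_const)
next
  case (Suc n)
  have d: "(recip_sin has_real_derivative z * (recip_sin z * recip_sin z * recip_sin z)) (at z)"
    if "z \<in> {-1<..<1}" for z
  proof -
    have z: "0 < 1 - z\<^sup>2" using one_minus_sq_pos[of z] that by auto
    then show ?thesis
      unfolding recip_sin_def[abs_def]
      by (auto intro!: derivative_eq_intros simp: field_simps)
  qed
  have K: "bounded ((\<lambda>z. z) ` K)"
    unfolding bounded_iff by (rule exI[of _ 1]) (use assms in force)
  have "smooth_conv n {-1<..<1} K (\<lambda>_ z. z) (\<lambda>z. z)"
    by (rule smooth_conv_bounded_linear) (use assms K bounded_linear_ident in auto)
  then have "smooth_conv n {-1<..<1} K (\<lambda>_ z. z * (recip_sin z * recip_sin z * recip_sin z))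
      (\<lambda>z. z * (recip_sin z * recip_sin z * recip_sin z))"
    by (intro smooth_conv_mult assms Suc) auto
  then show ?case
    by (intro smooth_conv_real_SucI[OF _ assms(1) d d Suc]) auto
qed

section \<open>The punctured cone\<close>

abbreviation e3 :: "real^3" where "e3 \<equiv> axis 3 1"

definition cos_polar :: "real^3 \<Rightarrow> real" where "cos_polar X = X $ 3 / norm X"

lemma norm_sq_3: "(norm (X::real^3))\<^sup>2 = (X$1)\<^sup>2 + (X$2)\<^sup>2 + (X$3)\<^sup>2"
  unfolding power2_norm_eq_inner by (simp add: inner_vec_def sum_3 power2_eq_square)

lemma in_punctured_cone_iff: "X \<in> punctured_cone \<longleftrightarrow> X $ 1 \<noteq> 0 \<or> X $ 2 \<noteq> 0"
proof
  assume "X \<in> punctured_cone"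
  then obtain t Y where t: "X = t *\<^sub>R Y" "0 < t" and Y: "norm Y = 1" "Y \<noteq> south" "Y \<noteq> north"
    by (auto simp: cone_over_def)
  show "X $ 1 \<noteq> 0 \<or> X $ 2 \<noteq> 0"
  proof (rule ccontr)
    assume "\<not> ?thesis"
    then have "Y $ 1 = 0" "Y $ 2 = 0" using t by auto
    moreover from this have "(Y$3)\<^sup>2 = 1" using norm_sq_3[of Y] Y by simp
    then have "Y $ 3 = 1 \<or> Y $ 3 = -1" by (simp add: power2_eq_1_iff)
    ultimately show False using Y by (auto simp: north_def south_def vec_eq_iff forall_3 vector_3)
  qed
next
  assume X: "X $ 1 \<noteq> 0 \<or> X $ 2 \<noteq> 0"
  then have "X \<noteq> 0" by auto
  then have "X = norm X *\<^sub>R (X /\<^sub>R norm X)" "norm (X /\<^sub>R norm X) = 1" "0 < norm X" by auto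
  moreover have "X /\<^sub>R norm X \<noteq> south" "X /\<^sub>R norm X \<noteq> north"
    using X by (auto simp: north_def south_def vec_eq_iff forall_3 vector_3)
  ultimately show "X \<in> punctured_cone" unfolding cone_over_def
    by (intro CollectI exI[of _ "norm X"] exI[of _ "X /\<^sub>R norm X"]) (auto simp del: norm_scaleR)
qed

lemma open_punctured_cone: "open punctured_cone"
proof -
  have "punctured_cone = {X. X $ 1 \<noteq> 0} \<union> {X. X $ 2 \<noteq> (0::real)}"
    by (auto simp: in_punctured_cone_iff)
  then show ?thesis by (auto intro!: open_Un open_Collect_neq continuous_intros)
qed

lemma punctured_coneD:
  assumes "X \<in> punctured_cone"
  shows "0 < norm X" "X \<noteq> 0" "\<bar>cos_polar X\<bar> < 1" "X $ 3 = cos_polar X * norm X"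
proof -
  show X: "X \<noteq> 0" using assms by (auto simp: in_punctured_cone_iff)
  then show n: "0 < norm X" by simp
  have "(X$1)\<^sup>2 + (X$2)\<^sup>2 > 0" using assms
    by (simp add: in_punctured_cone_iff sum_power2_gt_zero_iff)
  then have "(X$3)\<^sup>2 < (norm X)\<^sup>2" using norm_sq_3[of X] by linarith
  then have "\<bar>X $ 3\<bar> < norm X" using abs_le_square_iff[of "norm X" "X $ 3"] by (simp add: not_le[symmetric])
  then show "\<bar>cos_polar X\<bar> < 1" using n by (simp add: cos_polar_def abs_mult)
  show "X $ 3 = cos_polar X * norm X" using n by (simp add: cos_polar_def)
qed

lemma inner_e3 [simp]: "X \<bullet> e3 = X $ 3" "e3 \<bullet> X = X $ 3"
  by (simp_all add: inner_axis inner_axis')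

section \<open>Differential operators on axial fields\<close>

definition radial :: "(real \<Rightarrow> real) \<Rightarrow> int \<Rightarrow> real^3 \<Rightarrow> real" where
  "radial K m X = K (cos_polar X) * norm X powi m"

definition axial :: "(real \<Rightarrow> real) \<Rightarrow> int \<Rightarrow> (real \<Rightarrow> real) \<Rightarrow> int \<Rightarrow> real^3 \<Rightarrow> real^3" where
  "axial F m G n X = radial F m X *\<^sub>R X + radial G n X *\<^sub>R e3"

text \<open>Zonal functions \<open>K(z) r\<^sup>m\<close> have gradients of the form \<^const>\<open>axial\<close>, because
  \<open>\<nabla>z = (e\<^sub>3 - z X / r) / r\<close>. As divergences of axial fields are
  sums of zonal functions again, all operators can be computed within these two classes.\<close>
lemma radial_has_derivative:
  assumes X: "X \<in> punctured_cone" and K: "(K has_real_derivative K' (cos_polar X)) (at (cos_polar X))"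
  shows "(radial K m has_derivative
     (\<lambda>h. axial (\<lambda>z. of_int m * K z - z * K' z) (m - 2) K' (m - 1) X \<bullet> h)) (at X)"
proof -
  note n = punctured_coneD[OF X]
  have z: "(cos_polar has_derivative (\<lambda>h. h $ 3 / norm X - cos_polar X * (X \<bullet> h) / (norm X)\<^sup>2)) (at X)"
    unfolding cos_polar_def[abs_def]
    using n
    by (auto intro!: derivative_eq_intros bounded_linear_imp_has_derivative bounded_linear_vec_nth has_derivative_norm[THEN has_derivative_eq_rhs]
        simp: fun_eq_iff sgn_div_norm inner_commute power2_eq_square field_simps)
  have Kd: "((\<lambda>Y. K (cos_polar Y)) has_derivative (\<lambda>h. K' (cos_polar X) * (h $ 3 / norm X - cos_polar X * (X \<bullet> h) / (norm X)\<^sup>2))) (at X)"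
    using diff_chain_at[OF z K[unfolded has_field_derivative_def]] by (simp add: o_def)
  have Nd: "((\<lambda>Y::real^3. norm Y powi m) has_derivative (\<lambda>h. (X \<bullet> h / norm X) * (of_int m * norm X powi (m - 1)))) (at X)"
    using n by (auto intro!: derivative_eq_intros has_derivative_norm[THEN has_derivative_eq_rhs]
       simp: fun_eq_iff sgn_div_norm inner_commute field_simps)
  have p: "norm X powi m = norm X powi (m-2) * (norm X)\<^sup>2" "norm X powi (m-1) = norm X powi (m-2) * norm X"
    using n(1) power_int_add[of "norm X" "m-2" 2] power_int_add[of "norm X" "m-2" 1] by auto
  have ax: "axial (\<lambda>z. of_int m * K z - z * K' z) (m - 2) K' (m - 1) X \<bullet> h
     = (of_int m * K (cos_polar X) - cos_polar X * K' (cos_polar X)) * norm X powi (m - 2) * (X \<bullet> h)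
       + K' (cos_polar X) * (norm X powi (m - 2) * norm X) * h $ 3" for h
    by (simp add: axial_def radial_def inner_add_left p(2))
  show ?thesis
    unfolding radial_def[abs_def]
    by (rule has_derivative_eq_rhs[OF has_derivative_mult[OF Kd Nd]])
      (use n(1) in \<open>simp add: fun_eq_iff ax p field_simps power2_eq_square\<close>)
qed

lemma axial_has_derivative:
  assumes X: "X \<in> punctured_cone"
    and F: "(F has_real_derivative F' (cos_polar X)) (at (cos_polar X))"
    and G: "(G has_real_derivative G' (cos_polar X)) (at (cos_polar X))"
  shows "(axial F m G n has_derivative
     (\<lambda>h. (axial (\<lambda>z. of_int m * F z - z * F' z) (m - 2) F' (m - 1) X \<bullet> h) *\<^sub>R X + radial F m X *\<^sub>R h
       + (axial (\<lambda>z. of_int n * G z - z * G' z) (n - 2) G' (n - 1) X \<bullet> h) *\<^sub>R e3)) (at X)"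
proof -
  have "axial F m G n = (\<lambda>Y. radial F m Y *\<^sub>R Y + radial G n Y *\<^sub>R e3)"
    by (simp add: fun_eq_iff axial_def)
  then show ?thesis
    by (rule ssubst, intro has_derivative_eq_rhs[OF has_derivative_add[OF
        has_derivative_scaleR[OF radial_has_derivative[where m=m and K=F and K'=F', OF X F] has_derivative_ident]
        has_derivative_scaleR[OF radial_has_derivative[where m=n and K=G and K'=G', OF X G] has_derivative_const]]])
      (simp add: fun_eq_iff algebra_simps)
qed

lemma pd_eqI: "(f has_derivative D) (at x) \<Longrightarrow> D b = v \<Longrightarrow> pd b f x = v"
  using pd_eq by metis

lemma divergence_eq_trace:
  "(u has_derivative D) (at X) \<Longrightarrow> divergence u X = (\<Sum>b\<in>Basis. D b \<bullet> b)"
  unfolding divergence_def by (simp add: pd_eq)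

lemma trace_axial_derivative:
  fixes X :: "real^3"
  shows "(\<Sum>b\<in>Basis. ((g \<bullet> b) *\<^sub>R X + c *\<^sub>R b + (h \<bullet> b) *\<^sub>R Y) \<bullet> b) = g \<bullet> X + 3 * c + h \<bullet> Y"
proof -
  have "(\<Sum>b\<in>Basis. ((g \<bullet> b) *\<^sub>R X + c *\<^sub>R b + (h \<bullet> b) *\<^sub>R Y) \<bullet> b)
     = (\<Sum>b\<in>Basis. (g \<bullet> b) * (X \<bullet> b) + c + (h \<bullet> b) * (Y \<bullet> b))"
    by (intro sum.cong refl) (simp add: inner_add_left inner_Basis)
  also have "\<dots> = g \<bullet> X + 3 * c + h \<bullet> Y"
    by (simp only: sum.distrib euclidean_inner[symmetric]) simp
  finally show ?thesis .
qed

lemma axial_inner: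
  assumes "X \<in> punctured_cone"
  shows "axial F m G n X \<bullet> X = F (cos_polar X) * norm X powi (m + 2) + cos_polar X * G (cos_polar X) * norm X powi (n + 1)"
    "axial F m G n X $ 3 = cos_polar X * F (cos_polar X) * norm X powi (m + 1) + G (cos_polar X) * norm X powi n"
  using punctured_coneD[OF assms] 
  by (simp_all add: axial_def radial_def inner_add_left power_int_add inner_commute[of e3]
      dot_square_norm)

lemma divergence_axial:
  assumes X: "X \<in> punctured_cone"
    and F: "(F has_real_derivative F' (cos_polar X)) (at (cos_polar X))"
    and G: "(G has_real_derivative G' (cos_polar X)) (at (cos_polar X))"
  shows "divergence (axial F m G n) X = (of_int m + 3) * F (cos_polar X) * norm X powi m
    + ((1 - (cos_polar X)\<^sup>2) * G' (cos_polar X) + of_int n * cos_polar X * G (cos_polar X)) * norm X powi (n - 1)"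
  unfolding divergence_eq_trace[OF axial_has_derivative[where F'=F' and G'=G', OF assms]] trace_axial_derivative
    axial_inner[OF X] inner_e3
  by (simp add: radial_def algebra_simps power2_eq_square)

lemma gradient_eq:
  "(\<phi> has_derivative (\<lambda>h. g \<bullet> h)) (at X) \<Longrightarrow> gradient \<phi> X = g"
  unfolding gradient_def by (simp add: pd_eq euclidean_representation)

lemma convection_eq:
  assumes "(u has_derivative D) (at X)" shows "convection u X = D (u X)"
proof -
  have l: "linear D" using assms has_derivative_linear by blast
  have "D (\<Sum>b\<in>Basis. (u X \<bullet> b) *\<^sub>R b) = convection u X"
    unfolding convection_def by (simp only: linear_sum[OF l] linear_scale[OF l] pd_eq[OF assms])
  then show ?thesis by (simp only: euclidean_representation)
qed

text \<open>Only first derivatives of the gradients \<open>g\<close> and \<open>k\<close> are needed, so second derivatives of the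
  coefficients are handled as divergences; the middle term is the cross term of the product rule,
  the second derivatives of \<open>Y\<close> being zero.\<close>
lemma laplacian_split:
  fixes X :: "'a::euclidean_space"
  assumes S: "open S" "X \<in> S"
    and d: "\<And>Y. Y \<in> S \<Longrightarrow> (\<phi> has_derivative (\<lambda>h. g Y \<bullet> h)) (at Y)"
      "\<And>Y. Y \<in> S \<Longrightarrow> (\<psi> has_derivative (\<lambda>h. k Y \<bullet> h)) (at Y)"
    and H: "g differentiable (at X)" "k differentiable (at X)"
    and u: "\<And>Y. Y \<in> S \<Longrightarrow> u Y = \<phi> Y *\<^sub>R Y + \<psi> Y *\<^sub>R e"
  shows "laplacian u X = divergence g X *\<^sub>R X + 2 *\<^sub>R g X + divergence k X *\<^sub>R e"
proof -
  obtain Hg Hk where Hg: "(g has_derivative Hg) (at X)" and Hk: "(k has_derivative Hk) (at X)"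
    using H unfolding differentiable_def by blast
  have 1: "pd b u Y = (g Y \<bullet> b) *\<^sub>R Y + \<phi> Y *\<^sub>R b + (k Y \<bullet> b) *\<^sub>R e" if "Y \<in> S" for b Y
  proof -
    have "pd b u Y = pd b (\<lambda>Y. \<phi> Y *\<^sub>R Y + \<psi> Y *\<^sub>R e) Y"
      by (rule pd_cong[OF S(1) that u])
    also have "\<dots> = (g Y \<bullet> b) *\<^sub>R Y + \<phi> Y *\<^sub>R b + (k Y \<bullet> b) *\<^sub>R e"
      by (rule pd_eqI) (auto intro!: derivative_eq_intros d that simp: algebra_simps)
    finally show ?thesis .
  qed
  have "pd b (pd b u) X = (Hg b \<bullet> b) *\<^sub>R X + (2 * (g X \<bullet> b)) *\<^sub>R b + (Hk b \<bullet> b) *\<^sub>R e" for b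
  proof -
    have "pd b (pd b u) X = pd b (\<lambda>Y. (g Y \<bullet> b) *\<^sub>R Y + \<phi> Y *\<^sub>R b + (k Y \<bullet> b) *\<^sub>R e) X"
      by (rule pd_cong[OF S 1])
    also have "\<dots> = (Hg b \<bullet> b) *\<^sub>R X + (2 * (g X \<bullet> b)) *\<^sub>R b + (Hk b \<bullet> b) *\<^sub>R e"
      by (rule pd_eqI[where D="\<lambda>h. (Hg h \<bullet> b) *\<^sub>R X + (g X \<bullet> b) *\<^sub>R h + (g X \<bullet> h) *\<^sub>R b + (Hk h \<bullet> b) *\<^sub>R e"])
        (auto intro!: derivative_eq_intros d S Hg Hk simp: algebra_simps simp flip: scaleR_2)
    finally show ?thesis .
  qed
  then have "laplacian u X = (\<Sum>b\<in>Basis. (Hg b \<bullet> b) *\<^sub>R X) + (\<Sum>b\<in>Basis. (2 * (g X \<bullet> b)) *\<^sub>R b)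
      + (\<Sum>b\<in>Basis. (Hk b \<bullet> b) *\<^sub>R e)"
    unfolding laplacian_def by (simp add: sum.distrib)
  also have "(\<Sum>b\<in>Basis. (2 * (g X \<bullet> b)) *\<^sub>R b) = 2 *\<^sub>R (\<Sum>b\<in>Basis. (g X \<bullet> b) *\<^sub>R b)"
    by (simp only: scaleR_sum_right scaleR_scaleR)
  also have "\<dots> = 2 *\<^sub>R g X" by (simp only: euclidean_representation)
  finally show ?thesis
    by (simp only: divergence_eq_trace[OF Hg] divergence_eq_trace[OF Hk] scaleR_sum_left)
qed

text \<open>The profiles carry the powers \<open>r\<^sup>-\<^sup>2\<close> and \<open>r\<^sup>-\<^sup>1\<close> because \<open>F(z) X / r\<^sup>2 + G(z) e\<^sub>3 / r\<close> is the general
  \<open>(-1)\<close>-homogeneous axisymmetric field without swirl. All terms of the equations then have the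
  shape \<open>\<alpha>(z) X / r\<^sup>4 + \<beta>(z) e\<^sub>3 / r\<^sup>3\<close>, and the equations reduce to ordinary ones for \<open>\<alpha>\<close> and \<open>\<beta>\<close>.\<close>
lemma axial_operators:
  assumes d: "\<And>z. \<bar>z\<bar> < 1 \<Longrightarrow> (F has_real_derivative F1 z) (at z)" "\<And>z. \<bar>z\<bar> < 1 \<Longrightarrow> (F1 has_real_derivative F2 z) (at z)"
      "\<And>z. \<bar>z\<bar> < 1 \<Longrightarrow> (G has_real_derivative G1 z) (at z)" "\<And>z. \<bar>z\<bar> < 1 \<Longrightarrow> (G1 has_real_derivative G2 z) (at z)"
    and u: "\<And>Y. Y \<in> punctured_cone \<Longrightarrow> u Y = axial F (-2) G (-1) Y"
    and X: "X \<in> punctured_cone"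
  defines "z \<equiv> cos_polar X" and "r \<equiv> norm X"
  shows "laplacian u X = (((1 - z\<^sup>2) * F2 z - 4 * z * F1 z - 2 * F z) / r ^ 4) *\<^sub>R X
            + (((1 - z\<^sup>2) * G2 z - 2 * z * G1 z + 2 * F1 z) / r ^ 3) *\<^sub>R e3" (is ?lap)
    and "convection u X = (((1 - z\<^sup>2) * G z * F1 z - (F z)\<^sup>2 - 2 * z * F z * G z) / r ^ 4) *\<^sub>R X
            + (((1 - z\<^sup>2) * G z * G1 z - z * (G z)\<^sup>2) / r ^ 3) *\<^sub>R e3" (is ?conv)
    and "divergence u X = (F z + (1 - z\<^sup>2) * G1 z - z * G z) / r\<^sup>2" (is ?div)
proof -
  note n = punctured_coneD[OF X]
  have r: "r > 0" and z: "\<bar>z\<bar> < 1" using n by (auto simp: r_def z_def)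
  have cp: "\<bar>cos_polar Y\<bar> < 1" if "Y \<in> punctured_cone" for Y using punctured_coneD[OF that] by auto
  have pw: "r powi -1 = 1 / r" "r powi -2 = 1 / r^2" "r powi -3 = 1 / r^3" "r powi -4 = 1 / r^4"
    using r by (simp_all add: power_int_minus field_simps)
  define gF where "gF = axial (\<lambda>z. of_int (-2) * F z - z * F1 z) (-2-2) F1 (-2-1)"
  define gG where "gG = axial (\<lambda>z. of_int (-1) * G z - z * G1 z) (-1-2) G1 (-1-1)"
  have dF: "(radial F (-2) has_derivative (\<lambda>h. gF Y \<bullet> h)) (at Y)" if "Y \<in> punctured_cone" for Y
    unfolding gF_def by (rule radial_has_derivative[where K=F and K'=F1, OF that d(1)[OF cp[OF that]]])
  have dG: "(radial G (-1) has_derivative (\<lambda>h. gG Y \<bullet> h)) (at Y)" if "Y \<in> punctured_cone" for Y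
    unfolding gG_def by (rule radial_has_derivative[where K=G and K'=G1, OF that d(3)[OF cp[OF that]]])
  have c1: "((\<lambda>z. of_int (-2) * F z - z * F1 z) has_real_derivative (\<lambda>z. - 3 * F1 z - z * F2 z) (cos_polar X)) (at (cos_polar X))"
    by (auto intro!: derivative_eq_intros d cp X)
  have c2: "((\<lambda>z. of_int (-1) * G z - z * G1 z) has_real_derivative (\<lambda>z. - 2 * G1 z - z * G2 z) (cos_polar X)) (at (cos_polar X))"
    by (auto intro!: derivative_eq_intros d cp X)
  have diff: "gF differentiable (at X)" "gG differentiable (at X)"
    unfolding gF_def gG_def differentiable_def
    using axial_has_derivative[where F'="\<lambda>z. - 3 * F1 z - z * F2 z" and G=F1 and G'=F2, OF X c1 d(2)[OF cp[OF X]]] axial_has_derivative[where F'="\<lambda>z. - 2 * G1 z - z * G2 z" and G=G1 and G'=G2, OF X c2 d(4)[OF cp[OF X]]] by blast+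
  have lap: "laplacian u X = divergence gF X *\<^sub>R X + 2 *\<^sub>R gF X + divergence gG X *\<^sub>R e3"
    by (rule laplacian_split[OF open_punctured_cone X dF dG diff]) (simp_all add: u axial_def)
  have dgF: "divergence gF X = ((1 - z\<^sup>2) * F2 z - 2 * z * F1 z + 2 * F z) / r ^ 4"
    unfolding gF_def
    by (subst divergence_axial[where F'="\<lambda>z. - 3 * F1 z - z * F2 z" and G=F1 and G'=F2, OF X c1 d(2)[OF cp[OF X]]])
      (use r in \<open>simp add: z_def[symmetric] r_def[symmetric] pw field_simps\<close>)
  have dgG: "divergence gG X = ((1 - z\<^sup>2) * G2 z - 2 * z * G1 z) / r ^ 3"
    unfolding gG_def
    by (subst divergence_axial[where F'="\<lambda>z. - 2 * G1 z - z * G2 z" and G=G1 and G'=G2, OF X c2 d(4)[OF cp[OF X]]])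
      (use r in \<open>simp add: z_def[symmetric] r_def[symmetric] pw field_simps\<close>)
  have gFX: "gF X = ((- 2 * F z - z * F1 z) / r ^ 4) *\<^sub>R X + (F1 z / r ^ 3) *\<^sub>R e3"
    by (simp add: gF_def axial_def radial_def z_def[symmetric] r_def[symmetric] pw)
  have gGX: "gG X = ((- G z - z * G1 z) / r ^ 3) *\<^sub>R X + (G1 z / r ^ 2) *\<^sub>R e3"
    by (simp add: gG_def axial_def radial_def z_def[symmetric] r_def[symmetric] pw)
  show ?lap
    unfolding lap dgF dgG gFX by (simp add: algebra_simps flip: scaleR_left.add scaleR_left.diff add_divide_distrib diff_divide_distrib)
  have uD: "(u has_derivative (\<lambda>h. (gF X \<bullet> h) *\<^sub>R X + radial F (-2) X *\<^sub>R h + (gG X \<bullet> h) *\<^sub>R e3)) (at X)"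
    using has_derivative_transform_within_open[OF axial_has_derivative[where F=F and F'=F1 and G=G and G'=G1 and m="-2" and n="-1", OF X d(1,3)[OF cp[OF X]]] open_punctured_cone X] u
    unfolding gF_def gG_def by simp
  have i: "X \<bullet> X = r\<^sup>2" "X $ 3 = z * r" using n by (auto simp: r_def z_def dot_square_norm)
  have uX: "u X = (F z / r\<^sup>2) *\<^sub>R X + (G z / r) *\<^sub>R e3"
    by (simp add: u[OF X] axial_def radial_def z_def[symmetric] r_def[symmetric] pw divide_inverse)
  have a: "gF X \<bullet> u X = ((- 2 * F z - z * F1 z) * (F z + z * G z) + F1 z * (z * F z + G z)) / r ^ 4"
    "gG X \<bullet> u X = ((- G z - z * G1 z) * (F z + z * G z) + G1 z * (z * F z + G z)) / r ^ 3"
    using r unfolding gFX gGX uX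
    by (simp_all add: inner_add_left inner_add_right i field_simps power2_eq_square power3_eq_cube power4_eq_xxxx)
  have "convection u X = (gF X \<bullet> u X) *\<^sub>R X + (F z / r\<^sup>2) *\<^sub>R u X + (gG X \<bullet> u X) *\<^sub>R e3"
    unfolding convection_eq[OF uD] by (simp add: radial_def z_def[symmetric] r_def[symmetric] pw)
  also have "\<dots> = (gF X \<bullet> u X + F z / r\<^sup>2 * (F z / r\<^sup>2)) *\<^sub>R X + (F z / r\<^sup>2 * (G z / r) + gG X \<bullet> u X) *\<^sub>R e3"
    unfolding uX by (simp add: algebra_simps)
  finally show ?conv unfolding a
    by (rule back_subst[of "\<lambda>v. convection u X = v"])
      (use r in \<open>intro arg_cong2[of _ _ _ _ "\<lambda>a b. a *\<^sub>R X + b *\<^sub>R e3"]; simp add: field_simps power2_eq_square power3_eq_cube power4_eq_xxxx\<close>)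
  show ?div
    using r unfolding divergence_eq_trace[OF uD] trace_axial_derivative
    by (simp add: gFX gGX inner_add_left i radial_def z_def[symmetric] r_def[symmetric] pw field_simps power2_eq_square power3_eq_cube power4_eq_xxxx)
qed

lemma gradient_radial:
  assumes "X \<in> punctured_cone" "(Q has_real_derivative Q') (at (cos_polar X))"
    and "\<And>Y. Y \<in> punctured_cone \<Longrightarrow> p Y = radial Q (-2) Y"
  shows "gradient p X = ((- cos_polar X * Q' - 2 * Q (cos_polar X)) / norm X ^ 4) *\<^sub>R X + (Q' / norm X ^ 3) *\<^sub>R e3"
proof -
  have r: "norm X > 0" using punctured_coneD[OF assms(1)] by simp
  have pw: "norm X powi -3 = 1 / norm X^3" "norm X powi -4 = 1 / norm X^4"
    using r by (simp_all add: power_int_minus field_simps)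
  have "(radial Q (-2) has_derivative
     (\<lambda>h. axial (\<lambda>z. of_int (-2) * Q z - z * Q') (- 2 - 2) (\<lambda>_. Q') (- 2 - 1) X \<bullet> h)) (at X)"
    by (rule radial_has_derivative[where K'="\<lambda>_. Q'", OF assms(1,2)])
  then have "(p has_derivative
     (\<lambda>h. axial (\<lambda>z. of_int (-2) * Q z - z * Q') (- 2 - 2) (\<lambda>_. Q') (- 2 - 1) X \<bullet> h)) (at X)"
    by (rule has_derivative_transform_within_open[OF _ open_punctured_cone assms(1)]) (simp add: assms(3))
  from gradient_eq[OF this] show ?thesis by (simp add: axial_def radial_def pw)
qed

section \<open>The Riccati equation\<close>

definition quad :: "real \<Rightarrow> real \<Rightarrow> real \<Rightarrow> real \<Rightarrow> real" where
  "quad a b c z = a + b * z + c * z\<^sup>2"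

definition riccati_rhs :: "real \<Rightarrow> real \<Rightarrow> real \<Rightarrow> (real \<Rightarrow> real) \<Rightarrow> real \<Rightarrow> real" where
  "riccati_rhs a b c V z = (quad a b c z - 2 * z * V z - (V z)\<^sup>2 / 2) / (1 - z\<^sup>2)"

definition riccati :: "real \<Rightarrow> real \<Rightarrow> real \<Rightarrow> (real \<Rightarrow> real) \<Rightarrow> bool" where
  "riccati a b c V \<longleftrightarrow> (\<forall>z. \<bar>z\<bar> < 1 \<longrightarrow> (V has_real_derivative riccati_rhs a b c V z) (at z))"

lemma smooth_conv_inverse_weight:
  assumes "K \<subseteq> {-1<..<1}" "bounded (recip_sin ` K)"
  shows "smooth_conv n {-1<..<1} K (\<lambda>_ z. 1 / (1 - z\<^sup>2)) (\<lambda>z. 1 / (1 - z\<^sup>2))"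
proof -
  have eq: "recip_sin z * recip_sin z = 1 / (1 - z\<^sup>2)" if "z \<in> {-1<..<1}" for z
  proof -
    have "0 < 1 - z\<^sup>2" using one_minus_sq_pos[of z] that by auto
    then show ?thesis by (simp add: recip_sin_def)
  qed
  show ?thesis
    by (rule smooth_conv_cong[OF _ assms(1) eq eq smooth_conv_mult[OF _ assms(1)
          smooth_conv_recip_sin[OF assms] smooth_conv_recip_sin[OF assms]]]) auto
qed

lemma smooth_conv_riccati_rhs:
  assumes "K \<subseteq> {-1<..<1}" "bounded (recip_sin ` K)"
    and "a \<longlonglongrightarrow> a'" "b \<longlonglongrightarrow> b'" "c \<longlonglongrightarrow> c'"
    and "smooth_conv n {-1<..<1} K V W"
  shows "smooth_conv n {-1<..<1} K (\<lambda>k. riccati_rhs (a k) (b k) (c k) (V k)) (riccati_rhs a' b' c' W)"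
proof -
  have K: "bounded ((\<lambda>z. z) ` K)"
    unfolding bounded_iff by (rule exI[of _ 1]) (use assms in force)
  have id: "smooth_conv n {-1<..<1} K (\<lambda>_ z. z) (\<lambda>z. z)"
    by (intro smooth_conv_bounded_linear bounded_linear_ident K assms) auto
  have "smooth_conv n {-1<..<1} K
     (\<lambda>k z. (a k + b k * z + c k * (z * z) - 2 * z * V k z - (1/2) * (V k z * V k z)) * (1 / (1 - z\<^sup>2)))
     (\<lambda>z. (a' + b' * z + c' * (z * z) - 2 * z * W z - (1/2) * (W z * W z)) * (1 / (1 - z\<^sup>2)))"
    by (intro smooth_conv_mult smooth_conv_diff smooth_conv_add smooth_conv_const smooth_conv_const_seq id
        smooth_conv_inverse_weight assms) auto
  then show ?thesis
    by (simp add: riccati_rhs_def[abs_def] quad_def power2_eq_square)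
qed

text \<open>The right-hand side contains no derivative of the solution. Convergence of order \<open>n\<close> of the
  solutions hence gives order \<open>n\<close> for their derivatives, that is order \<open>n + 1\<close> for the solutions.\<close>
lemma riccati_smooth_conv:
  assumes "K \<subseteq> {-1<..<1}" "bounded (recip_sin ` K)" "bounded (W ` K)"
    and "a \<longlonglongrightarrow> a'" "b \<longlonglongrightarrow> b'" "c \<longlonglongrightarrow> c'"
    and "\<And>k. riccati (a k) (b k) (c k) (V k)" "riccati a' b' c' W"
    and "uniform_limit K V W sequentially"
  shows "smooth_conv n {-1<..<1} K V W"
proof (induction n)
  case 0 then show ?case using assms by simp
next
  case (Suc n)
  show ?case
    by (rule smooth_conv_real_SucI[OF _ assms(1) _ _ Suc smooth_conv_riccati_rhs[OF assms(1,2,4-6) Suc]])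
      (use assms(7,8) in \<open>auto simp: riccati_def\<close>)
qed

lemma riccati_smooth: "riccati a b c V \<Longrightarrow> smooth_on {-1<..<1} V"
  unfolding smooth_on_iff_smooth_conv
  by (intro allI riccati_smooth_conv[where a="\<lambda>_. a" and b="\<lambda>_. b" and c="\<lambda>_. c"]) auto

section \<open>Profiles of homogeneous solutions\<close>

text \<open>The three profiles of a solution in terms of the Riccati function \<open>V\<close>: \<open>F\<close> and \<open>G\<close> are the
  coefficients of \<open>X / r\<^sup>2\<close> and \<open>e\<^sub>3 / r\<close> in the velocity, \<open>Q\<close> is the pressure times \<open>r\<^sup>2\<close>. The
  derivative of \<open>V\<close> is eliminated by the Riccati equation, so that all of them depend on \<open>V\<close>
  without derivatives.\<close>
definition prof_G :: "(real \<Rightarrow> real) \<Rightarrow> real \<Rightarrow> real" where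
  "prof_G V z = - V z / (1 - z\<^sup>2)"

definition prof_F :: "real \<Rightarrow> real \<Rightarrow> real \<Rightarrow> (real \<Rightarrow> real) \<Rightarrow> real \<Rightarrow> real" where
  "prof_F a b c V z = riccati_rhs a b c V z - z * prof_G V z"

definition prof_Q :: "real \<Rightarrow> real \<Rightarrow> real \<Rightarrow> (real \<Rightarrow> real) \<Rightarrow> real \<Rightarrow> real" where
  "prof_Q a b c V z = riccati_rhs a b c V z - c - (1 - z\<^sup>2) * (prof_G V z)\<^sup>2 / 2"

definition riccati_velocity :: "real \<Rightarrow> real \<Rightarrow> real \<Rightarrow> (real \<Rightarrow> real) \<Rightarrow> real^3 \<Rightarrow> real^3" where
  "riccati_velocity a b c V = axial (prof_F a b c V) (-2) (prof_G V) (-1)"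

definition riccati_pressure :: "real \<Rightarrow> real \<Rightarrow> real \<Rightarrow> (real \<Rightarrow> real) \<Rightarrow> real^3 \<Rightarrow> real" where
  "riccati_pressure a b c V = radial (prof_Q a b c V) (-2)"

text \<open>Calculus for one profile \<open>G\<close>. Everything is expressed through \<open>G\<close> and not through
  \<open>U = -(1 - z\<^sup>2) G\<close>, since then \<open>U\<close>, \<open>F\<close> and the coefficients \<open>A\<close>, \<open>B\<close> of the momentum balance
  are polynomials in \<open>z\<close> and the derivatives of \<open>G\<close>, and identities between them are decided by
  polynomial arithmetic.\<close>
locale profile =
  fixes G G1 G2 G3 :: "real \<Rightarrow> real"
  assumes dG: "\<And>z. \<bar>z\<bar> < 1 \<Longrightarrow> (G has_real_derivative G1 z) (at z)"
    and dG1: "\<And>z. \<bar>z\<bar> < 1 \<Longrightarrow> (G1 has_real_derivative G2 z) (at z)"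
    and dG2: "\<And>z. \<bar>z\<bar> < 1 \<Longrightarrow> (G2 has_real_derivative G3 z) (at z)"
begin

definition "U z = - (1 - z\<^sup>2) * G z"
definition "U1 z = 2 * z * G z - (1 - z\<^sup>2) * G1 z"
definition "U2 z = 2 * G z + 4 * z * G1 z - (1 - z\<^sup>2) * G2 z"
definition "U3 z = 6 * G1 z + 6 * z * G2 z - (1 - z\<^sup>2) * G3 z"
definition "F z = z * G z - (1 - z\<^sup>2) * G1 z"
definition "F1 z = G z + 3 * z * G1 z - (1 - z\<^sup>2) * G2 z"
definition "F2 z = 4 * G1 z + 5 * z * G2 z - (1 - z\<^sup>2) * G3 z"

lemma derivs:
  assumes "\<bar>z\<bar> < 1"
  shows "(U has_real_derivative U1 z) (at z)" "(U1 has_real_derivative U2 z) (at z)"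
    "(U2 has_real_derivative U3 z) (at z)"
    "(F has_real_derivative F1 z) (at z)" "(F1 has_real_derivative F2 z) (at z)"
  unfolding U_def[abs_def] U1_def[abs_def] U2_def[abs_def] U3_def F_def[abs_def] F1_def[abs_def] F2_def
  by (auto intro!: derivative_eq_intros dG dG1 dG2 assms simp: algebra_simps power2_eq_square)

text \<open>The left-hand side of the Riccati equation for \<open>U\<close>, and its first two derivatives.\<close>
definition "T z = (1 - z\<^sup>2) * U1 z + 2 * z * U z + (U z)\<^sup>2 / 2"
definition "T1 z = (1 - z\<^sup>2) * U2 z + 2 * U z + U z * U1 z"
definition "T2 z = (1 - z\<^sup>2) * U3 z - 2 * z * U2 z + 2 * U1 z + (U1 z)\<^sup>2 + U z * U2 z"

lemma T_derivs:
  assumes "\<bar>z\<bar> < 1"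
  shows "(T has_real_derivative T1 z) (at z)" "(T1 has_real_derivative T2 z) (at z)"
  unfolding T_def[abs_def] T1_def[abs_def] T2_def
  by (auto intro!: derivative_eq_intros derivs assms simp: algebra_simps power2_eq_square)

text \<open>The coefficients of \<open>X / r\<^sup>4\<close> and \<open>e\<^sub>3 / r\<^sup>3\<close> in \<open>- \<Delta>u + u \<cdot> \<nabla>u\<close>, which the pressure gradient has to
  balance.\<close>
definition "A z = - ((1 - z\<^sup>2) * F2 z - 4 * z * F1 z - 2 * F z) + (1 - z\<^sup>2) * G z * F1 z - (F z)\<^sup>2 - 2 * z * F z * G z"
definition "B z = - ((1 - z\<^sup>2) * G2 z - 2 * z * G1 z + 2 * F1 z) + (1 - z\<^sup>2) * G z * G1 z - z * (G z)\<^sup>2"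

lemma div_zero: "F z + (1 - z\<^sup>2) * G1 z - z * G z = 0"
  by (simp add: F_def)

lemma B_eq: "B z = - U2 z - F z * G z"
  by (simp add: B_def U2_def F_def F1_def algebra_simps power2_eq_square)

text \<open>This is where the third-order integrability shows: by Euler's identity \<open>A + z B\<close> is twice the
  pressure profile, and up to terms of lower order it is minus the second derivative of the
  Riccati expression \<open>T\<close>.\<close>
lemma A_zB_eq: "A z + z * B z = - T2 z + 2 * U1 z - (1 - z\<^sup>2) * (G z)\<^sup>2"
  unfolding A_def B_def T2_def U_def U1_def U2_def U3_def F_def F1_def F2_def by algebra

lemma momentum:
  assumes u: "\<And>Y. Y \<in> punctured_cone \<Longrightarrow> u Y = axial F (-2) G (-1) Y" and X: "X \<in> punctured_cone"
  shows "- laplacian u X + convection u X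
      = (A (cos_polar X) / norm X ^ 4) *\<^sub>R X + (B (cos_polar X) / norm X ^ 3) *\<^sub>R e3"
    "divergence u X = 0"
proof -
  note o = axial_operators[of F F1 F2 G G1 G2, OF derivs(4,5) dG dG1 u X, simplified]
  show "divergence u X = 0" unfolding o(3) by (simp add: div_zero)
  show "- laplacian u X + convection u X
      = (A (cos_polar X) / norm X ^ 4) *\<^sub>R X + (B (cos_polar X) / norm X ^ 3) *\<^sub>R e3"
    unfolding o(1,2) A_def B_def
    by (simp add: algebra_simps flip: scaleR_left.add scaleR_left.diff add_divide_distrib diff_divide_distrib)
qed

end

lemma profile_of_smooth:
  assumes "smooth_on {-1<..<1} G"
  shows "profile G (pd 1 G) (pd 1 (pd 1 G)) (pd 1 (pd 1 (pd 1 G)))"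
proof -
  have "smooth_on {-1<..<1} (pd 1 G)" "smooth_on {-1<..<1} (pd 1 (pd 1 G))"
    using assms by (auto intro!: smooth_on_pd)
  with assms show ?thesis
    by unfold_locales (auto intro!: smooth_on_real_derivative)
qed

section \<open>Spherical coordinates\<close>

lemma sph_in_punctured_cone:
  assumes "r > 0" "0 < \<theta>" "\<theta> < pi" shows "sph r \<theta> \<phi> \<in> punctured_cone"
proof -
  have "sin \<theta> > 0" using assms by (intro sin_gt_zero)
  moreover have "cos \<phi> \<noteq> 0 \<or> sin \<phi> \<noteq> 0" using sin_zero_abs_cos_one by fastforce
  ultimately show ?thesis using assms by (auto simp: in_punctured_cone_iff sph_def vector_3)
qed

lemma norm_sph: "r \<ge> 0 \<Longrightarrow> norm (sph r \<theta> \<phi>) = r"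
proof -
  assume r: "r \<ge> 0"
  have "(norm (sph r \<theta> \<phi>))\<^sup>2 = r\<^sup>2 * ((sin \<theta>)\<^sup>2 * ((sin \<phi>)\<^sup>2 + (cos \<phi>)\<^sup>2) + (cos \<theta>)\<^sup>2)"
    unfolding norm_sq_3 by (simp add: sph_def vector_3 power_mult_distrib algebra_simps del: sin_cos_squared_add sin_cos_squared_add2)
  then have "(norm (sph r \<theta> \<phi>))\<^sup>2 = r\<^sup>2" by simp
  then show ?thesis using r by (simp add: power2_eq_iff_nonneg)
qed

lemma cos_polar_sph: "r > 0 \<Longrightarrow> cos_polar (sph r \<theta> \<phi>) = cos \<theta>"
  by (simp add: cos_polar_def norm_sph) (simp add: sph_def vector_3)

lemma punctured_cone_sph:
  assumes X: "X \<in> punctured_cone"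
  obtains \<theta> \<phi> where "0 < \<theta>" "\<theta> < pi" "X = sph (norm X) \<theta> \<phi>" "cos \<theta> = cos_polar X"
proof -
  note n = punctured_coneD[OF X]
  define \<theta> where "\<theta> = arccos (cos_polar X)"
  have c: "cos \<theta> = cos_polar X" using n by (simp add: \<theta>_def)
  have \<theta>: "0 < \<theta>" "\<theta> < pi" using n arccos_lt_bounded[of "cos_polar X"] by (auto simp: \<theta>_def)
  then have s: "sin \<theta> > 0" by (intro sin_gt_zero)
  define \<rho> where "\<rho> = norm X * sin \<theta>"
  have \<rho>: "\<rho> > 0" using s n by (simp add: \<rho>_def)
  have "(X$1)\<^sup>2 + (X$2)\<^sup>2 = (norm X)\<^sup>2 - (cos \<theta> * norm X)\<^sup>2"
    using norm_sq_3[of X] n c by simp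
  also have "\<dots> = \<rho>\<^sup>2" by (simp add: \<rho>_def power_mult_distrib sin_squared_eq algebra_simps)
  finally have "(X$1 / \<rho>)\<^sup>2 + (X$2 / \<rho>)\<^sup>2 = 1" using \<rho>
    by (simp add: power_divide flip: add_divide_distrib)
  then obtain \<phi> where "X$1 / \<rho> = cos \<phi>" "X$2 / \<rho> = sin \<phi>" using sincos_total_2pi by metis
  then have "X$1 = \<rho> * cos \<phi>" "X$2 = \<rho> * sin \<phi>" using \<rho> by (simp_all add: field_simps)
  moreover have "X$3 = norm X * cos \<theta>" using n(4) c by (simp only: mult.commute)
  ultimately have "X = sph (norm X) \<theta> \<phi>"
    unfolding vec_eq_iff forall_3 sph_def vector_3 \<rho>_def by (simp only: simp_thms)
  with \<theta> c show thesis using that by blast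
qed

definition meridian :: "real \<Rightarrow> real^3" where "meridian z = vector [sqrt (1 - z\<^sup>2), 0, z]"

lemma sph_meridian: "0 < \<theta> \<Longrightarrow> \<theta> < pi \<Longrightarrow> sph r \<theta> 0 = r *\<^sub>R meridian (cos \<theta>)"
  using sin_gt_zero[of \<theta>]
  by (simp add: vec_eq_iff forall_3 sph_def meridian_def vector_3 sin_squared_eq[symmetric])

lemma inner_3: "(v::real^3) \<bullet> w = v$1 * w$1 + v$2 * w$2 + v$3 * w$3"
  by (simp add: inner_vec_def sum_3)

lemma frame_expansion:
  "v = (v \<bullet> e_r \<theta> \<phi>) *\<^sub>R e_r \<theta> \<phi> + (v \<bullet> e_theta \<theta> \<phi>) *\<^sub>R e_theta \<theta> \<phi> + (v \<bullet> e_phi \<theta> \<phi>) *\<^sub>R e_phi \<theta> \<phi>"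
proof -
  have 1: "(sin \<theta>)\<^sup>2 + (cos \<theta>)\<^sup>2 = 1" "(sin \<phi>)\<^sup>2 + (cos \<phi>)\<^sup>2 = 1" by simp_all
  have "a = (a * (s * c) + b * (s * d) + e * t) * (s * c) + (a * (t * c) + b * (t * d) - e * s) * (t * c) + (b * c - a * d) * (- d)"
    "b = (a * (s * c) + b * (s * d) + e * t) * (s * d) + (a * (t * c) + b * (t * d) - e * s) * (t * d) + (b * c - a * d) * c"
    "e = (a * (s * c) + b * (s * d) + e * t) * t + (a * (t * c) + b * (t * d) - e * s) * (- s)"
    if "s\<^sup>2 + t\<^sup>2 = 1" "d\<^sup>2 + c\<^sup>2 = 1" for a b e s t c d :: real
    using that by algebra+
  from this[OF 1] show ?thesis
    by (simp add: vec_eq_iff forall_3 inner_3 e_r_def e_theta_def e_phi_def vector_3)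
qed

section \<open>Normalising the viscosity\<close>

lemma pd_scaleR: "f differentiable (at x) \<Longrightarrow> pd b (\<lambda>x. c *\<^sub>R f x) x = c *\<^sub>R pd b f x"
  by (rule pd_eqI[OF has_derivative_scaleR_right[of f "frechet_derivative f (at x)"]])
    (auto simp: frechet_derivative_works pd_def)

text \<open>The convection term is quadratic in \<open>u\<close> while the viscous term carries the factor \<open>\<nu>\<close>, so both
  scale by \<open>\<nu>\<^sup>-\<^sup>2\<close>.\<close>
lemma NS_solution_rescale:
  assumes S: "open S" and \<nu>: "\<nu> > 0" and NS: "NS_solution \<nu> S u p"
  shows "NS_solution 1 S (\<lambda>X. u X /\<^sub>R \<nu>) (\<lambda>X. p X / \<nu>\<^sup>2)"
  unfolding NS_solution_def
proof (intro conjI ballI)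
  have su: "smooth_on S u" and sp: "smooth_on S p" using NS by (auto simp: NS_solution_def)
  show "smooth_on S (\<lambda>X. u X /\<^sub>R \<nu>)" using su by (intro smooth_on_scaleR S smooth_on_const)
  show "smooth_on S (\<lambda>X. p X / \<nu>\<^sup>2)"
    unfolding divide_inverse using sp by (intro smooth_on_mult S smooth_on_const)
  fix X assume X: "X \<in> S"
  have eq: "- \<nu> *\<^sub>R laplacian u X + convection u X + gradient p X = 0" "divergence u X = 0"
    using NS X by (auto simp: NS_solution_def)
  have pdu: "pd b (\<lambda>X. u X /\<^sub>R \<nu>) Y = pd b u Y /\<^sub>R \<nu>" if "Y \<in> S" for b Y
    using smooth_on_differentiable[OF su that] by (rule pd_scaleR)
  have pdp: "pd b (\<lambda>X. p X / \<nu>\<^sup>2) X = inverse (\<nu>\<^sup>2) *\<^sub>R pd b p X" for b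
    using pd_scaleR[OF smooth_on_differentiable[OF sp X], of b "inverse (\<nu>\<^sup>2)"] by (simp add: divide_inverse mult.commute)
  have pd2: "pd b (pd b (\<lambda>X. u X /\<^sub>R \<nu>)) X = pd b (pd b u) X /\<^sub>R \<nu>" if "b \<in> Basis" for b
  proof -
    have "pd b (pd b (\<lambda>X. u X /\<^sub>R \<nu>)) X = pd b (\<lambda>X. pd b u X /\<^sub>R \<nu>) X"
      by (rule pd_cong[OF S X pdu])
    then show ?thesis using pd_scaleR[OF smooth_on_differentiable[OF smooth_on_pd[OF su that] X]] by simp
  qed
  have 1: "laplacian (\<lambda>X. u X /\<^sub>R \<nu>) X = laplacian u X /\<^sub>R \<nu>"
    unfolding laplacian_def by (simp add: pd2 scaleR_sum_right)
  have 2: "convection (\<lambda>X. u X /\<^sub>R \<nu>) X = inverse (\<nu>\<^sup>2) *\<^sub>R convection u X"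
    unfolding convection_def by (simp add: pdu X scaleR_sum_right power2_eq_square mult.commute mult.left_commute)
  have 3: "gradient (\<lambda>X. p X / \<nu>\<^sup>2) X = inverse (\<nu>\<^sup>2) *\<^sub>R gradient p X"
    unfolding gradient_def by (simp add: pdp scaleR_sum_right)
  have "- 1 *\<^sub>R laplacian (\<lambda>X. u X /\<^sub>R \<nu>) X + convection (\<lambda>X. u X /\<^sub>R \<nu>) X + gradient (\<lambda>X. p X / \<nu>\<^sup>2) X
      = inverse (\<nu>\<^sup>2) *\<^sub>R (- \<nu> *\<^sub>R laplacian u X + convection u X + gradient p X)"
    unfolding 1 2 3 using \<nu> by (simp add: algebra_simps power2_eq_square)
  then show "- 1 *\<^sub>R laplacian (\<lambda>X. u X /\<^sub>R \<nu>) X + convection (\<lambda>X. u X /\<^sub>R \<nu>) X + gradient (\<lambda>X. p X / \<nu>\<^sup>2) X = 0"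
    by (simp only: eq scaleR_zero_right)
  show "divergence (\<lambda>X. u X /\<^sub>R \<nu>) X = 0"
    using eq(2) unfolding divergence_def by (simp add: pdu X flip: sum_distrib_left)
qed

lemma hom_NS_solution_rescale:
  assumes "\<nu> > 0" "hom_NS_solution \<nu> u p"
  shows "hom_NS_solution 1 (\<lambda>X. u X /\<^sub>R \<nu>) (\<lambda>X. p X / \<nu>\<^sup>2)"
  using assms NS_solution_rescale[OF open_punctured_cone assms(1)]
  unfolding hom_NS_solution_def homogeneous_on_def by (simp add: mult.left_commute)

lemma comp_rescale:
  "comp_r (\<lambda>X. u X /\<^sub>R \<nu>) r \<theta> \<phi> = comp_r u r \<theta> \<phi> / \<nu>"
  "comp_theta (\<lambda>X. u X /\<^sub>R \<nu>) r \<theta> \<phi> = comp_theta u r \<theta> \<phi> / \<nu>"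
  "comp_phi (\<lambda>X. u X /\<^sub>R \<nu>) r \<theta> \<phi> = comp_phi u r \<theta> \<phi> / \<nu>"
  by (simp_all add: comp_r_def comp_theta_def comp_phi_def divide_inverse mult.commute)

lemma axisymmetric_rescale: "axisymmetric u \<Longrightarrow> axisymmetric (\<lambda>X. u X /\<^sub>R \<nu>)"
  unfolding axisymmetric_def comp_rescale by metis

lemma no_swirl_rescale: "no_swirl u \<Longrightarrow> no_swirl (\<lambda>X. u X /\<^sub>R \<nu>)"
  unfolding no_swirl_def comp_rescale by auto

section \<open>Every solution comes from the Riccati equation\<close>

lemma meridian_in_cone:
  assumes "\<bar>z\<bar> < 1"
  shows "meridian z \<in> punctured_cone" "norm (meridian z) = 1" "cos_polar (meridian z) = z"
proof -
  have s: "0 < sqrt (1 - z\<^sup>2)" "(sqrt (1 - z\<^sup>2))\<^sup>2 = 1 - z\<^sup>2" using one_minus_sq_pos[OF assms] by auto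
  show "meridian z \<in> punctured_cone" using s by (simp add: in_punctured_cone_iff meridian_def vector_3)
  have "(norm (meridian z))\<^sup>2 = 1"
    unfolding norm_sq_3 using s by (simp add: meridian_def vector_3)
  then show n: "norm (meridian z) = 1" by (simp add: power2_eq_1_iff) (metis norm_ge_zero not_one_le_zero neg_0_le_iff_le)
  show "cos_polar (meridian z) = z" by (simp add: cos_polar_def n) (simp add: meridian_def vector_3)
qed

lemma smooth_on_recip_sin: "smooth_on {-1<..<1} recip_sin"
  by (simp add: smooth_on_iff_smooth_conv smooth_conv_recip_sin)

lemma smooth_on_meridian: "smooth_on {-1<..<1} meridian"
proof -
  have "smooth_on {-1<..<1} (\<lambda>z. ((1 - z * z) * recip_sin z) *\<^sub>R axis 1 (1::real) + z *\<^sub>R e3)"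
    by (intro smooth_on_add smooth_on_scaleR smooth_on_recip_sin smooth_on_mult smooth_on_diff smooth_on_const
        smooth_on_bounded_linear bounded_linear_ident) auto
  then show ?thesis
  proof (rule smooth_on_cong[rotated -1])
    fix z :: real assume "z \<in> {-1<..<1}"
    then have z: "0 < 1 - z\<^sup>2" using one_minus_sq_pos[of z] by auto
    then have "(1 - z * z) * recip_sin z = sqrt (1 - z\<^sup>2)"
      by (simp add: recip_sin_def power2_eq_square[symmetric] real_div_sqrt)
    then show "((1 - z * z) * recip_sin z) *\<^sub>R axis 1 (1::real) + z *\<^sub>R e3 = meridian z"
      by (simp add: vec_eq_iff forall_3 meridian_def vector_3 axis_def)
  qed simp
qed

text \<open>The profiles are read off on the meridian \<open>\<phi> = 0\<close> of the unit sphere. There \<open>u\<close> has no second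
  component, and comparing the \<open>e\<^sub>r\<close> and \<open>e\<^sub>\<theta>\<close> components with those of
  \<open>f X / r\<^sup>2 + g e\<^sub>3 / r\<close> gives \<open>f = u\<^sub>1 / sin \<theta>\<close> and \<open>g = u\<^sub>3 - z f\<close>.\<close>
lemma axisymmetric_representation:
  assumes hom: "homogeneous_on punctured_cone (-1) u" and ax: "axisymmetric u" "no_swirl u"
    and X: "X \<in> punctured_cone"
  defines "f z \<equiv> u (meridian z) $ 1 * recip_sin z"
  shows "u X = axial f (-2) (\<lambda>z. u (meridian z) $ 3 - z * f z) (-1) X"
proof -
  obtain \<theta> \<phi> where \<theta>: "0 < \<theta>" "\<theta> < pi" and Xs: "X = sph (norm X) \<theta> \<phi>" and c: "cos \<theta> = cos_polar X"
    using punctured_cone_sph[OF X] by metis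
  define r where "r = norm X"
  have r: "r > 0" using punctured_coneD[OF X] by (simp add: r_def)
  define z where "z = cos \<theta>"
  have z: "\<bar>z\<bar> < 1" using punctured_coneD[OF X] c by (simp add: z_def)
  have s: "sin \<theta> > 0" using \<theta> by (intro sin_gt_zero)
  have rs: "recip_sin z = 1 / sin \<theta>" using s by (simp add: recip_sin_def z_def sin_squared_eq[symmetric])
  have hm: "u (sph r \<theta> 0) = u (meridian z) /\<^sub>R r"
    using hom r meridian_in_cone(1)[OF z] by (simp add: sph_meridian[OF \<theta>] homogeneous_on_def z_def power_int_minus)
  have "u X \<bullet> e_r \<theta> \<phi> = comp_r u r \<theta> \<phi>" "u X \<bullet> e_theta \<theta> \<phi> = comp_theta u r \<theta> \<phi>" "u X \<bullet> e_phi \<theta> \<phi> = comp_phi u r \<theta> \<phi>"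
    using Xs by (simp_all add: comp_r_def comp_theta_def comp_phi_def r_def)
  moreover have "comp_r u r \<theta> \<phi> = comp_r u r \<theta> 0" "comp_theta u r \<theta> \<phi> = comp_theta u r \<theta> 0" "comp_phi u r \<theta> \<phi> = 0"
    using ax r \<theta> by (auto simp: axisymmetric_def no_swirl_def)
  ultimately have u: "u X \<bullet> e_r \<theta> \<phi> = (sin \<theta> * u (meridian z) $ 1 + z * u (meridian z) $ 3) / r"
    "u X \<bullet> e_theta \<theta> \<phi> = (z * u (meridian z) $ 1 - sin \<theta> * u (meridian z) $ 3) / r"
    "u X \<bullet> e_phi \<theta> \<phi> = 0"
    by (simp_all add: comp_r_def comp_theta_def comp_phi_def hm inner_3 e_r_def e_theta_def vector_3 z_def divide_inverse algebra_simps)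
  have pw: "r powi -1 = 1 / r" "r powi -2 = 1 / r^2"
    using r by (simp_all add: power_int_minus field_simps)
  have ax_eq: "axial f (-2) (\<lambda>z. u (meridian z) $ 3 - z * f z) (-1) X
      = (f z / r) *\<^sub>R e_r \<theta> \<phi> + ((u (meridian z) $ 3 - z * f z) / r) *\<^sub>R e3"
  proof -
    have "sph r \<theta> \<phi> = r *\<^sub>R e_r \<theta> \<phi>"
      by (simp add: vec_eq_iff forall_3 sph_def e_r_def vector_3)
    then have X_eq: "X = r *\<^sub>R e_r \<theta> \<phi>" using Xs unfolding r_def by metis
    show ?thesis
      unfolding axial_def radial_def c[symmetric] z_def[symmetric] r_def[symmetric] pw
      using r by (subst X_eq) (simp add: power2_eq_square)
  qed
  have e3: "e3 = z *\<^sub>R e_r \<theta> \<phi> - sin \<theta> *\<^sub>R e_theta \<theta> \<phi>"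
    by (subst frame_expansion[of e3 \<theta> \<phi>]) (simp add: e_r_def e_theta_def e_phi_def vector_3 z_def)
  have sq: "sin \<theta> * sin \<theta> = 1 - z * z" by (simp add: z_def sin_squared_eq flip: power2_eq_square)
  have c1: "(f z / r) + ((u (meridian z) $ 3 - z * f z) / r) * z = (sin \<theta> * u (meridian z) $ 1 + z * u (meridian z) $ 3) / r"
  proof -
    have "f z - z * f z * z = f z * (sin \<theta> * sin \<theta>)" unfolding sq by (simp add: algebra_simps)
    also have "\<dots> = sin \<theta> * u (meridian z) $ 1" using s by (simp add: f_def rs)
    finally show ?thesis using r by (simp add: field_simps)
  qed
  have c2: "- ((u (meridian z) $ 3 - z * f z) / r) * sin \<theta> = (z * u (meridian z) $ 1 - sin \<theta> * u (meridian z) $ 3) / r"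
    using s r by (simp add: f_def rs field_simps)
  have "u X = ((sin \<theta> * u (meridian z) $ 1 + z * u (meridian z) $ 3) / r) *\<^sub>R e_r \<theta> \<phi>
     + ((z * u (meridian z) $ 1 - sin \<theta> * u (meridian z) $ 3) / r) *\<^sub>R e_theta \<theta> \<phi>"
    by (subst frame_expansion[of "u X" \<theta> \<phi>]) (simp only: u scaleR_zero_left add_0_right)
  then show ?thesis
    unfolding ax_eq e3 c1[symmetric] c2[symmetric] by (simp add: algebra_simps)
qed

lemma radial_representation:
  assumes rad: "\<And>X. X \<in> punctured_cone \<Longrightarrow> p X = radial Q (-2) X"
    and z: "\<bar>z\<bar> < 1"
  shows "Q z = p (meridian z)"
  using meridian_in_cone[OF z] by (simp add: rad radial_def)

text \<open>The identity recovers the pressure from its gradient, which the momentum equation expresses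
  through \<open>u\<close>; in particular \<open>p\<close> inherits the symmetry of \<open>u\<close>.\<close>
lemma euler_homogeneous:
  fixes p :: "real^3 \<Rightarrow> real"
  assumes hom: "homogeneous_on punctured_cone (-2) p" and X: "X \<in> punctured_cone"
    and d: "p differentiable (at X)"
  shows "gradient p X \<bullet> X = - 2 * p X"
proof -
  obtain D where D: "(p has_derivative D) (at X)" using d unfolding differentiable_def by blast
  then have lin: "linear D" using has_derivative_linear by blast
  have "gradient p X \<bullet> X = (\<Sum>b\<in>Basis. (X \<bullet> b) *\<^sub>R D b)"
    unfolding gradient_def pd_eq[OF D] inner_sum_left
    by (intro sum.cong refl) (simp add: mult.commute inner_commute)
  also have "\<dots> = D X"
    by (simp only: linear_sum[OF lin, symmetric] linear_scale[OF lin, symmetric] euclidean_representation)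
  finally have g: "gradient p X \<bullet> X = D X" .
  have "((\<lambda>t::real. t *\<^sub>R X) has_derivative (\<lambda>t. t *\<^sub>R X)) (at 1)"
    by (auto intro!: derivative_eq_intros)
  then have "((\<lambda>t. p (t *\<^sub>R X)) has_derivative (\<lambda>t. D (t *\<^sub>R X))) (at 1)"
    using diff_chain_at[of "\<lambda>t. t *\<^sub>R X" _ "1::real" p D] D by (simp add: o_def)
  then have "((\<lambda>t. t powi -2 * p X) has_derivative (\<lambda>t. D (t *\<^sub>R X))) (at 1)"
    by (rule has_derivative_transform_within_open[of _ _ _ _ "{0<..}"])
      (use hom X in \<open>auto simp: homogeneous_on_def\<close>)
  moreover have "((\<lambda>t::real. t powi -2 * p X) has_derivative (\<lambda>t. - 2 * t * p X)) (at 1)"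
    by (auto intro!: derivative_eq_intros)
  ultimately have "(\<lambda>t. D (t *\<^sub>R X)) = (\<lambda>t. - 2 * t * p X)"
    using has_derivative_unique by blast
  from fun_cong[OF this, of 1] g show ?thesis by simp
qed

text \<open>Incompressibility identifies \<open>f\<close> with the profile \<open>F\<close> belonging to \<open>G\<close>. Euler's identity gives
  \<open>p = Q(z) / r\<^sup>2\<close> with \<open>2 Q = A + z B\<close>; the component of the momentum equation orthogonal to \<open>X\<close>
  then says \<open>Q' = - B\<close>. Substituting \<open>A + z B\<close> and \<open>B\<close> in terms of \<open>T\<close> and \<open>U\<close>, everything cancels
  except the derivative of \<open>T''\<close>, so \<open>T\<close> is a quadratic polynomial.\<close>
theorem solution_is_riccati:
  assumes NS: "hom_NS_solution 1 u p" and ax: "axisymmetric u" "no_swirl u"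
  obtains a b c V where "riccati a b c V"
    "\<And>X. X \<in> punctured_cone \<Longrightarrow> u X = riccati_velocity a b c V X" "\<And>X. X \<in> punctured_cone \<Longrightarrow> p X = riccati_pressure a b c V X"
proof -
  let ?I = "{-1<..<1::real}"
  have su: "smooth_on punctured_cone u" and sp: "smooth_on punctured_cone p"
    and hu: "homogeneous_on punctured_cone (-1) u" and hp: "homogeneous_on punctured_cone (-2) p"
    using NS by (auto simp: hom_NS_solution_def NS_solution_def)
  have eq: "- laplacian u X + convection u X + gradient p X = 0" "divergence u X = 0" if "X \<in> punctured_cone" for X
    using NS that by (auto simp: hom_NS_solution_def NS_solution_def)
  define f where "f z = u (meridian z) $ 1 * recip_sin z" for z
  define G where "G z = u (meridian z) $ 3 - z * f z" for z
  have um: "smooth_on ?I (\<lambda>z. u (meridian z))"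
    by (rule smooth_on_compose[OF _ su smooth_on_meridian]) (use meridian_in_cone in auto)
  have nth: "smooth_on ?I (\<lambda>z. u (meridian z) $ i)" for i
    by (rule smooth_on_linear_comp[OF _ bounded_linear_vec_nth um]) simp
  have sf: "smooth_on ?I f"
    unfolding f_def[abs_def]
    by (intro smooth_on_mult nth smooth_on_recip_sin) auto
  have sG: "smooth_on ?I G"
    unfolding G_def[abs_def]
    by (intro smooth_on_mult smooth_on_diff nth sf smooth_on_bounded_linear bounded_linear_ident) auto
  interpret profile G "pd 1 G" "pd 1 (pd 1 G)" "pd 1 (pd 1 (pd 1 G))"
    by (rule profile_of_smooth[OF sG])
  have uG: "u X = axial f (-2) G (-1) X" if "X \<in> punctured_cone" for X
    using axisymmetric_representation[OF hu ax that] unfolding f_def[abs_def] G_def[abs_def] by simp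
  have fF: "f z = F z" if z: "\<bar>z\<bar> < 1" for z
  proof -
    note m = meridian_in_cone[OF z]
    have df: "(f has_real_derivative pd 1 f (cos_polar (meridian z))) (at (cos_polar (meridian z)))"
      using smooth_on_real_derivative[OF sf, of z] z m by (auto simp: abs_less_iff)
    have "divergence u (meridian z) = divergence (axial f (-2) G (-1)) (meridian z)"
      unfolding divergence_def using pd_cong[OF open_punctured_cone m(1) uG] by simp
    also have "\<dots> = f z + (1 - z\<^sup>2) * pd 1 G z - z * G z"
      using divergence_axial[where F=f and F'="pd 1 f" and G=G and G'="pd 1 G", OF m(1) df, of "-2" "-1"] dG[OF z] m by simp
    finally show ?thesis using eq(2)[OF m(1)] by (simp add: F_def)
  qed
  have uF: "u X = axial F (-2) G (-1) X" if "X \<in> punctured_cone" for X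
    using uG[OF that] fF[OF punctured_coneD(3)[OF that]] by (simp add: axial_def radial_def)
  have mom: "- laplacian (u) X + convection (u) X
      = (A (cos_polar X) / norm X ^ 4) *\<^sub>R X + (B (cos_polar X) / norm X ^ 3) *\<^sub>R e3"
    "divergence (u) X = 0" if "X \<in> punctured_cone" for X
    by (rule momentum(1)[OF uF that], assumption) (rule momentum(2)[OF uF that])
  have grad: "gradient p X = - ((A (cos_polar X) / norm X ^ 4) *\<^sub>R X + (B (cos_polar X) / norm X ^ 3) *\<^sub>R e3)"
    if "X \<in> punctured_cone" for X
    using minus_unique[OF eq(1)[OF that]] unfolding mom(1)[OF that] by (rule sym)
  define Q where "Q z = (A z + z * B z) / 2" for z
  have pQ: "p X = radial Q (-2) X" if X: "X \<in> punctured_cone" for X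
  proof -
    note n = punctured_coneD[OF X]
    have "- 2 * p X = - (A (cos_polar X) / norm X ^ 4 * (norm X)\<^sup>2 + B (cos_polar X) / norm X ^ 3 * (cos_polar X * norm X))"
      unfolding euler_homogeneous[OF hp X smooth_on_differentiable[OF sp X], symmetric] grad[OF X]
      using n(4) by (simp add: inner_diff_left inner_minus_left dot_square_norm)
    also have "\<dots> = - 2 * (Q (cos_polar X) / (norm X)\<^sup>2)"
      using n(1) by (simp add: Q_def field_simps power2_eq_square power3_eq_cube power4_eq_xxxx)
    finally show ?thesis using n(1) by (simp add: radial_def power_int_minus field_simps)
  qed
  have Qd: "(Q has_real_derivative - B z) (at z)" if z: "\<bar>z\<bar> < 1" for z
  proof -
    note m = meridian_in_cone[OF z]
    have sQ: "smooth_on ?I Q"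
      by (rule smooth_on_cong[OF _ _ smooth_on_compose[OF _ sp smooth_on_meridian]])
        (use meridian_in_cone radial_representation[OF pQ] in auto)
    have dQ: "(Q has_real_derivative pd 1 Q z) (at z)" using smooth_on_real_derivative[OF sQ, of z] z by (auto simp: abs_less_iff)
    have 1: "gradient p (meridian z) = (- z * pd 1 Q z - 2 * Q z) *\<^sub>R meridian z + pd 1 Q z *\<^sub>R e3"
      using gradient_radial[OF m(1) _ pQ, of "pd 1 Q z"] dQ m by simp
    have 2: "gradient p (meridian z) = - (A z *\<^sub>R meridian z + B z *\<^sub>R e3)"
      using grad[OF m(1)] m by simp
    have i: "meridian z \<bullet> meridian z = 1" "meridian z $ 3 = z" "e3 $ 3 = (1::real)"
      using m by (simp_all add: dot_square_norm) (simp add: meridian_def vector_3)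
    \<comment> \<open>The vector \<open>e\<^sub>3 - z X\<close> is orthogonal to \<open>X\<close> on the unit sphere.\<close>
    have g1: "gradient p (meridian z) \<bullet> (e3 - z *\<^sub>R meridian z) = (1 - z * z) * pd 1 Q z"
      unfolding 1 by (simp add: inner_add_left inner_diff_right i del: axis_nth) (simp add: algebra_simps)
    have g2: "gradient p (meridian z) \<bullet> (e3 - z *\<^sub>R meridian z) = (1 - z * z) * (- B z)"
      unfolding 2 inner_minus_left by (simp add: inner_add_left inner_diff_right i del: axis_nth) (simp add: i algebra_simps)
    have w: "1 - z * z \<noteq> 0" using one_minus_sq_pos[OF z] by (simp add: power2_eq_square)
    have "pd 1 Q z = - B z"
      using trans[OF sym[OF g1] g2] unfolding mult_left_cancel[OF w] .
    then show ?thesis using dQ by simp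
  qed
  have T2d: "(T2 has_real_derivative 0) (at z)" if z: "\<bar>z\<bar> < 1" for z
  proof -
    have "T2 z = - 2 * Q z + 2 * U1 z - (1 - z\<^sup>2) * (G z)\<^sup>2" for z
      unfolding Q_def A_zB_eq by (simp add: field_simps)
    then have "T2 = (\<lambda>z. - 2 * Q z + 2 * U1 z - (1 - z\<^sup>2) * (G z)\<^sup>2)" ..
    moreover have "((\<lambda>z. - 2 * Q z + 2 * U1 z - (1 - z\<^sup>2) * (G z)\<^sup>2) has_real_derivative 0) (at z)"
      by (rule derivative_eq_intros Qd derivs dG z refl)+ (simp add: B_eq F_def algebra_simps power2_eq_square)
    ultimately show ?thesis by simp
  qed
  have const: "h z = h 0" if hd0: "\<And>z. \<bar>z\<bar> < 1 \<Longrightarrow> (h has_real_derivative 0) (at z)" and "\<bar>z\<bar> < 1" for h z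
  proof -
    have "(h has_field_derivative 0) (at x within ?I)" if "x \<in> ?I" for x
      by (rule has_field_derivative_at_within, rule hd0) (use \<open>x \<in> ?I\<close> in auto)
    then obtain c where "\<forall>x\<in>?I. h x = c"
      using has_field_derivative_zero_constant[of ?I h] by (meson convex_real_interval(8))
    then show ?thesis using \<open>\<bar>z\<bar> < 1\<close> by (auto simp: abs_less_iff)
  qed
  define c where "c = T2 0 / 2"
  have T2: "T2 z = 2 * c" if "\<bar>z\<bar> < 1" for z using const[OF T2d that] by (simp add: c_def)
  have T1: "T1 z - 2 * c * z = T1 0 - 2 * c * 0" if z: "\<bar>z\<bar> < 1" for z
  proof (rule const[where h="\<lambda>z. T1 z - 2 * c * z", OF _ z])
    fix y :: real assume y: "\<bar>y\<bar> < 1"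
    have "((\<lambda>z. T1 z - 2 * c * z) has_real_derivative T2 y - 2 * c * 1) (at y)"
      by (intro DERIV_diff T_derivs(2)[OF y] DERIV_cmult DERIV_ident)
    then show "((\<lambda>z. T1 z - 2 * c * z) has_real_derivative 0) (at y)" by (simp add: T2[OF y])
  qed
  have T0: "T z - (T1 0 * z + c * z\<^sup>2) = T 0 - (T1 0 * 0 + c * 0\<^sup>2)" if z: "\<bar>z\<bar> < 1" for z
  proof (rule const[where h="\<lambda>z. T z - (T1 0 * z + c * z\<^sup>2)", OF _ z])
    fix y :: real assume y: "\<bar>y\<bar> < 1"
    have "((\<lambda>z. T z - (T1 0 * z + c * z\<^sup>2)) has_real_derivative T1 y - (T1 0 * 1 + c * (2 * y))) (at y)"
      by (intro DERIV_diff DERIV_add T_derivs(1)[OF y] DERIV_cmult DERIV_ident)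
        (auto intro!: derivative_eq_intros)
    then show "((\<lambda>z. T z - (T1 0 * z + c * z\<^sup>2)) has_real_derivative 0) (at y)"
      using T1[OF y] by (simp add: algebra_simps)
  qed
  have rhs: "riccati_rhs (T 0) (T1 0) c U z = U1 z" if z: "\<bar>z\<bar> < 1" for z
    using T0[OF z] one_minus_sq_pos[OF z] by (simp add: riccati_rhs_def quad_def T_def[of z] field_simps)
  have R: "riccati (T 0) (T1 0) c U"
    unfolding riccati_def using rhs derivs(1) by simp
  have pG: "prof_G U z = G z" if z: "\<bar>z\<bar> < 1" for z
    using one_minus_sq_pos[OF z] by (simp add: prof_G_def U_def field_simps)
  have pF: "prof_F (T 0) (T1 0) c U z = F z" if z: "\<bar>z\<bar> < 1" for z
    by (simp add: prof_F_def rhs pG z U1_def F_def)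
  have pQ': "prof_Q (T 0) (T1 0) c U z = Q z" if z: "\<bar>z\<bar> < 1" for z
    using A_zB_eq[of z] by (simp add: prof_Q_def rhs pG z Q_def T2 field_simps)
  show thesis
    by (rule that[OF R])
      (use pG pF pQ' pQ uF punctured_coneD(3) in \<open>simp_all add: riccati_velocity_def riccati_pressure_def axial_def radial_def\<close>)
qed

section \<open>Every Riccati solution gives a solution\<close>

text \<open>Bootstrapped from \<open>\<nabla>(1 / r) = - X / r\<^sup>3\<close>.\<close>
lemma smooth_on_inverse_norm: "smooth_on (UNIV - {0}) (\<lambda>X::'a::euclidean_space. inverse (norm X))"
proof -
  have o: "open (UNIV - {0::'a})" by auto
  have d: "((\<lambda>X. inverse (norm X)) has_derivative
     (\<lambda>h. - ((X \<bullet> h) * (inverse (norm X) * inverse (norm X) * inverse (norm X))))) (at X)" if "X \<in> UNIV - {0}" for X :: 'a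
    using that
    by (auto intro!: derivative_eq_intros has_derivative_norm[THEN has_derivative_eq_rhs] simp: fun_eq_iff sgn_div_norm inner_commute field_simps)
  have "smooth_conv n (UNIV - {0}) {} (\<lambda>_ X::'a. inverse (norm X)) (\<lambda>X. inverse (norm X))" for n
  proof (induction n)
    case (Suc n)
    have "smooth_conv n (UNIV - {0}) {}
       (\<lambda>_ X::'a. - ((X \<bullet> b) * (inverse (norm X) * inverse (norm X) * inverse (norm X))))
       (\<lambda>X. - ((X \<bullet> b) * (inverse (norm X) * inverse (norm X) * inverse (norm X))))" for b
      by (intro smooth_conv_linear[OF o _ bounded_linear_minus[OF bounded_linear_ident]] smooth_conv_mult o
          smooth_conv_bounded_linear[OF o _ bounded_linear_inner_left] Suc) auto
    then show ?case
      by (intro smooth_conv_SucI[OF o _ d d]) auto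
  qed simp
  then show ?thesis by (simp add: smooth_on_iff_smooth_conv)
qed

text \<open>The preceding reduction read backwards. Smoothness of the profiles comes from
  \<open>riccati_smooth\<close>, and the relations \<open>T'' = 2 c\<close> and \<open>U = V\<close> hold by differentiating the Riccati
  equation, which is an identity on an open interval.\<close>
theorem riccati_gives_solution:
  assumes R: "riccati a b c V"
  shows "hom_NS_solution 1 (riccati_velocity a b c V) (riccati_pressure a b c V)"
proof -
  let ?I = "{-1<..<1::real}"
  have sV: "smooth_on ?I V" by (rule riccati_smooth[OF R])
  have sq: "smooth_on ?I (\<lambda>z. 1 / (1 - z\<^sup>2))"
    by (auto simp: smooth_on_iff_smooth_conv intro: smooth_conv_inverse_weight)
  have sid: "smooth_on ?I (\<lambda>z. z)" by (intro smooth_on_bounded_linear bounded_linear_ident) simp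
  have sR: "smooth_on ?I (riccati_rhs a b c V)"
    unfolding smooth_on_iff_smooth_conv
    by (intro allI smooth_conv_riccati_rhs[where a="\<lambda>_. a" and b="\<lambda>_. b" and c="\<lambda>_. c"]) (auto intro: smooth_on_conv[OF sV])
  have "smooth_on ?I (\<lambda>z. (0 - V z) * (1 / (1 - z\<^sup>2)))"
    by (intro smooth_on_mult smooth_on_diff smooth_on_const sV sq) auto
  then have sG: "smooth_on ?I (prof_G V)" by (simp add: prof_G_def[abs_def])
  have sF: "smooth_on ?I (prof_F a b c V)" unfolding prof_F_def[abs_def]
    by (intro smooth_on_mult smooth_on_diff sid sG sR) auto
  have "smooth_on ?I (\<lambda>z. riccati_rhs a b c V z - c - (1 / 2) * ((1 - z * z) * (prof_G V z * prof_G V z)))"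
    by (intro smooth_on_mult smooth_on_diff sid sG sR smooth_on_const) auto
  then have sQ: "smooth_on ?I (prof_Q a b c V)" by (simp add: prof_Q_def[abs_def] power2_eq_square)
  interpret profile "prof_G V" "pd 1 (prof_G V)" "pd 1 (pd 1 (prof_G V))" "pd 1 (pd 1 (pd 1 (prof_G V)))"
    by (rule profile_of_smooth[OF sG])
  have opn: "open ?I" by simp
  have UV: "U z = V z" if z: "\<bar>z\<bar> < 1" for z
    using one_minus_sq_pos[OF z] by (simp add: U_def prof_G_def field_simps)
  have uniq: "g' z = h' z" if "\<And>z. \<bar>z\<bar> < 1 \<Longrightarrow> g z = h z" "(g has_real_derivative g' z) (at z)" "(h has_real_derivative h' z) (at z)" "\<bar>z\<bar> < 1"
    for g g' h h' :: "real \<Rightarrow> real" and z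
    by (rule DERIV_unique[OF that(2) DERIV_cong_ev[OF refl _ refl, THEN iffD1, OF _ that(3)]])
      (rule eventually_nhds_in_open[OF opn, THEN eventually_mono], use that in auto)
  have U1: "U1 z = riccati_rhs a b c V z" if z: "\<bar>z\<bar> < 1" for z
    by (rule uniq[where g=U and g'=U1 and h=V and h'="riccati_rhs a b c V", OF UV derivs(1)[OF z] _ z]) (use R z in \<open>simp_all add: riccati_def\<close>)
  have T: "T z = quad a b c z" if z: "\<bar>z\<bar> < 1" for z
    using one_minus_sq_pos[OF z] by (simp add: T_def U1 UV z riccati_rhs_def)
  have T1: "T1 z = b + 2 * c * z" if z: "\<bar>z\<bar> < 1" for z
    by (rule uniq[where g=T and g'=T1 and h="quad a b c" and h'="\<lambda>z. b + 2 * c * z", OF T T_derivs(1)[OF z] _ z]) (auto intro!: derivative_eq_intros simp: quad_def[abs_def])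
  have T2: "T2 z = 2 * c" if z: "\<bar>z\<bar> < 1" for z
    by (rule uniq[where g=T1 and g'=T2 and h="\<lambda>z. b + 2 * c * z" and h'="\<lambda>z. 2 * c", OF T1 T_derivs(2)[OF z] _ z]) (auto intro!: derivative_eq_intros)
  have F: "prof_F a b c V z = F z" if z: "\<bar>z\<bar> < 1" for z
    by (simp add: prof_F_def U1[OF z, symmetric] U1_def F_def)
  have Q: "prof_Q a b c V z = U1 z - c - 1 / 2 * ((1 - z\<^sup>2) * (prof_G V z)\<^sup>2)" if z: "\<bar>z\<bar> < 1" for z
    by (simp add: prof_Q_def U1[OF z])
  have dQ: "(prof_Q a b c V has_real_derivative - B z) (at z)" if z: "\<bar>z\<bar> < 1" for z
  proof -
    have "((\<lambda>z. U1 z - c - 1 / 2 * ((1 - z\<^sup>2) * (prof_G V z)\<^sup>2)) has_real_derivative - B z) (at z)"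
      by (rule derivative_eq_intros derivs dG z refl)+ (simp_all add: B_eq F_def field_simps power2_eq_square)
    then show ?thesis
      by (rule DERIV_cong_ev[OF refl _ refl, THEN iffD2, rotated])
        (rule eventually_nhds_in_open[OF opn, THEN eventually_mono], use Q z in auto)
  qed
  have uF: "riccati_velocity a b c V X = axial F (-2) (prof_G V) (-1) X" if "X \<in> punctured_cone" for X
    using F[OF punctured_coneD(3)[OF that]] by (simp add: riccati_velocity_def axial_def radial_def)
  have mom: "- laplacian (riccati_velocity a b c V) X + convection (riccati_velocity a b c V) X
      = (A (cos_polar X) / norm X ^ 4) *\<^sub>R X + (B (cos_polar X) / norm X ^ 3) *\<^sub>R e3"
    "divergence (riccati_velocity a b c V) X = 0" if "X \<in> punctured_cone" for X
    by (rule momentum(1)[OF uF that], assumption) (rule momentum(2)[OF uF that])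
  have cone0: "punctured_cone \<subseteq> UNIV - {0}" using punctured_coneD(2) by auto
  have sub: "smooth_on punctured_cone g" if "smooth_on (UNIV - {0}) g" for g :: "real^3 \<Rightarrow> real"
    using that cone0 unfolding smooth_on_def by blast
  note sn = sub[OF smooth_on_inverse_norm]
  have scp: "smooth_on punctured_cone cos_polar"
    unfolding cos_polar_def[abs_def] divide_inverse
    by (intro smooth_on_mult open_punctured_cone sn smooth_on_bounded_linear bounded_linear_vec_nth)
  have comp: "smooth_on punctured_cone (\<lambda>X. g (cos_polar X))" if "smooth_on ?I g" for g :: "real \<Rightarrow> real"
    by (rule smooth_on_compose[OF open_punctured_cone that scp]) (use punctured_coneD(3) in force)
  have rad: "smooth_on punctured_cone (radial g (-2))" "smooth_on punctured_cone (radial g (-1))" if "smooth_on ?I g" for g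
  proof -
    have "smooth_on punctured_cone (\<lambda>X. g (cos_polar X) * (inverse (norm X) * inverse (norm X)))"
      "smooth_on punctured_cone (\<lambda>X. g (cos_polar X) * inverse (norm X))"
      by (intro smooth_on_mult open_punctured_cone comp that sn)+
    then show "smooth_on punctured_cone (radial g (-2))" "smooth_on punctured_cone (radial g (-1))"
      by (simp_all add: radial_def[abs_def] power_int_minus power2_eq_square)
  qed
  have "smooth_on punctured_cone (riccati_velocity a b c V)"
    unfolding riccati_velocity_def axial_def[abs_def]
    by (intro smooth_on_add smooth_on_scaleR rad sF sG open_punctured_cone smooth_on_const smooth_on_bounded_linear bounded_linear_ident)
  moreover have "smooth_on punctured_cone (riccati_pressure a b c V)"
    unfolding riccati_pressure_def by (rule rad[OF sQ])
  moreover have "- laplacian (riccati_velocity a b c V) X + convection (riccati_velocity a b c V) X + gradient (riccati_pressure a b c V) X = 0"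
    if X: "X \<in> punctured_cone" for X
  proof -
    note n = punctured_coneD[OF X]
    let ?z = "cos_polar X"
    have g: "gradient (riccati_pressure a b c V) X = ((?z * B ?z - 2 * prof_Q a b c V ?z) / norm X ^ 4) *\<^sub>R X + (- B ?z / norm X ^ 3) *\<^sub>R e3"
      using gradient_radial[OF X dQ[OF n(3)], of "riccati_pressure a b c V"] by (simp add: riccati_pressure_def)
    have "A ?z + (?z * B ?z - 2 * prof_Q a b c V ?z) = 0"
      using A_zB_eq[of ?z] Q[OF n(3)] T2[OF n(3)] by (simp add: field_simps)
    then have "A ?z / norm X ^ 4 + (?z * B ?z - 2 * prof_Q a b c V ?z) / norm X ^ 4 = 0"
      by (simp flip: add_divide_distrib)
    then show ?thesis
      unfolding mom(1)[OF X] g by (simp add: algebra_simps flip: scaleR_left.add)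
  qed
  moreover have "homogeneous_on punctured_cone (-1) (riccati_velocity a b c V)" "homogeneous_on punctured_cone (-2) (riccati_pressure a b c V)"
    unfolding homogeneous_on_def riccati_velocity_def riccati_pressure_def axial_def radial_def
    by (auto simp: cos_polar_def power_int_mult_distrib power_int_minus field_simps power2_eq_square scaleR_add_right)
  ultimately show ?thesis
    using mom(2) by (simp add: hom_NS_solution_def NS_solution_def)
qed

section \<open>Estimates for the Riccati equation\<close>

text \<open>In the angle \<open>\<theta>\<close> the singular factor \<open>1 - z\<^sup>2\<close> becomes \<open>sin \<theta>\<close>, and zones become
  intervals; the estimates are carried out in this variable.\<close>
lemma riccati_polar:
  assumes R: "riccati a b c V" and \<theta>: "0 < \<theta>" "\<theta> < pi"
  obtains y' where "((\<lambda>\<theta>. V (cos \<theta>)) has_real_derivative y') (at \<theta>)"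
    "quad a b c (cos \<theta>) = - sin \<theta> * y' + 2 * cos \<theta> * V (cos \<theta>) + (V (cos \<theta>))\<^sup>2 / 2"
proof -
  have s: "sin \<theta> > 0" using \<theta> by (rule sin_gt_zero)
  have "(cos \<theta>)\<^sup>2 < 1" using s by (simp add: cos_squared_eq)
  then have c: "\<bar>cos \<theta>\<bar> < 1" by (simp add: abs_square_less_1)
  have w: "1 - (cos \<theta>)\<^sup>2 = sin \<theta> * sin \<theta>" by (simp add: sin_squared_eq flip: power2_eq_square)
  have "((\<lambda>\<theta>. V (cos \<theta>)) has_real_derivative riccati_rhs a b c V (cos \<theta>) * (- sin \<theta>)) (at \<theta>)"
    using DERIV_chain2[of V _ cos \<theta> "- sin \<theta>" UNIV] R c DERIV_cos unfolding riccati_def by blast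
  then show thesis
    by (rule that) (use s in \<open>simp add: riccati_rhs_def w field_simps\<close>)
qed

lemma riccati_polar_continuous:
  assumes "riccati a b c V" "0 < \<alpha>" "\<beta> < pi"
  shows "continuous_on {\<alpha>..\<beta>} (\<lambda>\<theta>. V (cos \<theta>))"
proof (rule continuous_at_imp_continuous_on, rule ballI)
  fix \<theta> assume "\<theta> \<in> {\<alpha>..\<beta>}"
  then show "isCont (\<lambda>\<theta>. V (cos \<theta>)) \<theta>"
    using riccati_polar[OF assms(1), of \<theta>] assms by (metis DERIV_isCont atLeastAtMost_iff less_le_trans le_less_trans)
qed

lemma continuous_large_abs_sign:
  fixes f :: "real \<Rightarrow> real"
  assumes "continuous_on {\<alpha>..\<beta>} f" "A \<ge> 0" "\<And>t. t \<in> {\<alpha>..\<beta>} \<Longrightarrow> \<bar>f t\<bar> > A"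
  shows "(\<forall>t\<in>{\<alpha>..\<beta>}. f t > A) \<or> (\<forall>t\<in>{\<alpha>..\<beta>}. f t < - A)"
proof (rule ccontr)
  assume "\<not> ?thesis"
  then obtain s t where s: "s \<in> {\<alpha>..\<beta>}" "\<not> f s > A" and t: "t \<in> {\<alpha>..\<beta>}" "\<not> f t < - A" by blast
  have "f s < - A" "f t > A" using assms(3)[OF s(1)] assms(3)[OF t(1)] s t by linarith+
  moreover have "connected (f ` {\<alpha>..\<beta>})" by (rule connected_continuous_image[OF assms(1)]) simp
  ultimately have "0 \<in> f ` {\<alpha>..\<beta>}"
    using connectedD_interval[of "f ` {\<alpha>..\<beta>}" "f s" "f t" 0] s t assms(2) by simp
  then show False using assms(2,3) by fastforce
qed

text \<open>Multiply the equation by \<open>\<phi>(t) = (t - \<alpha>) (\<beta> - t)\<close> and integrate. Integration by parts removes the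
  derivative without boundary terms, and what is left is at most quadratic in \<open>V\<close>. If the polynomial
  were large on the whole interval it would have constant sign there, and its weighted integral would
  be too large.\<close>
lemma riccati_small_forcing:
  assumes "0 < \<alpha>" "\<alpha> < \<beta>" "\<beta> < pi"
  obtains C where "C > 0" "\<And>a b c V. riccati a b c V \<Longrightarrow>
     \<exists>\<theta>\<in>{\<alpha>..\<beta>}. \<bar>quad a b c (cos \<theta>)\<bar> \<le> C * (1 + integral {\<alpha>..\<beta>} (\<lambda>\<theta>. (V (cos \<theta>))\<^sup>2))"
proof -
  define \<phi> where "\<phi> t = (t - \<alpha>) * (\<beta> - t)" for t
  have pi4: "pi < 4" using pi_less_4 .
  have \<phi>: "0 \<le> \<phi> t" "\<phi> t \<le> 16" if "t \<in> {\<alpha>..\<beta>}" for t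
  proof -
    show "0 \<le> \<phi> t" using that by (simp add: \<phi>_def)
    have "\<phi> t \<le> 4 * 4" unfolding \<phi>_def using that assms pi4 by (intro mult_mono) auto
    then show "\<phi> t \<le> 16" by simp
  qed
  have c\<phi>: "continuous_on {\<alpha>..\<beta>} \<phi>" unfolding \<phi>_def[abs_def] by (intro continuous_intros)
  define I where "I = integral {\<alpha>..\<beta>} \<phi>"
  have "I > 0"
  proof -
    have "((\<lambda>t. \<phi> t) has_integral ((\<alpha> + \<beta>) * \<beta>\<^sup>2 / 2 - \<beta> ^ 3 / 3 - \<alpha> * \<beta> * \<beta>) - ((\<alpha> + \<beta>) * \<alpha>\<^sup>2 / 2 - \<alpha> ^ 3 / 3 - \<alpha> * \<beta> * \<alpha>)) {\<alpha>..\<beta>}"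
      by (rule fundamental_theorem_of_calculus)
        (use assms in \<open>auto intro!: derivative_eq_intros simp: \<phi>_def algebra_simps power2_eq_square simp flip: has_real_derivative_iff_has_vector_derivative\<close>)
    then have "I = ((\<alpha> + \<beta>) * \<beta>\<^sup>2 / 2 - \<beta> ^ 3 / 3 - \<alpha> * \<beta> * \<beta>) - ((\<alpha> + \<beta>) * \<alpha>\<^sup>2 / 2 - \<alpha> ^ 3 / 3 - \<alpha> * \<beta> * \<alpha>)"
      by (simp add: I_def integral_unique)
    also have "\<dots> = (\<beta> - \<alpha>) ^ 3 / 6" by (simp add: field_simps power2_eq_square power3_eq_cube)
    finally have "I = (\<beta> - \<alpha>) ^ 3 / 6" .
    moreover have "(\<beta> - \<alpha>) ^ 3 > 0" using assms by (intro zero_less_power) simp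
    ultimately show ?thesis by linarith
  qed
  show thesis
  proof (rule that[of "140 / I"])
    show "140 / I > 0" using \<open>I > 0\<close> by simp
    fix a b c V assume R: "riccati a b c V"
    let ?y = "\<lambda>\<theta>. V (cos \<theta>)" and ?P = "\<lambda>\<theta>. quad a b c (cos \<theta>)"
    have cy: "continuous_on {\<alpha>..\<beta>} ?y" using riccati_polar_continuous[OF R] assms by simp
    have cP: "continuous_on {\<alpha>..\<beta>} ?P" unfolding quad_def by (intro continuous_intros)
    define M where "M = integral {\<alpha>..\<beta>} (\<lambda>\<theta>. (?y \<theta>)\<^sup>2)"
    have M: "M \<ge> 0" unfolding M_def by (rule integral_nonneg) (auto intro!: integrable_continuous_interval continuous_intros cy)
    define k where "k t = (((\<beta> - t) - (t - \<alpha>)) * sin t + 3 * \<phi> t * cos t) * ?y t + \<phi> t * (?y t)\<^sup>2 / 2" for t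
    have ck: "continuous_on {\<alpha>..\<beta>} k" unfolding k_def[abs_def] by (intro continuous_intros cy c\<phi>) auto
    have d: "((\<lambda>t. \<phi> t * sin t * ?y t) has_real_derivative (k t - \<phi> t * ?P t)) (at t)" if "t \<in> {\<alpha>..\<beta>}" for t
    proof -
      have tp: "0 < t" "t < pi" using that assms by auto
      obtain y' where y': "(?y has_real_derivative y') (at t)" "?P t = - sin t * y' + 2 * cos t * ?y t + (?y t)\<^sup>2 / 2"
        by (rule riccati_polar[OF R tp])
      show ?thesis unfolding \<phi>_def k_def y'(2)
        by (rule derivative_eq_intros y' refl)+ (simp add: field_simps)
    qed
    have "((\<lambda>t. k t - \<phi> t * ?P t) has_integral \<phi> \<beta> * sin \<beta> * ?y \<beta> - \<phi> \<alpha> * sin \<alpha> * ?y \<alpha>) {\<alpha>..\<beta>}"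
      by (rule fundamental_theorem_of_calculus)
        (use assms d in \<open>auto intro: has_field_derivative_at_within simp flip: has_real_derivative_iff_has_vector_derivative\<close>)
    then have "integral {\<alpha>..\<beta>} (\<lambda>t. k t - \<phi> t * ?P t) = 0"
      by (simp add: \<phi>_def integral_unique)
    moreover have i\<phi>P: "(\<lambda>t. \<phi> t * ?P t) integrable_on {\<alpha>..\<beta>}" and ik: "k integrable_on {\<alpha>..\<beta>}"
      by (auto intro!: integrable_continuous_interval continuous_intros ck c\<phi> cP)
    ultimately have eq: "integral {\<alpha>..\<beta>} (\<lambda>t. \<phi> t * ?P t) = integral {\<alpha>..\<beta>} k"
      by (simp add: integral_diff)
    have "norm (integral {\<alpha>..\<beta>} k) \<le> integral {\<alpha>..\<beta>} (\<lambda>t. 34 + 34 * (?y t)\<^sup>2)"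
    proof (rule integral_norm_bound_integral[OF ik])
      show "(\<lambda>t. 34 + 34 * (?y t)\<^sup>2) integrable_on {\<alpha>..\<beta>}"
        by (auto intro!: integrable_continuous_interval continuous_intros cy)
      fix t assume t: "t \<in> {\<alpha>..\<beta>}"
      have "\<bar>((\<beta> - t) - (t - \<alpha>)) * sin t\<bar> \<le> 4 * 1"
        unfolding abs_mult using t assms pi4 by (intro mult_mono) auto
      moreover have "\<bar>\<phi> t * cos t\<bar> \<le> 16 * 1"
        unfolding abs_mult using \<phi>[OF t] by (intro mult_mono) auto
      ultimately have "\<bar>((\<beta> - t) - (t - \<alpha>)) * sin t + 3 * \<phi> t * cos t\<bar> \<le> 52" by (simp add: abs_le_iff)
      then have "\<bar>(((\<beta> - t) - (t - \<alpha>)) * sin t + 3 * \<phi> t * cos t) * ?y t\<bar> \<le> 52 * \<bar>?y t\<bar>"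
        unfolding abs_mult by (intro mult_mono) auto
      moreover have "\<bar>\<phi> t * (?y t)\<^sup>2 / 2\<bar> \<le> 8 * (?y t)\<^sup>2" using \<phi>[OF t] mult_right_mono[of "\<phi> t" 16 "(?y t)\<^sup>2"] by simp
      moreover have "2 * \<bar>?y t\<bar> \<le> 1 + (?y t)\<^sup>2" using zero_le_power2[of "\<bar>?y t\<bar> - 1"] by (simp add: power2_diff)
      ultimately show "norm (k t) \<le> 34 + 34 * (?y t)\<^sup>2" unfolding k_def real_norm_def by (smt (verit))
    qed
    also have "\<dots> = 34 * (\<beta> - \<alpha>) + 34 * M"
      unfolding M_def using assms
      by (subst integral_add) (auto intro!: integrable_continuous_interval continuous_intros cy)
    also have "\<dots> < 140 * (1 + M)" using assms pi4 M by simp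
    finally have up: "\<bar>integral {\<alpha>..\<beta>} (\<lambda>t. \<phi> t * ?P t)\<bar> < 140 * (1 + M)" by (simp add: eq)
    define A where "A = 140 / I * (1 + M)"
    have A: "A \<ge> 0" using M \<open>I > 0\<close> by (simp add: A_def)
    have AI: "integral {\<alpha>..\<beta>} (\<lambda>t. \<phi> t * A) = 140 * (1 + M)"
      using \<open>I > 0\<close> by (simp add: A_def I_def[symmetric])
    have i\<phi>A: "(\<lambda>t. \<phi> t * A) integrable_on {\<alpha>..\<beta>}"
      by (auto intro!: integrable_continuous_interval continuous_intros c\<phi>)
    show "\<exists>\<theta>\<in>{\<alpha>..\<beta>}. \<bar>?P \<theta>\<bar> \<le> 140 / I * (1 + integral {\<alpha>..\<beta>} (\<lambda>\<theta>. (?y \<theta>)\<^sup>2))"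
    proof (rule ccontr)
      assume "\<not> ?thesis"
      then have "\<bar>?P t\<bar> > A" if "t \<in> {\<alpha>..\<beta>}" for t using that by (auto simp: A_def M_def not_le)
      from continuous_large_abs_sign[OF cP A this] show False
      proof
        assume *: "\<forall>t\<in>{\<alpha>..\<beta>}. ?P t > A"
        have "integral {\<alpha>..\<beta>} (\<lambda>t. \<phi> t * A) \<le> integral {\<alpha>..\<beta>} (\<lambda>t. \<phi> t * ?P t)"
          using * \<phi> by (intro integral_le i\<phi>P i\<phi>A mult_left_mono) (auto intro: less_imp_le)
        then show False using up AI by simp
      next
        assume *: "\<forall>t\<in>{\<alpha>..\<beta>}. ?P t < - A"
        have "integral {\<alpha>..\<beta>} (\<lambda>t. \<phi> t * ?P t) \<le> integral {\<alpha>..\<beta>} (\<lambda>t. - (\<phi> t * A))"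
          using * \<phi> by (intro integral_le i\<phi>P integrable_neg i\<phi>A)
            (metis less_imp_le minus_mult_right mult_left_mono)
        then show False using up AI by simp
      qed
    qed
  qed
qed

text \<open>Newton's divided differences: \<open>p\<close> and \<open>q\<close> are the first ones, \<open>c\<close> is the second one.\<close>
lemma quad_coefficient_bound:
  fixes x1 x2 x3 :: real
  assumes \<delta>: "0 < \<delta>" "\<delta> \<le> 1" and x: "x1 - x2 \<ge> \<delta>" "x2 - x3 \<ge> \<delta>" "\<bar>x1\<bar> \<le> 1" "\<bar>x2\<bar> \<le> 1"
    and A: "\<bar>quad a b c x1\<bar> \<le> A" "\<bar>quad a b c x2\<bar> \<le> A" "\<bar>quad a b c x3\<bar> \<le> A"
  shows "\<bar>a\<bar> \<le> 15 * A / \<delta>\<^sup>2" "\<bar>b\<bar> \<le> 15 * A / \<delta>\<^sup>2" "\<bar>c\<bar> \<le> 15 * A / \<delta>\<^sup>2"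
proof -
  have A0: "A \<ge> 0" using A by linarith
  have \<delta>2: "A \<le> A / \<delta>\<^sup>2" "A / \<delta> \<le> A / \<delta>\<^sup>2"
  proof -
    have "\<delta>\<^sup>2 \<le> \<delta>" "\<delta>\<^sup>2 \<le> 1" using \<delta> by (simp_all add: power2_eq_square mult_le_one mult_left_le)
    then show "A \<le> A / \<delta>\<^sup>2" "A / \<delta> \<le> A / \<delta>\<^sup>2"
      using \<delta> A0 divide_left_mono[of "\<delta>\<^sup>2" \<delta> A] divide_left_mono[of "\<delta>\<^sup>2" 1 A] by simp_all
  qed
  define p q where "p = b + c * (x1 + x2)" and "q = b + c * (x2 + x3)"
  have p: "\<bar>p\<bar> \<le> 2 * A / \<delta>"
  proof -
    have "quad a b c x1 - quad a b c x2 = (x1 - x2) * p" by (simp add: quad_def p_def algebra_simps power2_eq_square)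
    moreover have "(x1 - x2) * \<bar>p\<bar> = \<bar>(x1 - x2) * p\<bar>" using \<delta> x by (simp add: abs_mult)
    ultimately have "(x1 - x2) * \<bar>p\<bar> \<le> 2 * A" using A by linarith
    then have "\<delta> * \<bar>p\<bar> \<le> 2 * A" using mult_right_mono[OF x(1), of "\<bar>p\<bar>"] by simp
    then show ?thesis using \<delta> by (simp add: le_divide_eq mult.commute)
  qed
  have q: "\<bar>q\<bar> \<le> 2 * A / \<delta>"
  proof -
    have "quad a b c x2 - quad a b c x3 = (x2 - x3) * q" by (simp add: quad_def q_def algebra_simps power2_eq_square)
    moreover have "(x2 - x3) * \<bar>q\<bar> = \<bar>(x2 - x3) * q\<bar>" using \<delta> x by (simp add: abs_mult)
    ultimately have "(x2 - x3) * \<bar>q\<bar> \<le> 2 * A" using A by linarith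
    then have "\<delta> * \<bar>q\<bar> \<le> 2 * A" using mult_right_mono[OF x(2), of "\<bar>q\<bar>"] by simp
    then show ?thesis using \<delta> by (simp add: le_divide_eq mult.commute)
  qed
  have "p - q = (x1 - x3) * c" by (simp add: p_def q_def algebra_simps)
  then have "(x1 - x3) * \<bar>c\<bar> = \<bar>p - q\<bar>" using x \<delta> by (simp add: abs_mult)
  also have "\<dots> \<le> 4 * A / \<delta>" using p q by linarith
  finally have "(x1 - x3) * \<bar>c\<bar> \<le> 4 * A / \<delta>" .
  moreover have "\<delta> * \<bar>c\<bar> \<le> (x1 - x3) * \<bar>c\<bar>" using x \<delta> by (intro mult_right_mono) auto
  ultimately have "\<delta> * \<bar>c\<bar> \<le> 4 * A / \<delta>" by linarith
  then have c: "\<bar>c\<bar> \<le> 4 * (A / \<delta>\<^sup>2)" using \<delta> by (simp add: field_simps power2_eq_square)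
  then show "\<bar>c\<bar> \<le> 15 * A / \<delta>\<^sup>2" using \<delta>2 A0 by linarith
  have "\<bar>c * (x1 + x2)\<bar> \<le> 4 * (A / \<delta>\<^sup>2) * 2" unfolding abs_mult using c x by (intro mult_mono) auto
  then have b: "\<bar>b\<bar> \<le> 10 * (A / \<delta>\<^sup>2)" using p \<delta>2 unfolding p_def by (simp add: abs_le_iff)
  then show "\<bar>b\<bar> \<le> 15 * A / \<delta>\<^sup>2" using \<delta>2 A0 by linarith
  have "\<bar>b * x1\<bar> \<le> 10 * (A / \<delta>\<^sup>2) * 1" unfolding abs_mult using b x by (intro mult_mono) auto
  moreover have "\<bar>c * x1\<^sup>2\<bar> \<le> 4 * (A / \<delta>\<^sup>2) * 1" unfolding abs_mult using c x by (intro mult_mono) (auto simp: abs_square_le_1)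
  ultimately show "\<bar>a\<bar> \<le> 15 * A / \<delta>\<^sup>2" using A(1) \<delta>2 unfolding quad_def by (simp add: abs_le_iff)
qed

text \<open>Of five equal parts of the interval the first, third and fifth each contain a point where the
  polynomial is small; the second and fourth keep these points apart.\<close>
lemma riccati_coefficient_bound:
  assumes "0 < \<alpha>" "\<alpha> < \<beta>" "\<beta> < pi"
  obtains C where "C > 0" "\<And>a b c V. riccati a b c V \<Longrightarrow>
     \<bar>a\<bar> \<le> C * (1 + integral {\<alpha>..\<beta>} (\<lambda>\<theta>. (V (cos \<theta>))\<^sup>2)) \<and>
     \<bar>b\<bar> \<le> C * (1 + integral {\<alpha>..\<beta>} (\<lambda>\<theta>. (V (cos \<theta>))\<^sup>2)) \<and>
     \<bar>c\<bar> \<le> C * (1 + integral {\<alpha>..\<beta>} (\<lambda>\<theta>. (V (cos \<theta>))\<^sup>2))"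
proof -
  define t where "t i = \<alpha> + real i * ((\<beta> - \<alpha>) / 5)" for i :: nat
  have h: "(\<beta> - \<alpha>) / 5 > 0" using assms by simp
  have tmono: "t i < t j" if "i < j" for i j using that h by (simp add: t_def)
  have t0: "t 0 = \<alpha>" and t5: "t 5 = \<beta>" by (simp_all add: t_def diff_divide_distrib)
  have tin: "\<alpha> \<le> t i" "t i \<le> \<beta>" if "i \<le> 5" for i
    using tmono[of 0 i] tmono[of i 5] that t0 t5 by (cases "i = 0"; cases "i = 5"; simp)+
  have ex: "\<exists>C>0. \<forall>a b c V. riccati a b c V \<longrightarrow>
     (\<exists>\<theta>\<in>{t i..t (Suc i)}. \<bar>quad a b c (cos \<theta>)\<bar> \<le> C * (1 + integral {\<alpha>..\<beta>} (\<lambda>\<theta>. (V (cos \<theta>))\<^sup>2)))"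
    if i: "Suc i \<le> 5" for i
  proof -
    have b: "0 < t i" "t i < t (Suc i)" "t (Suc i) < pi" using tin[of i] tin[of "Suc i"] i assms tmono[of i "Suc i"] by auto
    obtain C where C: "C > 0" "\<And>a b c V. riccati a b c V \<Longrightarrow>
     \<exists>\<theta>\<in>{t i..t (Suc i)}. \<bar>quad a b c (cos \<theta>)\<bar> \<le> C * (1 + integral {t i..t (Suc i)} (\<lambda>\<theta>. (V (cos \<theta>))\<^sup>2))"
      using riccati_small_forcing[OF b] by metis
    have le: "integral {t i..t (Suc i)} (\<lambda>\<theta>. (V (cos \<theta>))\<^sup>2) \<le> integral {\<alpha>..\<beta>} (\<lambda>\<theta>. (V (cos \<theta>))\<^sup>2)"
      if R: "riccati a b c V" for a b c V
      using tin[of i] tin[of "Suc i"] i b riccati_polar_continuous[OF R, of \<alpha> \<beta>] assms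
      by (intro integral_subset_le)
        (auto intro!: integrable_continuous_interval continuous_intros continuous_on_subset[of "{\<alpha>..\<beta>}" "\<lambda>\<theta>. V (cos \<theta>)"])
    have "\<exists>\<theta>\<in>{t i..t (Suc i)}. \<bar>quad a b c (cos \<theta>)\<bar> \<le> C * (1 + integral {\<alpha>..\<beta>} (\<lambda>\<theta>. (V (cos \<theta>))\<^sup>2))"
      if R: "riccati a b c V" for a b c V
      using C(2)[OF R] mult_left_mono[OF add_left_mono[OF le[OF R], of 1], of C] C(1) by (meson less_imp_le order_trans)
    then show ?thesis using C(1) by blast
  qed
  obtain C1 C2 C3 where C: "C1 > 0" "C2 > 0" "C3 > 0" and
    P: "\<And>a b c V. riccati a b c V \<Longrightarrow> \<exists>\<theta>\<in>{t 0..t (Suc 0)}. \<bar>quad a b c (cos \<theta>)\<bar> \<le> C1 * (1 + integral {\<alpha>..\<beta>} (\<lambda>\<theta>. (V (cos \<theta>))\<^sup>2))"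
      "\<And>a b c V. riccati a b c V \<Longrightarrow> \<exists>\<theta>\<in>{t 2..t (Suc 2)}. \<bar>quad a b c (cos \<theta>)\<bar> \<le> C2 * (1 + integral {\<alpha>..\<beta>} (\<lambda>\<theta>. (V (cos \<theta>))\<^sup>2))"
      "\<And>a b c V. riccati a b c V \<Longrightarrow> \<exists>\<theta>\<in>{t 4..t (Suc 4)}. \<bar>quad a b c (cos \<theta>)\<bar> \<le> C3 * (1 + integral {\<alpha>..\<beta>} (\<lambda>\<theta>. (V (cos \<theta>))\<^sup>2))"
    using ex[of 0] ex[of 2] ex[of 4] by auto
  define D where "D = C1 + C2 + C3"
  have D: "C1 \<le> D" "C2 \<le> D" "C3 \<le> D" using C by (auto simp: D_def)
  define \<delta> where "\<delta> = Min {1, cos (t 1) - cos (t 2), cos (t 3) - cos (t 4)}"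
  have cm: "cos (t j) < cos (t i)" if "i < j" "j \<le> 5" for i j
    using tin[of i] tin[of j] tmono[OF that(1)] that assms by (intro cos_monotone_0_pi) auto
  have \<delta>: "0 < \<delta>" "\<delta> \<le> 1" "\<delta> \<le> cos (t 1) - cos (t 2)" "\<delta> \<le> cos (t 3) - cos (t 4)"
    using cm[of 1 2] cm[of 3 4] by (auto simp: \<delta>_def)
  show thesis
  proof (rule that[of "15 * D / \<delta>\<^sup>2"])
    show "15 * D / \<delta>\<^sup>2 > 0" using \<delta> C by (simp add: D_def)
    fix a b c V assume R: "riccati a b c V"
    let ?M = "1 + integral {\<alpha>..\<beta>} (\<lambda>\<theta>. (V (cos \<theta>))\<^sup>2)"
    have M: "?M \<ge> 0"
      using riccati_polar_continuous[OF R, of \<alpha> \<beta>] assms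
      by (intro add_nonneg_nonneg integral_nonneg) (auto intro!: integrable_continuous_interval continuous_intros)
    have W: "x \<le> D * ?M" if "x \<le> C' * ?M" "C' \<le> D" for x C'
      using that mult_right_mono[OF that(2) M] by linarith
    obtain s1 s2 s3 where s: "s1 \<in> {t 0..t (Suc 0)}" "s2 \<in> {t 2..t (Suc 2)}" "s3 \<in> {t 4..t (Suc 4)}"
      and A: "\<bar>quad a b c (cos s1)\<bar> \<le> D * ?M" "\<bar>quad a b c (cos s2)\<bar> \<le> D * ?M" "\<bar>quad a b c (cos s3)\<bar> \<le> D * ?M"
      using P(1)[OF R] P(2)[OF R] P(3)[OF R] W D by metis
    have cs: "cos y \<le> cos x" if "x \<le> y" "\<alpha> \<le> x" "y \<le> \<beta>" for x y
      using that assms by (intro cos_monotone_0_pi_le) auto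
    have sn: "t (Suc 0) = t 1" "t (Suc 2) = t 3" "t (Suc 4) = t 5" by (simp_all add: eval_nat_numeral)
    have "cos (t 1) \<le> cos s1" "cos s2 \<le> cos (t 2)" "cos (t 3) \<le> cos s2" "cos s3 \<le> cos (t 4)"
      using s tin[of 0] tin[of 1] tin[of 2] tin[of 3] tin[of 4] tin[of 5] unfolding sn by (auto intro!: cs)
    then have g: "cos s1 - cos s2 \<ge> \<delta>" "cos s2 - cos s3 \<ge> \<delta>" using \<delta> by linarith+
    from quad_coefficient_bound[OF \<delta>(1,2) g abs_cos_le_one abs_cos_le_one A]
    show "\<bar>a\<bar> \<le> 15 * D / \<delta>\<^sup>2 * ?M \<and> \<bar>b\<bar> \<le> 15 * D / \<delta>\<^sup>2 * ?M \<and> \<bar>c\<bar> \<le> 15 * D / \<delta>\<^sup>2 * ?M" by simp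
  qed
qed

lemma quad_bound: "\<bar>a\<bar> \<le> A \<Longrightarrow> \<bar>b\<bar> \<le> A \<Longrightarrow> \<bar>c\<bar> \<le> A \<Longrightarrow> \<bar>x\<bar> \<le> 1 \<Longrightarrow> \<bar>quad a b c x\<bar> \<le> 3 * A"
proof -
  assume A: "\<bar>a\<bar> \<le> A" "\<bar>b\<bar> \<le> A" "\<bar>c\<bar> \<le> A" and x: "\<bar>x\<bar> \<le> 1"
  have "\<bar>b * x\<bar> \<le> A * 1" unfolding abs_mult using A x by (intro mult_mono) auto
  moreover have "\<bar>c * x\<^sup>2\<bar> \<le> A * 1" unfolding abs_mult using A x by (intro mult_mono) (auto simp: abs_square_le_1)
  ultimately show ?thesis unfolding quad_def using A by (simp add: abs_le_iff)
qed

text \<open>Let \<open>\<phi>\<close> vanish at the ends of a slightly larger interval. At a maximum of \<open>(\<phi> V)\<^sup>2\<close> the derivative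
  of \<open>\<phi> V\<close> vanishes, which eliminates \<open>V'\<close> from the equation; after multiplication by \<open>\<phi>\<^sup>2\<close> the
  square \<open>(\<phi> V)\<^sup>2 / 2\<close> is bounded by a linear term in \<open>\<phi> V\<close> and the polynomial. This quantifies
  that solutions existing beyond the interval cannot be large inside it, for either sign of \<open>V\<close>.\<close>
lemma riccati_pointwise_bound:
  assumes "0 < \<alpha>" "\<alpha> < \<beta>" "\<beta> < pi"
  obtains C where "C > 0" "\<And>a b c V A \<theta>. riccati a b c V \<Longrightarrow> \<bar>a\<bar> \<le> A \<Longrightarrow> \<bar>b\<bar> \<le> A \<Longrightarrow> \<bar>c\<bar> \<le> A \<Longrightarrow>
     \<theta> \<in> {\<alpha>..\<beta>} \<Longrightarrow> (V (cos \<theta>))\<^sup>2 \<le> C * (1 + A)"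
proof -
  define \<alpha>' \<beta>' where "\<alpha>' = \<alpha> / 2" and "\<beta>' = (\<beta> + pi) / 2"
  have ab: "0 < \<alpha>'" "\<alpha>' < \<alpha>" "\<beta> < \<beta>'" "\<beta>' < pi" using assms by (auto simp: \<alpha>'_def \<beta>'_def)
  define \<phi> where "\<phi> t = (t - \<alpha>') * (\<beta>' - t)" for t
  have pi4: "pi < 4" using pi_less_4 .
  define m where "m = (\<alpha> - \<alpha>') * (\<beta>' - \<beta>)"
  have m: "m > 0" using ab by (simp add: m_def)
  show thesis
  proof (rule that[of "6000 / m\<^sup>2"])
    show "6000 / m\<^sup>2 > 0" using m by simp
    fix a b c V A \<theta>
    assume R: "riccati a b c V" and A: "\<bar>a\<bar> \<le> A" "\<bar>b\<bar> \<le> A" "\<bar>c\<bar> \<le> A" and \<theta>: "\<theta> \<in> {\<alpha>..\<beta>}"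
    have A0: "A \<ge> 0" using A by linarith
    define h where "h t = \<phi> t * V (cos t)" for t
    have "continuous_on {\<alpha>'..\<beta>'} (\<lambda>t. (h t)\<^sup>2)"
      unfolding h_def \<phi>_def using riccati_polar_continuous[OF R, of \<alpha>' \<beta>'] ab by (intro continuous_intros) auto
    then obtain s where s: "s \<in> {\<alpha>'..\<beta>'}" "\<And>t. t \<in> {\<alpha>'..\<beta>'} \<Longrightarrow> (h t)\<^sup>2 \<le> (h s)\<^sup>2"
      using continuous_attains_sup[of "{\<alpha>'..\<beta>'}" "\<lambda>t. (h t)\<^sup>2"] ab assms by auto
    have hs: "(h s)\<^sup>2 \<le> 6000 * (1 + A)"
    proof (cases "h s = 0")
      case True then show ?thesis using A0 by simp
    next
      case False
      then have s': "\<alpha>' < s" "s < \<beta>'" using s(1) by (auto simp: h_def \<phi>_def less_le)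
      have sp: "0 < s" "s < pi" using s' ab by linarith+
      obtain y' where y': "((\<lambda>t. V (cos t)) has_real_derivative y') (at s)"
        and P: "quad a b c (cos s) = - sin s * y' + 2 * cos s * V (cos s) + (V (cos s))\<^sup>2 / 2"
        by (rule riccati_polar[OF R sp])
      define k where "k = (\<beta>' - s) - (s - \<alpha>')"
      have dh: "(h has_real_derivative (k * V (cos s) + \<phi> s * y')) (at s)"
        unfolding h_def[abs_def] \<phi>_def k_def by (rule derivative_eq_intros y' refl)+ (simp add: algebra_simps)
      have dh2: "((\<lambda>t. (h t)\<^sup>2) has_real_derivative (2 * h s * (k * V (cos s) + \<phi> s * y'))) (at s)"
        by (rule derivative_eq_intros dh refl)+ simp
      have "2 * h s * (k * V (cos s) + \<phi> s * y') = 0"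
      proof (rule DERIV_local_max[OF dh2])
        show "min (s - \<alpha>') (\<beta>' - s) > 0" using s' by simp
        show "\<forall>t. \<bar>s - t\<bar> < min (s - \<alpha>') (\<beta>' - s) \<longrightarrow> (h t)\<^sup>2 \<le> (h s)\<^sup>2"
          using s(2) by (auto simp: abs_less_iff)
      qed
      then have crit: "\<phi> s * y' = - k * V (cos s)" using False by simp
      have \<phi>s: "0 \<le> \<phi> s" "\<phi> s \<le> 16"
      proof -
        show "0 \<le> \<phi> s" using s' by (simp add: \<phi>_def)
        have "\<phi> s \<le> 4 * 4" unfolding \<phi>_def using s' ab pi4 by (intro mult_mono) auto
        then show "\<phi> s \<le> 16" by simp
      qed
      have "(\<phi> s)\<^sup>2 * quad a b c (cos s) = - sin s * \<phi> s * (\<phi> s * y') + 2 * cos s * \<phi> s * h s + (h s)\<^sup>2 / 2"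
        unfolding P h_def by (simp add: algebra_simps power2_eq_square)
      also have "\<dots> = (k * sin s + 2 * cos s * \<phi> s) * h s + (h s)\<^sup>2 / 2"
        unfolding crit by (simp add: h_def algebra_simps)
      finally have e: "(h s)\<^sup>2 / 2 = (\<phi> s)\<^sup>2 * quad a b c (cos s) - (k * sin s + 2 * cos s * \<phi> s) * h s" by simp
      have "\<bar>k * sin s\<bar> \<le> 4 * 1" unfolding abs_mult using s' ab pi4 by (intro mult_mono) (auto simp: k_def)
      moreover have "\<bar>cos s * \<phi> s\<bar> \<le> 1 * 16" unfolding abs_mult using \<phi>s by (intro mult_mono) auto
      ultimately have "\<bar>k * sin s + 2 * cos s * \<phi> s\<bar> \<le> 36" by (simp add: abs_le_iff)
      then have 1: "\<bar>(k * sin s + 2 * cos s * \<phi> s) * h s\<bar> \<le> 36 * \<bar>h s\<bar>"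
        unfolding abs_mult by (intro mult_mono) auto
      have "\<phi> s * \<phi> s \<le> 16 * 16" using \<phi>s by (intro mult_mono) auto
      then have 2: "\<bar>(\<phi> s)\<^sup>2 * quad a b c (cos s)\<bar> \<le> 256 * (3 * A)"
        unfolding abs_mult using quad_bound[OF A, of "cos s"] by (intro mult_mono) (auto simp: power2_eq_square)
      \<comment> \<open>Half of \<open>h\<^sup>2 / 2\<close> absorbs the linear term \<open>36 \<bar>h\<bar>\<close>.\<close>
      have "144 * \<bar>h s\<bar> \<le> (h s)\<^sup>2 + 5184" using zero_le_power2[of "\<bar>h s\<bar> - 72"] by (simp add: power2_diff)
      then show ?thesis using e 1 2 A0 by (simp add: abs_le_iff)
    qed
    have "m \<le> \<phi> \<theta>" unfolding m_def \<phi>_def using \<theta> ab by (intro mult_mono) auto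
    then have "m\<^sup>2 \<le> (\<phi> \<theta>)\<^sup>2" using m by (intro power_mono) auto
    then have "m\<^sup>2 * (V (cos \<theta>))\<^sup>2 \<le> (h \<theta>)\<^sup>2" by (simp add: h_def power_mult_distrib mult_right_mono)
    also have "\<dots> \<le> (h s)\<^sup>2" using s(2)[of \<theta>] \<theta> ab by simp
    also note hs
    finally show "(V (cos \<theta>))\<^sup>2 \<le> 6000 / m\<^sup>2 * (1 + A)" using m by (simp add: field_simps)
  qed
qed

section \<open>Compactness of Riccati solutions\<close>

text \<open>Since the hypothesis bounds \<open>\<bar>E'\<bar>\<close>, the estimate runs in both directions from 0; negative \<open>x\<close>
  are reduced to positive ones by reflection.\<close>
lemma gronwall_abs:
  fixes E :: "real \<Rightarrow> real"
  assumes dE: "\<And>x. \<bar>x\<bar> \<le> d \<Longrightarrow> (E has_real_derivative E' x) (at x)"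
    and bd: "\<And>x. \<bar>x\<bar> \<le> d \<Longrightarrow> \<bar>E' x\<bar> \<le> L * E x"
    and x: "\<bar>x\<bar> \<le> d"
  shows "E x \<le> E 0 * exp (L * \<bar>x\<bar>)"
proof -
  have *: "F t \<le> F 0 * exp (L * t)"
    if dF: "\<And>x. \<bar>x\<bar> \<le> d \<Longrightarrow> (F has_real_derivative F' x) (at x)"
      and bF: "\<And>x. \<bar>x\<bar> \<le> d \<Longrightarrow> \<bar>F' x\<bar> \<le> L * F x" and t: "0 \<le> t" "t \<le> d" for F F' :: "real \<Rightarrow> real" and t
  proof -
    have "F t * exp (- L * t) \<le> F 0 * exp (- L * 0)"
    proof (rule DERIV_nonpos_imp_nonincreasing[OF t(1)])
      fix s assume s: "0 \<le> s" "s \<le> t"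
      then have s': "\<bar>s\<bar> \<le> d" using t by simp
      have "((\<lambda>s. F s * exp (- L * s)) has_real_derivative (F' s - L * F s) * exp (- L * s)) (at s)"
        by (rule derivative_eq_intros dF[OF s'] refl)+ (simp add: algebra_simps)
      moreover have "(F' s - L * F s) * exp (- L * s) \<le> 0"
        using bF[OF s'] by (intro mult_nonpos_nonneg) auto
      ultimately show "\<exists>y. ((\<lambda>s. F s * exp (- L * s)) has_real_derivative y) (at s) \<and> y \<le> 0" by blast
    qed
    then show ?thesis by (simp add: exp_minus field_simps)
  qed
  show ?thesis
  proof (cases "x \<ge> 0")
    case True then show ?thesis using *[of E E' x] dE bd x by simp
  next
    case False
    have "((\<lambda>x. E (- x)) has_real_derivative - E' (- x)) (at x)" if "\<bar>x\<bar> \<le> d" for x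
      using dE[of "- x"] that by (simp add: DERIV_mirror[symmetric])
    then show ?thesis using *[of "\<lambda>x. E (- x)" "\<lambda>x. - E' (- x)" "- x"] bd x False by simp
  qed
qed

text \<open>Gronwall's inequality for \<open>(V - W)\<^sup>2 + \<eta>\<^sup>2\<close>: the difference solves a linear equation with bounded
  coefficients and a forcing of size \<open>\<eta>\<close>, and the summand \<open>\<eta>\<^sup>2\<close> absorbs the forcing.\<close>
lemma riccati_stability:
  assumes d: "0 \<le> d" "d < 1" and K: "K \<ge> 0"
  obtains L where "\<And>a b c V a' b' c' W \<eta> x. riccati a b c V \<Longrightarrow> riccati a' b' c' W \<Longrightarrow>
    (\<And>y. \<bar>y\<bar> \<le> d \<Longrightarrow> \<bar>V y\<bar> \<le> K \<and> \<bar>W y\<bar> \<le> K) \<Longrightarrow>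
    \<bar>a - a'\<bar> \<le> \<eta> \<Longrightarrow> \<bar>b - b'\<bar> \<le> \<eta> \<Longrightarrow> \<bar>c - c'\<bar> \<le> \<eta> \<Longrightarrow> \<bar>V 0 - W 0\<bar> \<le> \<eta> \<Longrightarrow> \<bar>x\<bar> \<le> d \<Longrightarrow>
    (V x - W x)\<^sup>2 \<le> \<eta>\<^sup>2 * L"
proof -
  define w where "w = 1 - d\<^sup>2"
  have w: "w > 0" using d by (simp add: w_def abs_square_less_1)
  define L where "L = (7 + 2 * K) / w"
  have L: "L \<ge> 0" using w K by (simp add: L_def)
  show thesis
  proof (rule that[of "2 * exp L"])
    fix a b c V a' b' c' W \<eta> x
    assume R: "riccati a b c V" "riccati a' b' c' W"
      and VW: "\<And>y. \<bar>y\<bar> \<le> d \<Longrightarrow> \<bar>V y\<bar> \<le> K \<and> \<bar>W y\<bar> \<le> K"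
      and \<eta>: "\<bar>a - a'\<bar> \<le> \<eta>" "\<bar>b - b'\<bar> \<le> \<eta>" "\<bar>c - c'\<bar> \<le> \<eta>" and 0: "\<bar>V 0 - W 0\<bar> \<le> \<eta>"
      and x: "\<bar>x\<bar> \<le> d"
    define Z where "Z y = V y - W y" for y
    define Z' where "Z' y = riccati_rhs a b c V y - riccati_rhs a' b' c' W y" for y
    have dZ: "((\<lambda>y. (Z y)\<^sup>2 + \<eta>\<^sup>2) has_real_derivative 2 * Z y * Z' y) (at y)" if "\<bar>y\<bar> \<le> d" for y
    proof -
      have "(V has_real_derivative riccati_rhs a b c V y) (at y)" "(W has_real_derivative riccati_rhs a' b' c' W y) (at y)"
        using R that d by (auto simp: riccati_def)
      then show ?thesis unfolding Z_def[abs_def] Z'_def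
        by (auto intro!: derivative_eq_intros)
    qed
    have bd: "\<bar>2 * Z y * Z' y\<bar> \<le> L * ((Z y)\<^sup>2 + \<eta>\<^sup>2)" if y: "\<bar>y\<bar> \<le> d" for y
    proof -
      have wy: "w \<le> 1 - y\<^sup>2" using abs_le_square_iff[of y d] y d unfolding w_def by simp
      define N where "N = quad (a - a') (b - b') (c - c') y - (2 * y + (V y + W y) / 2) * Z y"
      have Z': "Z' y = N / (1 - y\<^sup>2)"
        unfolding Z'_def riccati_rhs_def N_def Z_def diff_divide_distrib[symmetric]
        by (rule arg_cong[of _ _ "\<lambda>t. t / (1 - y\<^sup>2)"]) (simp add: quad_def field_simps power2_eq_square)
      have "\<bar>quad (a - a') (b - b') (c - c') y\<bar> \<le> 3 * \<eta>" using quad_bound[OF \<eta>, of y] y d by simp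
      moreover have "\<bar>(2 * y + (V y + W y) / 2) * Z y\<bar> \<le> (2 + K) * \<bar>Z y\<bar>"
      proof -
        have "- K \<le> V y" "V y \<le> K" "- K \<le> W y" "W y \<le> K" "- 1 \<le> y" "y \<le> 1"
          using VW[OF y] y d by auto
        then have "\<bar>2 * y + (V y + W y) / 2\<bar> \<le> 2 + K" by (intro abs_leI) (simp_all add: field_simps)
        then show ?thesis unfolding abs_mult by (intro mult_right_mono) auto
      qed
      ultimately have N: "\<bar>N\<bar> \<le> 3 * \<eta> + (2 + K) * \<bar>Z y\<bar>" unfolding N_def by (simp add: abs_le_iff)
      have "\<bar>2 * Z y * N\<bar> \<le> 2 * \<bar>Z y\<bar> * (3 * \<eta> + (2 + K) * \<bar>Z y\<bar>)"
        unfolding abs_mult using N by (intro mult_mono) auto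
      also have "\<dots> = 3 * (2 * \<bar>Z y\<bar> * \<eta>) + (4 + 2 * K) * (Z y)\<^sup>2"
        by (simp add: algebra_simps power2_eq_square abs_mult_self_eq)
      also have "2 * \<bar>Z y\<bar> * \<eta> \<le> (Z y)\<^sup>2 + \<eta>\<^sup>2"
        using zero_le_power2[of "\<bar>Z y\<bar> - \<eta>"] by (simp add: power2_diff)
      also have "3 * ((Z y)\<^sup>2 + \<eta>\<^sup>2) + (4 + 2 * K) * (Z y)\<^sup>2 \<le> (7 + 2 * K) * ((Z y)\<^sup>2 + \<eta>\<^sup>2)"
        using K by (simp add: algebra_simps)
      finally have n: "\<bar>2 * Z y * N\<bar> \<le> (7 + 2 * K) * ((Z y)\<^sup>2 + \<eta>\<^sup>2)" by simp
      have "\<bar>2 * Z y * Z' y\<bar> = \<bar>2 * Z y * N\<bar> / (1 - y\<^sup>2)" using w wy by (simp add: Z' abs_mult)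
      also have "\<dots> \<le> (7 + 2 * K) * ((Z y)\<^sup>2 + \<eta>\<^sup>2) / w" using n w wy K by (intro frac_le) auto
      finally show ?thesis by (simp add: L_def)
    qed
    have "(Z x)\<^sup>2 + \<eta>\<^sup>2 \<le> ((Z 0)\<^sup>2 + \<eta>\<^sup>2) * exp (L * \<bar>x\<bar>)"
      by (rule gronwall_abs[OF dZ bd x])
    also have "\<dots> \<le> (2 * \<eta>\<^sup>2) * exp L"
    proof (rule mult_mono)
      have "(Z 0)\<^sup>2 \<le> \<eta>\<^sup>2" using 0 unfolding Z_def by (metis abs_ge_zero power2_abs power_mono)
      then show "(Z 0)\<^sup>2 + \<eta>\<^sup>2 \<le> 2 * \<eta>\<^sup>2" by simp
      show "exp (L * \<bar>x\<bar>) \<le> exp L" using L x d by (simp add: mult_left_le)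
    qed auto
    finally show "(V x - W x)\<^sup>2 \<le> \<eta>\<^sup>2 * (2 * exp L)" unfolding Z_def using zero_le_power2[of \<eta>] by linarith
  qed
qed

lemma recip_sin_bounded:
  assumes "d < 1" shows "bounded (recip_sin ` {-d..d})"
proof -
  have "continuous_on {-d..d} recip_sin"
    unfolding recip_sin_def[abs_def]
  proof (intro continuous_intros ballI)
    fix z assume "z \<in> {-d..d}"
    then have "0 < 1 - z\<^sup>2" using assms by (intro one_minus_sq_pos) auto
    then show "sqrt (1 - z\<^sup>2) \<noteq> 0" by simp
  qed
  then show ?thesis using compact_continuous_image compact_imp_bounded compact_Icc by blast
qed

lemma riccati_uniform_bound:
  assumes "d < 1" "\<And>k. riccati (a k) (b k) (c k) (V k)"
    and "\<And>k. \<bar>a k\<bar> \<le> A" "\<And>k. \<bar>b k\<bar> \<le> A" "\<And>k. \<bar>c k\<bar> \<le> A"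
  obtains K where "K \<ge> 0" "\<And>k x. \<bar>x\<bar> \<le> d \<Longrightarrow> \<bar>V k x\<bar> \<le> K"
proof -
  define e where "e = max d 0"
  have e: "0 \<le> e" "e < 1" "d \<le> e" using assms by (auto simp: e_def)
  define f where "f = (e + 1) / 2"
  have f: "e < f" "f < 1" "0 < f" using e by (auto simp: f_def)
  have "arccos f < arccos (- f)" using f by (intro arccos_less_arccos) auto
  moreover have "0 < arccos f" "arccos (- f) < pi" using arccos_lt_bounded[of f] arccos_lt_bounded[of "- f"] f by auto
  ultimately obtain C where C: "C > 0" "\<And>a b c V A \<theta>. riccati a b c V \<Longrightarrow> \<bar>a\<bar> \<le> A \<Longrightarrow> \<bar>b\<bar> \<le> A \<Longrightarrow> \<bar>c\<bar> \<le> A \<Longrightarrow>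
     \<theta> \<in> {arccos f..arccos (- f)} \<Longrightarrow> (V (cos \<theta>))\<^sup>2 \<le> C * (1 + A)"
    using riccati_pointwise_bound[of "arccos f" "arccos (- f)"] by metis
  have A: "A \<ge> 0" using assms(3)[of undefined] by linarith
  show thesis
  proof (rule that[of "sqrt (C * (1 + A))"])
    show "sqrt (C * (1 + A)) \<ge> 0" using C A by simp
    fix k x assume "\<bar>x\<bar> \<le> d"
    then have x: "- f \<le> x" "x \<le> f" using e f by auto
    then have "arccos x \<in> {arccos f..arccos (- f)}" using f by (auto intro!: arccos_le_arccos)
    from C(2)[OF assms(2-5) this] have "(V k x)\<^sup>2 \<le> C * (1 + A)" using x f by simp
    then show "\<bar>V k x\<bar> \<le> sqrt (C * (1 + A))" by (simp add: real_le_rsqrt)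
  qed
qed

text \<open>A solution is determined by its coefficients and its value at 0, so a convergent subsequence of
  these four numbers suffices: by \<open>riccati_stability\<close> the solutions are then uniformly Cauchy on
  each \<open>[-d, d]\<close>. The right-hand sides converge uniformly as well, hence the limit is again a
  solution.\<close>
theorem riccati_compactness:
  assumes R: "\<And>k. riccati (a k) (b k) (c k) (V k)"
    and A: "\<And>k. \<bar>a k\<bar> \<le> A" "\<And>k. \<bar>b k\<bar> \<le> A" "\<And>k. \<bar>c k\<bar> \<le> A"
  obtains \<sigma> a' b' c' W where "strict_mono (\<sigma> :: nat \<Rightarrow> nat)"
    "(\<lambda>k. a (\<sigma> k)) \<longlonglongrightarrow> a'" "(\<lambda>k. b (\<sigma> k)) \<longlonglongrightarrow> b'" "(\<lambda>k. c (\<sigma> k)) \<longlonglongrightarrow> c'"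
    "riccati a' b' c' W" "\<forall>d<1. uniform_limit {-d..d} (\<lambda>k. V (\<sigma> k)) W sequentially \<and> bounded (W ` {-d..d})"
proof -
  obtain K0 where K0: "\<And>k. \<bar>V k 0\<bar> \<le> K0" using riccati_uniform_bound[where d=0, OF _ R A] by (metis abs_zero order_refl zero_less_one)
  define s where "s k = (a k, b k, c k, V k 0)" for k
  have "bounded (range s)"
  proof (rule bounded_subset)
    show "bounded ({-A..A} \<times> {-A..A} \<times> {-A..A} \<times> {-K0..K0})" by (intro bounded_Times) auto
    show "range s \<subseteq> {-A..A} \<times> {-A..A} \<times> {-A..A} \<times> {-K0..K0}"
      using A K0 by (auto simp: s_def abs_le_iff) (smt (verit))+
  qed
  then obtain l \<sigma> where \<sigma>: "strict_mono (\<sigma> :: nat \<Rightarrow> nat)" and l: "(s \<circ> \<sigma>) \<longlonglongrightarrow> l"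
    using bounded_imp_convergent_subsequence by metis
  obtain a' b' c' v' where l': "l = (a', b', c', v')" by (cases l) auto
  have la: "(\<lambda>k. a (\<sigma> k)) \<longlonglongrightarrow> a'" using tendsto_fst[OF l] by (simp add: l' s_def o_def)
  have lb: "(\<lambda>k. b (\<sigma> k)) \<longlonglongrightarrow> b'" using tendsto_fst[OF tendsto_snd[OF l]] by (simp add: l' s_def o_def)
  have lc: "(\<lambda>k. c (\<sigma> k)) \<longlonglongrightarrow> c'" using tendsto_fst[OF tendsto_snd[OF tendsto_snd[OF l]]] by (simp add: l' s_def o_def)
  have lv: "(\<lambda>k. V (\<sigma> k) 0) \<longlonglongrightarrow> v'" using tendsto_snd[OF tendsto_snd[OF tendsto_snd[OF l]]] by (simp add: l' s_def o_def)
  define W where "W x = lim (\<lambda>k. V (\<sigma> k) x)" for x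
  have near: "\<exists>N. \<forall>m\<ge>N. \<forall>n\<ge>N. \<bar>f m - f n\<bar> \<le> \<eta>" if "f \<longlonglongrightarrow> t" "\<eta> > 0" for f :: "nat \<Rightarrow> real" and t \<eta>
    using LIMSEQ_imp_Cauchy[OF that(1)] that(2) unfolding Cauchy_def dist_real_def by (meson less_imp_le)
  have ul0: "uniform_limit {-d..d} (\<lambda>k. V (\<sigma> k)) W sequentially \<and> bounded (W ` {-d..d})" if d: "0 \<le> d" "d < 1" for d
  proof -
    obtain K where K: "K \<ge> 0" "\<And>k x. \<bar>x\<bar> \<le> d \<Longrightarrow> \<bar>V k x\<bar> \<le> K" using riccati_uniform_bound[OF d(2) R A] by metis
    obtain L where L: "\<And>a b c V a' b' c' W \<eta> x. riccati a b c V \<Longrightarrow> riccati a' b' c' W \<Longrightarrow>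
      (\<And>y. \<bar>y\<bar> \<le> d \<Longrightarrow> \<bar>V y\<bar> \<le> K \<and> \<bar>W y\<bar> \<le> K) \<Longrightarrow>
      \<bar>a - a'\<bar> \<le> \<eta> \<Longrightarrow> \<bar>b - b'\<bar> \<le> \<eta> \<Longrightarrow> \<bar>c - c'\<bar> \<le> \<eta> \<Longrightarrow> \<bar>V 0 - W 0\<bar> \<le> \<eta> \<Longrightarrow> \<bar>x\<bar> \<le> d \<Longrightarrow>
      (V x - W x)\<^sup>2 \<le> \<eta>\<^sup>2 * L"
      using riccati_stability[OF d K(1)] by metis
    have "uniformly_Cauchy_on {-d..d} (\<lambda>k. V (\<sigma> k))"
    proof (rule uniformly_Cauchy_onI)
      fix e :: real assume e: "e > 0"
      define \<eta> where "\<eta> = e / (1 + \<bar>L\<bar>)"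
      have \<eta>: "\<eta> > 0" using e by (simp add: \<eta>_def)
      obtain N1 N2 N3 N4 where N: "\<forall>m\<ge>N1. \<forall>n\<ge>N1. \<bar>a (\<sigma> m) - a (\<sigma> n)\<bar> \<le> \<eta>" "\<forall>m\<ge>N2. \<forall>n\<ge>N2. \<bar>b (\<sigma> m) - b (\<sigma> n)\<bar> \<le> \<eta>"
        "\<forall>m\<ge>N3. \<forall>n\<ge>N3. \<bar>c (\<sigma> m) - c (\<sigma> n)\<bar> \<le> \<eta>" "\<forall>m\<ge>N4. \<forall>n\<ge>N4. \<bar>V (\<sigma> m) 0 - V (\<sigma> n) 0\<bar> \<le> \<eta>"
        using near[OF la \<eta>] near[OF lb \<eta>] near[OF lc \<eta>] near[OF lv \<eta>] by blast
      show "\<exists>M. \<forall>x\<in>{-d..d}. \<forall>m\<ge>M. \<forall>n\<ge>M. dist (V (\<sigma> m) x) (V (\<sigma> n) x) < e"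
      proof (intro exI[of _ "N1 + N2 + N3 + N4"] ballI allI impI)
        fix x m n assume x: "x \<in> {-d..d}" and mn: "N1 + N2 + N3 + N4 \<le> m" "N1 + N2 + N3 + N4 \<le> n"
        have "(V (\<sigma> m) x - V (\<sigma> n) x)\<^sup>2 \<le> \<eta>\<^sup>2 * L"
          by (rule L[OF R R]) (use N mn x K in \<open>auto simp: abs_le_iff\<close>)
        also have "L < (1 + \<bar>L\<bar>)\<^sup>2"
        proof -
          have "0 \<le> L\<^sup>2" "0 \<le> \<bar>L\<bar>" "L \<le> \<bar>L\<bar>" by simp_all
          then have "L < 1 + L\<^sup>2 + 2 * \<bar>L\<bar>" by linarith
          then show ?thesis by (simp add: power2_sum)
        qed
        then have "\<eta>\<^sup>2 * L < \<eta>\<^sup>2 * (1 + \<bar>L\<bar>)\<^sup>2"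
          using \<eta> by (intro mult_strict_left_mono) auto
        also have "\<dots> = e\<^sup>2"
        proof -
          have "\<eta> * (1 + \<bar>L\<bar>) = e" by (simp add: \<eta>_def)
          then show ?thesis by (metis power_mult_distrib)
        qed
        finally show "dist (V (\<sigma> m) x) (V (\<sigma> n) x) < e"
          using e unfolding dist_real_def by (metis abs_of_pos abs_less_iff power2_abs power2_less_imp_less less_imp_le)
      qed
    qed
    then have u: "uniform_limit {-d..d} (\<lambda>k. V (\<sigma> k)) W sequentially"
      using Cauchy_uniformly_convergent unfolding W_def[abs_def] uniformly_convergent_uniform_limit_iff by blast
    have "\<bar>W x\<bar> \<le> K" if "x \<in> {-d..d}" for x
    proof (rule LIMSEQ_le_const2)
      show "(\<lambda>k. \<bar>V (\<sigma> k) x\<bar>) \<longlonglongrightarrow> \<bar>W x\<bar>"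
        using tendsto_uniform_limitI[OF u that] by (rule tendsto_rabs)
      show "\<exists>N. \<forall>n\<ge>N. \<bar>V (\<sigma> n) x\<bar> \<le> K" using K that by (auto simp: abs_le_iff)
    qed
    then have "bounded (W ` {-d..d})" unfolding bounded_iff by (intro exI[of _ K]) auto
    with u show ?thesis by simp
  qed
  have ul: "uniform_limit {-d..d} (\<lambda>k. V (\<sigma> k)) W sequentially \<and> bounded (W ` {-d..d})" if "d < 1" for d
  proof (cases "d \<ge> 0")
    case True then show ?thesis using ul0 that by blast
  next
    case False then have "{-d..d} = {}" by auto
    then show ?thesis by (simp add: uniform_limit_iff)
  qed
  have RW: "riccati a' b' c' W"
    unfolding riccati_def
  proof (intro allI impI)
    fix z :: real assume z: "\<bar>z\<bar> < 1"
    define d where "d = (1 + \<bar>z\<bar>) / 2"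
    have d: "0 < d" "d < 1" "\<bar>z\<bar> < d" using z by (auto simp: d_def)
    have "smooth_conv 0 {-1<..<1} {-d..d} (\<lambda>k. riccati_rhs (a (\<sigma> k)) (b (\<sigma> k)) (c (\<sigma> k)) (V (\<sigma> k))) (riccati_rhs a' b' c' W)"
      by (rule smooth_conv_riccati_rhs[OF _ recip_sin_bounded la lb lc]) (use ul[OF d(2)] d in auto)
    then have u': "uniform_limit {-d..d} (\<lambda>k. riccati_rhs (a (\<sigma> k)) (b (\<sigma> k)) (c (\<sigma> k)) (V (\<sigma> k))) (riccati_rhs a' b' c' W) sequentially"
      by simp
    have "\<exists>g. \<forall>x\<in>{-d<..<d}. (\<lambda>n. V (\<sigma> n) x) \<longlonglongrightarrow> g x \<and> (g has_derivative (\<lambda>h. riccati_rhs a' b' c' W x * h)) (at x within {-d<..<d})"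
    proof (rule has_derivative_sequence)
      show "convex {-d<..<d}" by simp
      show "(V (\<sigma> n) has_derivative (\<lambda>h. riccati_rhs (a (\<sigma> n)) (b (\<sigma> n)) (c (\<sigma> n)) (V (\<sigma> n)) x * h)) (at x within {-d<..<d})"
        if "x \<in> {-d<..<d}" for n x
        using R[of "\<sigma> n"] that d has_field_derivative_at_within[of "V (\<sigma> n)"]
        unfolding riccati_def has_field_derivative_def by (simp add: abs_less_iff)
      show "\<forall>\<^sub>F n in sequentially. \<forall>x\<in>{-d<..<d}. \<forall>h. norm (riccati_rhs (a (\<sigma> n)) (b (\<sigma> n)) (c (\<sigma> n)) (V (\<sigma> n)) x * h - riccati_rhs a' b' c' W x * h) \<le> e * norm h"
        if "e > 0" for e
        using uniform_limitD[OF u' that]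
      proof eventually_elim
        case (elim n)
        show ?case
        proof (intro ballI allI)
          fix x h :: real assume "x \<in> {-d<..<d}"
          then have "\<bar>riccati_rhs (a (\<sigma> n)) (b (\<sigma> n)) (c (\<sigma> n)) (V (\<sigma> n)) x - riccati_rhs a' b' c' W x\<bar> \<le> e"
            using elim by (auto simp: dist_real_def less_imp_le)
          then show "norm (riccati_rhs (a (\<sigma> n)) (b (\<sigma> n)) (c (\<sigma> n)) (V (\<sigma> n)) x * h - riccati_rhs a' b' c' W x * h) \<le> e * norm h"
            by (simp add: left_diff_distrib[symmetric] abs_mult mult_right_mono)
        qed
      qed
      show "0 \<in> {-d<..<d}" using d by simp
      show "(\<lambda>n. V (\<sigma> n) 0) \<longlonglongrightarrow> v'" by (rule lv)
    qed
    then obtain g where g: "\<And>x. x \<in> {-d<..<d} \<Longrightarrow> (\<lambda>n. V (\<sigma> n) x) \<longlonglongrightarrow> g x"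
      "\<And>x. x \<in> {-d<..<d} \<Longrightarrow> (g has_derivative (\<lambda>h. riccati_rhs a' b' c' W x * h)) (at x within {-d<..<d})" by blast
    have zd: "z \<in> {-d<..<d}" using d by (auto simp: abs_less_iff)
    have "(g has_derivative (\<lambda>h. riccati_rhs a' b' c' W z * h)) (at z)"
      using g(2)[OF zd] at_within_open[OF zd] by simp
    then have "(W has_derivative (\<lambda>h. riccati_rhs a' b' c' W z * h)) (at z)"
      by (rule has_derivative_transform_within_open[of _ _ _ _ "{-d<..<d}"]) (use zd g(1) in \<open>auto simp: W_def intro!: limI[symmetric]\<close>)
    then show "(W has_real_derivative riccati_rhs a' b' c' W z) (at z)"
      by (simp add: has_field_derivative_def)
  qed
  show thesis by (rule that[OF \<sigma> la lb lc RW]) (use ul in auto)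
qed

section \<open>Convergence of the fields on zones\<close>

lemma smooth_conv_limit: "smooth_conv n S K f l \<Longrightarrow> smooth_conv n S K (\<lambda>_. l) l"
proof (induction n arbitrary: f l)
  case 0 then show ?case by (simp add: uniform_limit_const)
next
  case (Suc n)
  then have "smooth_conv n S K (\<lambda>_. pd b l) (pd b l)" if "b \<in> Basis" for b
    using that by (intro Suc.IH[of "\<lambda>k. pd b (f k)"]) simp
  then show ?case using Suc.prems by (simp add: uniform_limit_const)
qed

lemma smooth_conv_iter_pd:
  assumes "smooth_conv n S K f l" "set bs \<subseteq> Basis" "length bs \<le> n"
  shows "uniform_limit K (\<lambda>k. iter_pd bs (f k)) (iter_pd bs l) sequentially"
  using assms
proof (induction n arbitrary: f l bs)
  case 0 then show ?case by simp
next
  case (Suc n)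
  show ?case
  proof (cases bs rule: rev_cases)
    case Nil then show ?thesis using Suc.prems by simp
  next
    case (snoc cs b)
    then have "smooth_conv n S K (\<lambda>k. pd b (f k)) (pd b l)" using Suc.prems by simp
    from Suc.IH[OF this, of cs] show ?thesis using snoc Suc.prems by simp
  qed
qed

lemma iter_pd_zero: "iter_pd bs (\<lambda>_. 0) = (\<lambda>_. 0)"
proof (induction bs)
  case (Cons b bs)
  have "pd b (\<lambda>_. 0) = (\<lambda>_. 0)" by (rule ext, rule pd_eq[where D="\<lambda>_. 0"]) auto
  then show ?case using Cons by simp
qed simp

text \<open>Only finitely many iterated partial derivatives have order at most \<open>m\<close>.\<close>
lemma Cm_norm_tendsto_0:
  fixes f :: "nat \<Rightarrow> 'a::euclidean_space \<Rightarrow> 'b::real_normed_vector"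
  assumes f: "smooth_conv m S K f (\<lambda>_. 0)" and Z: "Z \<subseteq> K"
  shows "(\<lambda>k. Cm_norm m Z (f k)) \<longlonglongrightarrow> 0"
proof -
  define Bs where "Bs = {bs :: 'a list. set bs \<subseteq> Basis \<and> length bs \<le> m}"
  have fin: "finite Bs" unfolding Bs_def by (rule finite_lists_length_le) simp
  have ev: "\<forall>\<^sub>F k in sequentially. Cm_norm m Z (f k) \<le> ennreal e" if "e > 0" for e
  proof -
    have "\<forall>\<^sub>F k in sequentially. \<forall>bs\<in>Bs. \<forall>x\<in>K. dist (iter_pd bs (f k) x) (iter_pd bs (\<lambda>_. 0) x) < e"
      using fin
    proof (rule eventually_ball_finite, intro ballI)
      fix bs :: "'a list" assume "bs \<in> Bs"
      then show "\<forall>\<^sub>F k in sequentially. \<forall>x\<in>K. dist (iter_pd bs (f k) x) (iter_pd bs (\<lambda>_. 0) x) < e"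
        by (intro uniform_limitD[OF _ that] smooth_conv_iter_pd[OF f]) (auto simp: Bs_def)
    qed
    then show ?thesis
    proof eventually_elim
      case (elim k)
      show ?case unfolding Cm_norm_def Bs_def[symmetric]
        using elim Z by (intro SUP_least ennreal_leI) (force simp: iter_pd_zero less_imp_le)
    qed
  qed
  show ?thesis
  proof (rule order_tendstoI)
    fix y :: ennreal assume "0 < y"
    then obtain x where x: "0 < x" "x < y" using dense by blast
    then obtain e where e: "x = ennreal e" "0 \<le> e" by (cases x) auto
    then have "e > 0" using x by (cases "e = 0") auto
    from ev[OF this] show "\<forall>\<^sub>F k in sequentially. Cm_norm m Z (f k) < y"
      by eventually_elim (use e x in auto)
  qed auto
qed

lemma smooth_conv_sin_cos:
  "smooth_conv n UNIV UNIV (\<lambda>_. sin) (sin :: real \<Rightarrow> real) \<and> smooth_conv n UNIV UNIV (\<lambda>_. cos) (cos :: real \<Rightarrow> real)"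
proof (induction n)
  have b: "bounded (range (sin :: real \<Rightarrow> real))" "bounded (range (cos :: real \<Rightarrow> real))"
    unfolding bounded_iff by (auto intro!: exI[of _ 1])
  {
    case 0 then show ?case using b by (auto intro: uniform_limit_const)
  next
    case (Suc n)
    have "smooth_conv n UNIV UNIV (\<lambda>_ x. - sin x) (\<lambda>x::real. - sin x)"
      by (rule smooth_conv_linear[OF _ _ bounded_linear_minus[OF bounded_linear_ident]]) (use Suc in auto)
    then have "smooth_conv (Suc n) UNIV UNIV (\<lambda>_. cos) (cos :: real \<Rightarrow> real)"
      by (intro smooth_conv_real_SucI[where f'="\<lambda>_ x. - sin x" and l'="\<lambda>x. - sin x"]) (use Suc in auto)
    moreover have "smooth_conv (Suc n) UNIV UNIV (\<lambda>_. sin) (sin :: real \<Rightarrow> real)"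
      by (rule smooth_conv_real_SucI[where f'="\<lambda>_. cos" and l'=cos]) (use Suc in auto)
    ultimately show ?case by blast
  }
qed

lemma pd_bounded_linear: "bounded_linear g \<Longrightarrow> pd b g = (\<lambda>_. g b)"
  by (rule ext, rule pd_eq, rule bounded_linear_imp_has_derivative)

lemma smooth_conv_compose_linear:
  fixes g :: "'a::euclidean_space \<Rightarrow> 'c::euclidean_space"
  assumes "open S" "K \<subseteq> S" "bounded_linear g" "smooth_conv n UNIV UNIV f l"
  shows "smooth_conv n S K (\<lambda>k x. f k (g x)) (\<lambda>x. l (g x))"
  by (rule smooth_conv_compose[OF assms(1,2) _ _ _ _ assms(4)])
    (use assms(3) in \<open>auto simp: pd_bounded_linear intro: smooth_conv_const bounded_linear_imp_differentiable\<close>)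

definition polar_strip :: "(real \<times> real) set" where "polar_strip = {0<..<pi} \<times> UNIV"

lemma open_polar_strip: "open polar_strip" by (simp add: polar_strip_def open_Times)

lemma smooth_conv_polar:
  assumes K: "K \<subseteq> polar_strip"
  shows "smooth_conv n polar_strip K (\<lambda>_ x. sin (fst x)) (\<lambda>x. sin (fst x))"
    "smooth_conv n polar_strip K (\<lambda>_ x. cos (fst x)) (\<lambda>x. cos (fst x))"
    "smooth_conv n polar_strip K (\<lambda>_ x. sin (snd x)) (\<lambda>x. sin (snd x))"
    "smooth_conv n polar_strip K (\<lambda>_ x. cos (snd x)) (\<lambda>x. cos (snd x))"
  using smooth_conv_compose_linear[OF open_polar_strip K bounded_linear_fst] 
    smooth_conv_compose_linear[OF open_polar_strip K bounded_linear_snd] smooth_conv_sin_cos by blast+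

lemma smooth_conv_sph:
  assumes K: "K \<subseteq> polar_strip"
  shows "smooth_conv n polar_strip K (\<lambda>_ x. sph 1 (fst x) (snd x)) (\<lambda>x. sph 1 (fst x) (snd x))"
proof -
  have eq: "sph 1 \<theta> \<phi> = (sin \<theta> * cos \<phi>) *\<^sub>R axis 1 1 + (sin \<theta> * sin \<phi>) *\<^sub>R axis 2 1 + cos \<theta> *\<^sub>R e3" for \<theta> \<phi>
    by (simp add: vec_eq_iff forall_3 sph_def vector_3 axis_def)
  show ?thesis unfolding eq
    by (intro smooth_conv_add smooth_conv_scaleR smooth_conv_mult smooth_conv_polar smooth_conv_const open_polar_strip K)
qed

lemma smooth_conv_zonal:
  assumes K: "K \<subseteq> polar_strip" "(\<lambda>x. cos (fst x)) ` K \<subseteq> K'"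
    and f: "smooth_conv n {-1<..<1} K' f l"
  shows "smooth_conv n polar_strip K (\<lambda>k x. f k (cos (fst x))) (\<lambda>x. l (cos (fst x)))"
proof (rule smooth_conv_compose[OF open_polar_strip K(1) _ K(2) _ _ f])
  show "(\<lambda>x. cos (fst x)) ` polar_strip \<subseteq> {-1<..<1}"
  proof (clarsimp simp: polar_strip_def)
    fix t :: real assume t: "0 < t" "t < pi"
    show "- 1 < cos t \<and> cos t < 1" using cos_monotone_0_pi[of 0 t] cos_monotone_0_pi[of t pi] t by simp
  qed
  have s: "smooth_conv (Suc n) polar_strip K (\<lambda>_ x. cos (fst x)) (\<lambda>x. cos (fst x))" for n
    by (rule smooth_conv_polar(2)[OF K(1)])
  show "(\<lambda>x. cos (fst x)) differentiable (at x)" if "x \<in> polar_strip" for x :: "real \<times> real"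
    using s[of 0] that by simp
  show "smooth_conv n polar_strip K (\<lambda>_. pd b (\<lambda>x. cos (fst x))) (pd b (\<lambda>x. cos (fst x)))" if "b \<in> Basis" for n b
    using s[of n] that by simp
qed

lemma riccati_velocity_sph: "riccati_velocity a b c V (sph 1 \<theta> \<phi>) = prof_F a b c V (cos \<theta>) *\<^sub>R sph 1 \<theta> \<phi> + prof_G V (cos \<theta>) *\<^sub>R e3"
  by (simp add: riccati_velocity_def axial_def radial_def cos_polar_sph norm_sph)

lemma riccati_pressure_sph: "riccati_pressure a b c V (sph 1 \<theta> \<phi>) = prof_Q a b c V (cos \<theta>)"
  by (simp add: riccati_pressure_def radial_def cos_polar_sph norm_sph)

text \<open>On the unit sphere velocity and pressure are sums of products of a profile at \<open>cos \<theta>\<close> and a fixed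
  function of the angles, all of whose derivatives are bounded on the strip \<open>\<epsilon> \<le> \<theta> \<le> \<pi> - \<epsilon>\<close>.\<close>
theorem riccati_fields_converge:
  assumes R: "\<And>k. riccati (a k) (b k) (c k) (V k)" "riccati a' b' c' W"
    and lim: "a \<longlonglongrightarrow> a'" "b \<longlonglongrightarrow> b'" "c \<longlonglongrightarrow> c'"
    and u: "\<And>d. d < 1 \<Longrightarrow> uniform_limit {-d..d} V W sequentially" "\<And>d. d < 1 \<Longrightarrow> bounded (W ` {-d..d})"
    and \<epsilon>: "\<epsilon> > 0"
    and f: "\<And>k X. X \<in> punctured_cone \<Longrightarrow> f k X = (riccati_velocity (a k) (b k) (c k) (V k) X, riccati_pressure (a k) (b k) (c k) (V k) X) - (riccati_velocity a' b' c' W X, riccati_pressure a' b' c' W X)"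
  shows "(\<lambda>k. zone_Cm_norm m \<epsilon> (pi - \<epsilon>) (f k)) \<longlonglongrightarrow> 0"
proof -
  define K where "K = {\<epsilon>..pi - \<epsilon>} \<times> (UNIV :: real set)"
  have K: "K \<subseteq> polar_strip" using \<epsilon> by (auto simp: K_def polar_strip_def)
  \<comment> \<open>For \<open>\<epsilon> > \<pi> / 2\<close> the strip is empty and any \<open>d < 1\<close> will do.\<close>
  define d where "d = (if \<epsilon> \<le> pi - \<epsilon> then cos \<epsilon> else 0)"
  have d: "d < 1" using \<epsilon> cos_monotone_0_pi[of 0 \<epsilon>] by (auto simp: d_def)
  have KK: "(\<lambda>x. cos (fst x)) ` K \<subseteq> {-d..d}"
  proof (clarsimp simp: K_def)
    fix t assume t: "\<epsilon> \<le> t" "t \<le> pi - \<epsilon>"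
    have "cos (pi - \<epsilon>) \<le> cos t" by (rule cos_monotone_0_pi_le) (use t \<epsilon> in auto)
    moreover have "cos t \<le> cos \<epsilon>" by (rule cos_monotone_0_pi_le) (use t \<epsilon> in auto)
    ultimately show "- d \<le> cos t \<and> cos t \<le> d" using t by (simp add: d_def)
  qed
  let ?I = "{-1<..<1::real}"
  have I: "{-d..d} \<subseteq> ?I" using d by auto
  note rb = recip_sin_bounded[OF d]
  have V: "smooth_conv m ?I {-d..d} V W"
    by (rule riccati_smooth_conv[OF I rb u(2)[OF d] lim R u(1)[OF d]])
  have rhs: "smooth_conv m ?I {-d..d} (\<lambda>k. riccati_rhs (a k) (b k) (c k) (V k)) (riccati_rhs a' b' c' W)"
    by (rule smooth_conv_riccati_rhs[OF I rb lim V])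
  have z: "smooth_conv m ?I {-d..d} (\<lambda>_ z. z) (\<lambda>z. z)"
    by (rule smooth_conv_bounded_linear[OF _ I bounded_linear_ident]) auto
  have "smooth_conv m ?I {-d..d} (\<lambda>k z. (0 - V k z) * (1 / (1 - z\<^sup>2))) (\<lambda>z. (0 - W z) * (1 / (1 - z\<^sup>2)))"
    by (intro smooth_conv_mult smooth_conv_diff smooth_conv_const V smooth_conv_inverse_weight I rb) auto
  then have G: "smooth_conv m ?I {-d..d} (\<lambda>k. prof_G (V k)) (prof_G W)" by (simp add: prof_G_def[abs_def])
  have F: "smooth_conv m ?I {-d..d} (\<lambda>k. prof_F (a k) (b k) (c k) (V k)) (prof_F a' b' c' W)"
    unfolding prof_F_def[abs_def] by (intro smooth_conv_diff smooth_conv_mult rhs z G I) auto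
  have "smooth_conv m ?I {-d..d} (\<lambda>k z. riccati_rhs (a k) (b k) (c k) (V k) z - c k - 1 / 2 * ((1 - z * z) * (prof_G (V k) z * prof_G (V k) z)))
     (\<lambda>z. riccati_rhs a' b' c' W z - c' - 1 / 2 * ((1 - z * z) * (prof_G W z * prof_G W z)))"
    by (intro smooth_conv_diff smooth_conv_mult smooth_conv_const smooth_conv_const_seq lim rhs z G I) auto
  then have Q: "smooth_conv m ?I {-d..d} (\<lambda>k. prof_Q (a k) (b k) (c k) (V k)) (prof_Q a' b' c' W)"
    by (simp add: prof_Q_def[abs_def] power2_eq_square)
  define h where "h a b c V x = (prof_F a b c V (cos (fst x)) *\<^sub>R (sph 1 (fst x) (snd x), 0 :: real)
      + prof_G V (cos (fst x)) *\<^sub>R (e3, 0)) + prof_Q a b c V (cos (fst x)) *\<^sub>R (0, 1)" for a b c V and x :: "real \<times> real"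
  have h_eq: "h a b c V x = (riccati_velocity a b c V (sph 1 (fst x) (snd x)), riccati_pressure a b c V (sph 1 (fst x) (snd x)))" for a b c V x
    by (simp add: h_def riccati_velocity_sph riccati_pressure_sph)
  have pr: "bounded_linear (\<lambda>v :: real^3. (v, 0 :: real))" by (intro bounded_linear_Pair bounded_linear_ident bounded_linear_zero)
  have "smooth_conv m polar_strip K (\<lambda>k. h (a k) (b k) (c k) (V k)) (h a' b' c' W)"
    unfolding h_def
    by (intro smooth_conv_add smooth_conv_scaleR smooth_conv_const open_polar_strip K smooth_conv_zonal[OF K KK] F G Q
        smooth_conv_linear[OF open_polar_strip K pr] smooth_conv_sph)
  from smooth_conv_diff[OF open_polar_strip K this smooth_conv_limit[OF this]]
  have "smooth_conv m polar_strip K (\<lambda>k (\<theta>, \<phi>). f k (sph 1 \<theta> \<phi>)) (\<lambda>_. 0)"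
  proof (rule smooth_conv_cong[OF open_polar_strip K, rotated -1])
    fix k x assume "x \<in> polar_strip"
    then have "sph 1 (fst x) (snd x) \<in> punctured_cone" by (intro sph_in_punctured_cone) (auto simp: polar_strip_def)
    then show "h (a k) (b k) (c k) (V k) x - h a' b' c' W x = (case x of (\<theta>, \<phi>) \<Rightarrow> f k (sph 1 \<theta> \<phi>))"
      by (simp add: h_eq f split_beta)
  qed simp
  moreover have "{\<epsilon><..<pi - \<epsilon>} \<times> UNIV \<subseteq> K" by (auto simp: K_def)
  ultimately show ?thesis unfolding zone_Cm_norm_def by (rule Cm_norm_tendsto_0)
qed

section \<open>Zone integrals\<close>

text \<open>The open zone is replaced by the closed box, which differs by two segments of measure zero, so
  that the integral of a continuous function over the box can be iterated.\<close>
lemma zone_integral_rotational: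
  assumes ab: "a \<le> b" and g: "continuous_on {a..b} g"
    and f: "\<And>\<theta> \<phi>. a < \<theta> \<Longrightarrow> \<theta> < b \<Longrightarrow> f \<theta> \<phi> * sin \<theta> = g \<theta>"
  shows "zone_integral a b f = 2 * pi * integral {a..b} g"
proof -
  let ?S = "{a<..<b} \<times> {0..2 * pi}" and ?B = "cbox (a, 0) (b, 2 * pi)"
  have B: "?B = {a..b} \<times> {0..2 * pi}" by (simp add: cbox_Pair_eq)
  have cg: "continuous_on ?B (\<lambda>x. g (fst x))"
    unfolding B by (rule continuous_on_compose2[OF g]) (auto intro!: continuous_intros)
  have "set_integrable lborel ?B (\<lambda>x. g (fst x))"
    unfolding set_integrable_def by (rule borel_integrable_compact[OF compact_cbox cg])
  then have i: "set_integrable lborel ?S (\<lambda>x. g (fst x))"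
    by (rule set_integrable_subset) (auto simp: B intro!: borel_Times)
  have "zone_integral a b f = (LINT x:?S|lborel. g (fst x))"
    unfolding zone_integral_def
    by (rule set_lebesgue_integral_cong) (auto simp: f intro!: borel_Times)
  also have "\<dots> = integral ?S (\<lambda>x. g (fst x))" by (rule set_borel_integral_eq_integral(2)[OF i])
  also have "\<dots> = integral ?B (\<lambda>x. g (fst x))"
  proof (rule integral_spike_set)
    have e: "(1, 0) \<in> (Basis :: (real \<times> real) set)" by (simp add: Basis_prod_def)
    have "negligible ({x :: real \<times> real. x \<bullet> (1, 0) = a} \<union> {x. x \<bullet> (1, 0) = b})"
      by (intro negligible_Un negligible_standard_hyperplane e)
    then show "negligible {x \<in> ?B - ?S. g (fst x) \<noteq> 0}"
      by (rule negligible_subset) (auto simp: B)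
    have "{x \<in> ?S - ?B. g (fst x) \<noteq> 0} = {}" by (auto simp: B)
    then show "negligible {x \<in> ?S - ?B. g (fst x) \<noteq> 0}" by (metis negligible_empty)
  qed
  also have "\<dots> = integral (cbox a b) (\<lambda>x. integral (cbox 0 (2 * pi)) (\<lambda>y. g x))"
    using integral_prod_continuous[OF cg] by simp
  also have "\<dots> = 2 * pi * integral {a..b} g" by simp
  finally show ?thesis .
qed

lemma comp_theta_riccati_velocity:
  assumes "0 < \<theta>" "\<theta> < pi"
  shows "comp_theta (riccati_velocity a b c V) 1 \<theta> \<phi> = V (cos \<theta>) / sin \<theta>"
proof -
  have s: "sin \<theta> > 0" using assms by (rule sin_gt_zero)
  have w: "1 - (cos \<theta>)\<^sup>2 = sin \<theta> * sin \<theta>" by (simp add: sin_squared_eq flip: power2_eq_square)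
  have "(sin \<phi>)\<^sup>2 + (cos \<phi>)\<^sup>2 = 1" by simp
  then have "sin \<theta> * cos \<phi> * (cos \<theta> * cos \<phi>) + sin \<theta> * sin \<phi> * (cos \<theta> * sin \<phi>) - cos \<theta> * sin \<theta> = 0"
    by algebra
  then have o: "sph 1 \<theta> \<phi> \<bullet> e_theta \<theta> \<phi> = 0"
    by (simp add: inner_3 sph_def e_theta_def vector_3)
  have e: "e3 \<bullet> e_theta \<theta> \<phi> = - sin \<theta>" by (simp add: e_theta_def vector_3)
  show ?thesis
    unfolding comp_theta_def riccati_velocity_sph inner_add_left inner_scaleR_left o e prof_G_def w
    using s by simp
qed

lemma zone_integral_riccati:
  assumes R: "riccati a b c V" and ab: "0 < \<alpha>" "\<alpha> \<le> \<beta>" "\<beta> < pi"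
    and u: "\<And>X. X \<in> punctured_cone \<Longrightarrow> u X /\<^sub>R \<nu> = riccati_velocity a b c V X" and \<nu>: "\<nu> > 0"
  shows "zone_integral \<alpha> \<beta> (\<lambda>\<theta> \<phi>. \<bar>comp_theta u 1 \<theta> \<phi>\<bar>\<^sup>2) = 2 * pi * \<nu>\<^sup>2 * integral {\<alpha>..\<beta>} (\<lambda>\<theta>. (V (cos \<theta>))\<^sup>2 / sin \<theta>)"
proof -
  have sp: "sin \<theta> > 0" if "\<theta> \<in> {\<alpha>..\<beta>}" for \<theta> using that ab by (intro sin_gt_zero) auto
  have c: "continuous_on {\<alpha>..\<beta>} (\<lambda>\<theta>. \<nu>\<^sup>2 * ((V (cos \<theta>))\<^sup>2 / sin \<theta>))"
    using riccati_polar_continuous[OF R ab(1,3)] sp by (intro continuous_intros) force+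
  have "zone_integral \<alpha> \<beta> (\<lambda>\<theta> \<phi>. \<bar>comp_theta u 1 \<theta> \<phi>\<bar>\<^sup>2) = 2 * pi * integral {\<alpha>..\<beta>} (\<lambda>\<theta>. \<nu>\<^sup>2 * ((V (cos \<theta>))\<^sup>2 / sin \<theta>))"
  proof (rule zone_integral_rotational[OF ab(2) c])
    fix \<theta> \<phi> assume t: "\<alpha> < \<theta>" "\<theta> < \<beta>"
    then have t': "0 < \<theta>" "\<theta> < pi" using ab by auto
    have "comp_theta u 1 \<theta> \<phi> / \<nu> = comp_theta (riccati_velocity a b c V) 1 \<theta> \<phi>"
      unfolding comp_rescale[symmetric] using u[OF sph_in_punctured_cone[OF _ t', of 1]] by (simp add: comp_theta_def)
    then have "comp_theta u 1 \<theta> \<phi> = \<nu> * V (cos \<theta>) / sin \<theta>"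
      unfolding comp_theta_riccati_velocity[OF t'] using \<nu> by (simp add: field_simps)
    then show "\<bar>comp_theta u 1 \<theta> \<phi>\<bar>\<^sup>2 * sin \<theta> = \<nu>\<^sup>2 * ((V (cos \<theta>))\<^sup>2 / sin \<theta>)"
      using sp[of \<theta>] t by (simp add: power_divide power_mult_distrib power2_eq_square)
  qed
  then show ?thesis by (simp only: integral_mult_right mult.assoc)
qed

lemma integral_weight_le:
  assumes R: "riccati a b c V" and ab: "0 < \<alpha>" "\<beta> < pi"
  shows "integral {\<alpha>..\<beta>} (\<lambda>\<theta>. (V (cos \<theta>))\<^sup>2) \<le> integral {\<alpha>..\<beta>} (\<lambda>\<theta>. (V (cos \<theta>))\<^sup>2 / sin \<theta>)"
    "0 \<le> integral {\<alpha>..\<beta>} (\<lambda>\<theta>. (V (cos \<theta>))\<^sup>2 / sin \<theta>)"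
proof -
  have sp: "sin \<theta> > 0" if "\<theta> \<in> {\<alpha>..\<beta>}" for \<theta> using that ab by (intro sin_gt_zero) auto
  have i: "(\<lambda>\<theta>. (V (cos \<theta>))\<^sup>2 / sin \<theta>) integrable_on {\<alpha>..\<beta>}" "(\<lambda>\<theta>. (V (cos \<theta>))\<^sup>2) integrable_on {\<alpha>..\<beta>}"
    using riccati_polar_continuous[OF R ab] sp
    by (intro integrable_continuous_interval continuous_intros; force)+
  show "integral {\<alpha>..\<beta>} (\<lambda>\<theta>. (V (cos \<theta>))\<^sup>2) \<le> integral {\<alpha>..\<beta>} (\<lambda>\<theta>. (V (cos \<theta>))\<^sup>2 / sin \<theta>)"
  proof (rule integral_le[OF i(2,1)])
    fix \<theta> assume "\<theta> \<in> {\<alpha>..\<beta>}"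
    from sp[OF this] show "(V (cos \<theta>))\<^sup>2 \<le> (V (cos \<theta>))\<^sup>2 / sin \<theta>"
      by (simp add: le_divide_eq mult_left_le)
  qed
  show "0 \<le> integral {\<alpha>..\<beta>} (\<lambda>\<theta>. (V (cos \<theta>))\<^sup>2 / sin \<theta>)"
    by (rule integral_nonneg[OF i(1)]) (intro divide_nonneg_pos zero_le_power2 sp)
qed

lemma normalized_riccati:
  assumes "\<nu> > 0" "hom_NS_solution \<nu> u p" "axisymmetric u" "no_swirl u"
  obtains a b c V where "riccati a b c V"
    "\<And>X. X \<in> punctured_cone \<Longrightarrow> u X /\<^sub>R \<nu> = riccati_velocity a b c V X" "\<And>X. X \<in> punctured_cone \<Longrightarrow> p X / \<nu>\<^sup>2 = riccati_pressure a b c V X"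
  using solution_is_riccati[OF hom_NS_solution_rescale[OF assms(1,2)] axisymmetric_rescale[OF assms(3)] no_swirl_rescale[OF assms(4)]]
  by metis

text \<open>The square integral over the small zone bounds the coefficients, these bound \<open>V\<close> pointwise on the
  large zone. The estimates concern the normalised solution, and undoing the normalisation
  multiplies them by \<open>\<nu>\<^sup>2\<close>, which turns the additive constant into \<open>\<nu>\<^sup>2\<close>.\<close>
theorem interior_energy_bound:
  assumes \<theta>: "0 < \<theta>1" "\<theta>1 < \<theta>2" "\<theta>2 < \<theta>3" "\<theta>3 < \<theta>4" "\<theta>4 < pi"
  shows "\<exists>C>0. \<forall>\<nu> u p. 0 < \<nu> \<and> hom_NS_solution \<nu> u p \<and> axisymmetric u \<and> no_swirl u \<longrightarrow>
           zone_integral \<theta>1 \<theta>4 (\<lambda>\<theta> \<phi>. \<bar>comp_theta u 1 \<theta> \<phi>\<bar>\<^sup>2)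
             \<le> C * (zone_integral \<theta>2 \<theta>3 (\<lambda>\<theta> \<phi>. \<bar>comp_theta u 1 \<theta> \<phi>\<bar>\<^sup>2) + \<nu>\<^sup>2)"
proof -
  have t23: "0 < \<theta>2" "\<theta>2 < \<theta>3" "\<theta>3 < pi" and t14: "0 < \<theta>1" "\<theta>1 < \<theta>4" "\<theta>4 < pi" using \<theta> by linarith+
  obtain C1 where C1: "C1 > 0" "\<And>a b c V. riccati a b c V \<Longrightarrow>
     \<bar>a\<bar> \<le> C1 * (1 + integral {\<theta>2..\<theta>3} (\<lambda>\<theta>. (V (cos \<theta>))\<^sup>2)) \<and>
     \<bar>b\<bar> \<le> C1 * (1 + integral {\<theta>2..\<theta>3} (\<lambda>\<theta>. (V (cos \<theta>))\<^sup>2)) \<and>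
     \<bar>c\<bar> \<le> C1 * (1 + integral {\<theta>2..\<theta>3} (\<lambda>\<theta>. (V (cos \<theta>))\<^sup>2))"
    using riccati_coefficient_bound[OF t23] by metis
  obtain C2 where C2: "C2 > 0" "\<And>a b c V A \<theta>. riccati a b c V \<Longrightarrow> \<bar>a\<bar> \<le> A \<Longrightarrow> \<bar>b\<bar> \<le> A \<Longrightarrow> \<bar>c\<bar> \<le> A \<Longrightarrow>
     \<theta> \<in> {\<theta>1..\<theta>4} \<Longrightarrow> (V (cos \<theta>))\<^sup>2 \<le> C2 * (1 + A)"
    using riccati_pointwise_bound[OF t14] by metis
  have cs: "continuous_on {\<theta>1..\<theta>4} (sin :: real \<Rightarrow> real)" by (intro continuous_on_sin continuous_on_id)
  obtain s where s: "s \<in> {\<theta>1..\<theta>4}" "\<And>t. t \<in> {\<theta>1..\<theta>4} \<Longrightarrow> sin s \<le> sin t"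
    using continuous_attains_inf[OF compact_Icc _ cs] t14 by fastforce
  have m: "sin s > 0" using s t14 by (intro sin_gt_zero) auto
  define D where "D = 2 * pi * (\<theta>4 - \<theta>1) * (C2 * (1 + C1) / sin s)"
  have D: "D > 0" unfolding D_def using t14 C1(1) C2(1) m by (intro mult_pos_pos divide_pos_pos) auto
  show ?thesis
  proof (intro exI[of _ D] conjI D allI impI)
    fix \<nu> u p assume *: "0 < \<nu> \<and> hom_NS_solution \<nu> u p \<and> axisymmetric u \<and> no_swirl u"
    then have \<nu>: "\<nu> > 0" by simp
    obtain a b c V where R: "riccati a b c V" and u: "\<And>X. X \<in> punctured_cone \<Longrightarrow> u X /\<^sub>R \<nu> = riccati_velocity a b c V X"
      using normalized_riccati[of \<nu> u p] * by metis
    define J where "J = integral {\<theta>2..\<theta>3} (\<lambda>\<theta>. (V (cos \<theta>))\<^sup>2 / sin \<theta>)"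
    have J: "J \<ge> 0" "integral {\<theta>2..\<theta>3} (\<lambda>\<theta>. (V (cos \<theta>))\<^sup>2) \<le> J"
      using integral_weight_le[OF R t23(1,3)] by (auto simp: J_def)
    have A: "\<bar>a\<bar> \<le> C1 * (1 + J)" "\<bar>b\<bar> \<le> C1 * (1 + J)" "\<bar>c\<bar> \<le> C1 * (1 + J)"
      using C1(2)[OF R] mult_left_mono[OF add_left_mono[OF J(2), of 1], of C1] C1(1) by linarith+
    have pt: "(V (cos \<theta>))\<^sup>2 / sin \<theta> \<le> C2 * (1 + C1) * (1 + J) / sin s" if t: "\<theta> \<in> {\<theta>1..\<theta>4}" for \<theta>
    proof (rule frac_le)
      have "1 + C1 * (1 + J) \<le> (1 + C1) * (1 + J)" using J by (simp add: algebra_simps)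
      then have "C2 * (1 + C1 * (1 + J)) \<le> C2 * ((1 + C1) * (1 + J))"
        using C2(1) by (intro mult_left_mono) auto
      then show "(V (cos \<theta>))\<^sup>2 \<le> C2 * (1 + C1) * (1 + J)"
        using C2(2)[OF R A t] by (simp only: mult.assoc)
    qed (use m s(2)[OF t] C1 C2 J in auto)
    have sp: "sin \<theta> > 0" if "\<theta> \<in> {\<theta>1..\<theta>4}" for \<theta> using that t14 by (intro sin_gt_zero) auto
    have i: "(\<lambda>\<theta>. (V (cos \<theta>))\<^sup>2 / sin \<theta>) integrable_on {\<theta>1..\<theta>4}"
      using riccati_polar_continuous[OF R t14(1,3)] sp
      by (intro integrable_continuous_interval continuous_intros) force+
    have "integral {\<theta>1..\<theta>4} (\<lambda>\<theta>. (V (cos \<theta>))\<^sup>2 / sin \<theta>) \<le> integral {\<theta>1..\<theta>4} (\<lambda>_. C2 * (1 + C1) * (1 + J) / sin s)"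
      by (rule integral_le[OF i _ pt]) auto
    also have "\<dots> = (\<theta>4 - \<theta>1) * (C2 * (1 + C1) / sin s) * (1 + J)" using t14 by simp
    finally have "2 * pi * \<nu>\<^sup>2 * integral {\<theta>1..\<theta>4} (\<lambda>\<theta>. (V (cos \<theta>))\<^sup>2 / sin \<theta>) \<le> 2 * pi * \<nu>\<^sup>2 * ((\<theta>4 - \<theta>1) * (C2 * (1 + C1) / sin s) * (1 + J))"
      by (intro mult_left_mono) auto
    also have "\<dots> = D * (\<nu>\<^sup>2 * (1 + J))" by (simp add: D_def)
    also have "\<dots> \<le> D * (2 * pi * \<nu>\<^sup>2 * J + \<nu>\<^sup>2)"
    proof (intro mult_left_mono)
      have "1 * (\<nu>\<^sup>2 * J) \<le> 2 * pi * (\<nu>\<^sup>2 * J)" using J pi_gt3 by (intro mult_right_mono) auto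
      then show "\<nu>\<^sup>2 * (1 + J) \<le> 2 * pi * \<nu>\<^sup>2 * J + \<nu>\<^sup>2" by (simp add: algebra_simps)
    qed (use D in simp)
    finally show "zone_integral \<theta>1 \<theta>4 (\<lambda>\<theta> \<phi>. \<bar>comp_theta u 1 \<theta> \<phi>\<bar>\<^sup>2)
             \<le> D * (zone_integral \<theta>2 \<theta>3 (\<lambda>\<theta> \<phi>. \<bar>comp_theta u 1 \<theta> \<phi>\<bar>\<^sup>2) + \<nu>\<^sup>2)"
      using zone_integral_riccati[OF R _ _ _ u \<nu>, of \<theta>1 \<theta>4] zone_integral_riccati[OF R _ _ _ u \<nu>, of \<theta>2 \<theta>3] t14 t23
      by (simp add: J_def)
  qed
qed

text \<open>The hypothesis is a bound on \<open>\<integral> V\<^sub>k\<^sup>2\<close> over a zone for the normalised solutions, and hence on their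
  coefficients.\<close>
theorem subsequence_convergence:
  fixes \<nu> :: "nat \<Rightarrow> real" and u :: "nat \<Rightarrow> real^3 \<Rightarrow> real^3" and p :: "nat \<Rightarrow> real^3 \<Rightarrow> real"
  assumes \<nu>: "\<And>k. 0 < \<nu> k"
    and sol: "\<And>k. hom_NS_solution (\<nu> k) (u k) (p k) \<and> axisymmetric (u k) \<and> no_swirl (u k)"
    and ab: "0 < \<alpha>" "\<alpha> < \<beta>" "\<beta> < pi"
    and bdd: "bdd_above (range (\<lambda>k. zone_integral \<alpha> \<beta> (\<lambda>\<theta> \<phi>. \<bar>comp_theta (u k) 1 \<theta> \<phi>\<bar>\<^sup>2) / (\<nu> k)\<^sup>2))"
  shows "\<exists>u' p'. hom_NS_solution 1 u' p' \<and>
           (\<exists>\<sigma> :: nat \<Rightarrow> nat. strict_mono \<sigma> \<and>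
              (\<forall>\<epsilon>>0. \<forall>m :: nat.
                 (\<lambda>k. zone_Cm_norm m \<epsilon> (pi - \<epsilon>)
                    (\<lambda>x. (u (\<sigma> k) x /\<^sub>R \<nu> (\<sigma> k), p (\<sigma> k) x / (\<nu> (\<sigma> k))\<^sup>2) - (u' x, p' x)))
                 \<longlonglongrightarrow> 0))"
proof -
  have "\<forall>k. \<exists>a b c V. riccati a b c V \<and> (\<forall>X\<in>punctured_cone. u k X /\<^sub>R \<nu> k = riccati_velocity a b c V X) \<and>
      (\<forall>X\<in>punctured_cone. p k X / (\<nu> k)\<^sup>2 = riccati_pressure a b c V X)"
    using normalized_riccati[OF \<nu>] sol by metis
  then obtain a b c V where R: "\<And>k. riccati (a k) (b k) (c k) (V k)"
    and u: "\<And>k X. X \<in> punctured_cone \<Longrightarrow> u k X /\<^sub>R \<nu> k = riccati_velocity (a k) (b k) (c k) (V k) X"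
    and p: "\<And>k X. X \<in> punctured_cone \<Longrightarrow> p k X / (\<nu> k)\<^sup>2 = riccati_pressure (a k) (b k) (c k) (V k) X"
    by metis
  obtain M where M: "\<And>k. zone_integral \<alpha> \<beta> (\<lambda>\<theta> \<phi>. \<bar>comp_theta (u k) 1 \<theta> \<phi>\<bar>\<^sup>2) / (\<nu> k)\<^sup>2 \<le> M"
    using bdd by (auto simp: bdd_above_def)
  have J: "integral {\<alpha>..\<beta>} (\<lambda>\<theta>. (V k (cos \<theta>))\<^sup>2) \<le> M" for k
  proof -
    let ?J = "integral {\<alpha>..\<beta>} (\<lambda>\<theta>. (V k (cos \<theta>))\<^sup>2 / sin \<theta>)"
    have "2 * pi * ?J \<le> M"
      using M[of k] zone_integral_riccati[OF R ab(1) less_imp_le[OF ab(2)] ab(3) u \<nu>, of k] \<nu>[of k] by simp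
    moreover have "1 * ?J \<le> 2 * pi * ?J" using integral_weight_le(2)[OF R ab(1,3), of k] pi_gt3 by (intro mult_right_mono) auto
    ultimately show ?thesis using integral_weight_le(1)[OF R ab(1,3), of k] by linarith
  qed
  obtain C1 where C1: "C1 > 0" "\<And>a b c V. riccati a b c V \<Longrightarrow>
     \<bar>a\<bar> \<le> C1 * (1 + integral {\<alpha>..\<beta>} (\<lambda>\<theta>. (V (cos \<theta>))\<^sup>2)) \<and>
     \<bar>b\<bar> \<le> C1 * (1 + integral {\<alpha>..\<beta>} (\<lambda>\<theta>. (V (cos \<theta>))\<^sup>2)) \<and>
     \<bar>c\<bar> \<le> C1 * (1 + integral {\<alpha>..\<beta>} (\<lambda>\<theta>. (V (cos \<theta>))\<^sup>2))"
    using riccati_coefficient_bound[OF ab] by metis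
  have le: "C1 * (1 + integral {\<alpha>..\<beta>} (\<lambda>\<theta>. (V k (cos \<theta>))\<^sup>2)) \<le> C1 * (1 + M)" for k
    using J[of k] C1(1) by simp
  have A: "\<bar>a k\<bar> \<le> C1 * (1 + M)" "\<bar>b k\<bar> \<le> C1 * (1 + M)" "\<bar>c k\<bar> \<le> C1 * (1 + M)" for k
    using C1(2)[OF R, of k] le[of k] by linarith+
  obtain \<sigma> a' b' c' W where \<sigma>: "strict_mono (\<sigma> :: nat \<Rightarrow> nat)"
    and lim: "(\<lambda>k. a (\<sigma> k)) \<longlonglongrightarrow> a'" "(\<lambda>k. b (\<sigma> k)) \<longlonglongrightarrow> b'" "(\<lambda>k. c (\<sigma> k)) \<longlonglongrightarrow> c'"
    and RW: "riccati a' b' c' W"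
    and ul: "\<forall>d<1. uniform_limit {-d..d} (\<lambda>k. V (\<sigma> k)) W sequentially \<and> bounded (W ` {-d..d})"
    by (rule riccati_compactness[where a=a and b=b and c=c and V=V, OF R A])
  show ?thesis
  proof (intro exI conjI allI impI)
    show "hom_NS_solution 1 (riccati_velocity a' b' c' W) (riccati_pressure a' b' c' W)" by (rule riccati_gives_solution[OF RW])
    show "strict_mono \<sigma>" by (rule \<sigma>)
    fix \<epsilon> :: real and m :: nat assume "\<epsilon> > 0"
    show "(\<lambda>k. zone_Cm_norm m \<epsilon> (pi - \<epsilon>)
                    (\<lambda>x. (u (\<sigma> k) x /\<^sub>R \<nu> (\<sigma> k), p (\<sigma> k) x / (\<nu> (\<sigma> k))\<^sup>2) - (riccati_velocity a' b' c' W x, riccati_pressure a' b' c' W x)))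
                 \<longlonglongrightarrow> 0"
      by (rule riccati_fields_converge[OF R RW lim _ _ \<open>\<epsilon> > 0\<close>]) (use u p ul in auto)
  qed
qed

theorem theorem1p1:
  shows
    "(\<forall>\<theta>1 \<theta>2 \<theta>3 \<theta>4 :: real. 0 < \<theta>1 \<and> \<theta>1 < \<theta>2 \<and> \<theta>2 < \<theta>3 \<and> \<theta>3 < \<theta>4 \<and> \<theta>4 < pi \<longrightarrow>
        (\<exists>C>0. \<forall>\<nu> u p.
           0 < \<nu> \<and> \<nu> < 1 \<and> hom_NS_solution \<nu> u p \<and> axisymmetric u \<and> no_swirl u \<longrightarrow>
           zone_integral \<theta>1 \<theta>4 (\<lambda>\<theta> \<phi>. \<bar>comp_theta u 1 \<theta> \<phi>\<bar>\<^sup>2)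
             \<le> C * (zone_integral \<theta>2 \<theta>3 (\<lambda>\<theta> \<phi>. \<bar>comp_theta u 1 \<theta> \<phi>\<bar>\<^sup>2) + \<nu>\<^sup>2)))
     \<and>
     (\<forall>(\<nu> :: nat \<Rightarrow> real) (u :: nat \<Rightarrow> real^3 \<Rightarrow> real^3) (p :: nat \<Rightarrow> real^3 \<Rightarrow> real).
        (\<forall>k. 0 < \<nu> k) \<and> \<nu> \<longlonglongrightarrow> 0 \<and>
        (\<forall>k. hom_NS_solution (\<nu> k) (u k) (p k) \<and> axisymmetric (u k) \<and> no_swirl (u k)) \<and>
        (\<exists>a b. 0 < a \<and> a < b \<and> b < pi \<and>
           bdd_above (range (\<lambda>k. zone_integral a b (\<lambda>\<theta> \<phi>. \<bar>comp_theta (u k) 1 \<theta> \<phi>\<bar>\<^sup>2) / (\<nu> k)\<^sup>2)))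
        \<longrightarrow>
        (\<exists>u' p'. hom_NS_solution 1 u' p' \<and>
           (\<exists>\<sigma> :: nat \<Rightarrow> nat. strict_mono \<sigma> \<and>
              (\<forall>\<epsilon>>0. \<forall>m :: nat.
                 (\<lambda>k. zone_Cm_norm m \<epsilon> (pi - \<epsilon>)
                    (\<lambda>x. (u (\<sigma> k) x /\<^sub>R \<nu> (\<sigma> k), p (\<sigma> k) x / (\<nu> (\<sigma> k))\<^sup>2) - (u' x, p' x)))
                 \<longlonglongrightarrow> 0))))"
proof (intro conjI allI impI)
  fix \<theta>1 \<theta>2 \<theta>3 \<theta>4 :: real
  assume *: "0 < \<theta>1 \<and> \<theta>1 < \<theta>2 \<and> \<theta>2 < \<theta>3 \<and> \<theta>3 < \<theta>4 \<and> \<theta>4 < pi"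
  then have "0 < \<theta>1" "\<theta>1 < \<theta>2" "\<theta>2 < \<theta>3" "\<theta>3 < \<theta>4" "\<theta>4 < pi" by auto
  from interior_energy_bound[OF this]
  obtain C where "C > 0" and C: "\<And>\<nu> u p. 0 < \<nu> \<and> hom_NS_solution \<nu> u p \<and> axisymmetric u \<and> no_swirl u \<Longrightarrow>
           zone_integral \<theta>1 \<theta>4 (\<lambda>\<theta> \<phi>. \<bar>comp_theta u 1 \<theta> \<phi>\<bar>\<^sup>2)
             \<le> C * (zone_integral \<theta>2 \<theta>3 (\<lambda>\<theta> \<phi>. \<bar>comp_theta u 1 \<theta> \<phi>\<bar>\<^sup>2) + \<nu>\<^sup>2)" by blast
  show "\<exists>C>0. \<forall>\<nu> u p.
           0 < \<nu> \<and> \<nu> < 1 \<and> hom_NS_solution \<nu> u p \<and> axisymmetric u \<and> no_swirl u \<longrightarrow>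
           zone_integral \<theta>1 \<theta>4 (\<lambda>\<theta> \<phi>. \<bar>comp_theta u 1 \<theta> \<phi>\<bar>\<^sup>2)
             \<le> C * (zone_integral \<theta>2 \<theta>3 (\<lambda>\<theta> \<phi>. \<bar>comp_theta u 1 \<theta> \<phi>\<bar>\<^sup>2) + \<nu>\<^sup>2)"
    by (intro exI[of _ C] conjI allI impI \<open>C > 0\<close>, rule C) (elim conjE, intro conjI)
next
  fix \<nu> :: "nat \<Rightarrow> real" and u :: "nat \<Rightarrow> real^3 \<Rightarrow> real^3" and p :: "nat \<Rightarrow> real^3 \<Rightarrow> real"
  assume H: "(\<forall>k. 0 < \<nu> k) \<and> \<nu> \<longlonglongrightarrow> 0 \<and>
        (\<forall>k. hom_NS_solution (\<nu> k) (u k) (p k) \<and> axisymmetric (u k) \<and> no_swirl (u k)) \<and>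
        (\<exists>a b. 0 < a \<and> a < b \<and> b < pi \<and>
           bdd_above (range (\<lambda>k. zone_integral a b (\<lambda>\<theta> \<phi>. \<bar>comp_theta (u k) 1 \<theta> \<phi>\<bar>\<^sup>2) / (\<nu> k)\<^sup>2)))"
  then obtain a b where ab: "0 < a" "a < b" "b < pi" and
    bdd: "bdd_above (range (\<lambda>k. zone_integral a b (\<lambda>\<theta> \<phi>. \<bar>comp_theta (u k) 1 \<theta> \<phi>\<bar>\<^sup>2) / (\<nu> k)\<^sup>2))"
    by blast
  show "\<exists>u' p'. hom_NS_solution 1 u' p' \<and>
           (\<exists>\<sigma> :: nat \<Rightarrow> nat. strict_mono \<sigma> \<and>
              (\<forall>\<epsilon>>0. \<forall>m :: nat.
                 (\<lambda>k. zone_Cm_norm m \<epsilon> (pi - \<epsilon>)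
                    (\<lambda>x. (u (\<sigma> k) x /\<^sub>R \<nu> (\<sigma> k), p (\<sigma> k) x / (\<nu> (\<sigma> k))\<^sup>2) - (u' x, p' x)))
                 \<longlonglongrightarrow> 0))"
    by (rule subsequence_convergence[OF _ _ ab bdd]) (use H in blast)+
qed

end
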